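(* Let $N,n\ge1$ be integers and $1\le p\le\infty$. If $f\in H(\mathbb B_N)$ and $$\int_0^1(1-r)^{n-1}M_p(r,\mathcal R^nf)\,dr<\infty,$$ then $f\in H^p(\mathbb B_N)$ and $$\omega_n^+(\delta,f)_p\le C\int_{1-\delta}^1M_p(r,\mathcal R^nf)(1-r)^{n-1}\,dr,\quad 0<\delta<1,$$ where $C$ is a constant independent of $f$ and $\delta$.
   Context: $\mathbb B_N$ is the unit ball of $\mathbb C^N$, $\mathbb S_N=\partial\mathbb B_N$, $\sigma$ is the normalized Lebesgue measure on $\mathbb S_N$, and $H(\mathbb B_N)$ is the space of holomorphic functions on $\mathbb B_N$. For $0<r<1$, $M_p(r,g)=\left(\int_{\mathbb S_N}|g(r\zeta)|^p\,d\sigma(\zeta)\right)^{1/p}$ for $p<\infty$ and $M_\infty(r,g)=\operatorname{ess\,sup}_{\zeta\in\mathbb S_N}|g(r\zeta)|$. $H^p(\mathbb B_N)$ is the space of $f\in H(\mathbb B_N)$ with $\|f\|_p:=\sup_{0<r<1}M_p(r,f)<\infty$. If $f=\sum_{k\ge0}f_k$ is the homogeneous expansion of $f$, then $\mathcal R^nf=\sum_{k\ge1}k^nf_k$. Let $\mathcal L$ be the semigroup of all linear operators from $\mathbb B_N$ to $\mathbb B_N$ and $I$ the identity. For $U\in\mathcal L$, $\Delta^1_Uf(z)=f(Uz)-f(z)$ and $\Delta^n_Uf=\Delta^1_U(\Delta^{n-1}_Uf)$ for $n\ge2$; $\omega_n^+(\delta,f)_p=\sup_{\|U-I\|<\delta,\,U\in\mathcal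 L}\|\Delta^n_Uf\|_p$. *)

theory Defs
  imports "HOL-Probability.Probability"
begin

text \<open>
  Points of \<open>\<complex>\<^sup>N\<close> are vectors of type \<^typ>\<open>complex ^ 'd\<close> with \<open>N = CARD('d)\<close>; the norm of
  this type is the Euclidean (Hermitian) one, so the unit ball is \<^term>\<open>ball 0 1\<close>.
  Functions on the ball are total functions whose values outside the ball play no role.
\<close>

definition holomorphic_fun_on :: "(complex ^ 'd \<Rightarrow> complex) \<Rightarrow> (complex ^ 'd) set \<Rightarrow> bool" where
  "holomorphic_fun_on f S \<longleftrightarrow>
     (\<forall>z\<in>S. \<exists>D. Vector_Spaces.linear (*s) (*) D \<and> (f has_derivative D) (at z))"

text \<open>
  The normalized Lebesgue measure on the unit sphere: the measure of \<open>A\<close> is the proportion of the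
  volume of the unit ball taken by the cone \<open>{r \<zeta> | 0 < r < 1, \<zeta> \<in> A}\<close>
  (note \<^term>\<open>sgn z = z /\<^sub>R norm z\<close>).
\<close>

definition sphere_measure :: "(complex ^ 'd) measure" where
  "sphere_measure =
     restrict_space (distr (uniform_measure lborel (ball 0 1)) borel sgn) (sphere 0 1)"

text \<open>
  The integral means, for \<open>1 \<le> p \<le> \<infinity>\<close>, with values in \<open>[0,\<infinity>]\<close>.
\<close>

definition integral_mean :: "ennreal \<Rightarrow> real \<Rightarrow> (complex ^ 'd \<Rightarrow> complex) \<Rightarrow> ennreal" where
  "integral_mean p r g =
     (if p = \<top> then esssup sphere_measure (\<lambda>\<zeta>. ennreal (norm (g (r *\<^sub>R \<zeta>))))
      else let I = \<integral>\<^sup>+ \<zeta>. ennreal (norm (g (r *\<^sub>R \<zeta>)) powr enn2real p) \<partial>sphere_measure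
           in if I = \<top> then \<top> else ennreal (enn2real I powr (1 / enn2real p)))"

definition hardy_norm :: "ennreal \<Rightarrow> (complex ^ 'd \<Rightarrow> complex) \<Rightarrow> ennreal" where
  "hardy_norm p g = (SUP r\<in>{0<..<1}. integral_mean p r g)"

definition hardy_space :: "ennreal \<Rightarrow> (complex ^ 'd \<Rightarrow> complex) set" where
  "hardy_space p = {f. holomorphic_fun_on f (ball 0 1) \<and> hardy_norm p f < \<top>}"

definition homogeneous_polynomial :: "nat \<Rightarrow> (complex ^ 'd \<Rightarrow> complex) \<Rightarrow> bool" where
  "homogeneous_polynomial k P \<longleftrightarrow>
     (\<exists>c :: ('d \<Rightarrow> nat) \<Rightarrow> complex. \<forall>z.
        P z = (\<Sum>\<alpha> | (\<Sum>i\<in>UNIV. \<alpha> i) = k. c \<alpha> * (\<Prod>i\<in>UNIV. (z $ i) ^ \<alpha> i)))"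

definition is_homogeneous_expansion ::
    "(complex ^ 'd \<Rightarrow> complex) \<Rightarrow> (nat \<Rightarrow> complex ^ 'd \<Rightarrow> complex) \<Rightarrow> bool" where
  "is_homogeneous_expansion f F \<longleftrightarrow>
     (\<forall>k. homogeneous_polynomial k (F k)) \<and> (\<forall>z\<in>ball 0 1. (\<lambda>k. F k z) sums f z)"

text \<open>
  Every function holomorphic on the ball has exactly one homogeneous expansion: uniqueness holds
  already for pointwise convergence, since on each complex line through \<open>0\<close> the expansion is a
  power series.
\<close>

definition homogeneous_part ::
    "(complex ^ 'd \<Rightarrow> complex) \<Rightarrow> nat \<Rightarrow> complex ^ 'd \<Rightarrow> complex" where
  "homogeneous_part f = (THE F. is_homogeneous_expansion f F)"

definition radial_deriv :: "nat \<Rightarrow> (complex ^ 'd \<Rightarrow> complex) \<Rightarrow> complex ^ 'd \<Rightarrow> complex" where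
  "radial_deriv n f z = (\<Sum>k. of_nat (Suc k) ^ n * homogeneous_part f (Suc k) z)"

definition ball_operators :: "(complex ^ 'd \<Rightarrow> complex ^ 'd) set" where
  "ball_operators = {U. Vector_Spaces.linear (*s) (*s) U \<and> U ` ball 0 1 \<subseteq> ball 0 1}"

definition op_diff ::
    "(complex ^ 'd \<Rightarrow> complex ^ 'd) \<Rightarrow> (complex ^ 'd \<Rightarrow> complex) \<Rightarrow> complex ^ 'd \<Rightarrow> complex" where
  "op_diff U f = (\<lambda>z. f (U z) - f z)"

definition modulus_plus :: "nat \<Rightarrow> real \<Rightarrow> (complex ^ 'd \<Rightarrow> complex) \<Rightarrow> ennreal \<Rightarrow> ennreal" where
  "modulus_plus n \<delta> f p =
     (SUP U\<in>{U \<in> ball_operators. onorm (\<lambda>z. U z - z) < \<delta>}. hardy_norm p ((op_diff U ^^ n) f))"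

end

theory Submission
  imports Defs "HOL-Complex_Analysis.Cauchy_Integral_Formula"
begin

text \<open>
  Write \<open>R\<close> for the radial derivative and \<open>M\<^sub>p(r, g)\<close> for the integral means.  Along each ray \<open>R\<close> is
  differentiation with respect to \<open>ln t\<close>, so Taylor's formula between \<open>\<rho> z\<close> and \<open>z\<close> writes \<open>f(z)\<close> as the sum of
  the terms \<open>(- ln \<rho>)\<^sup>j / j! R\<^sup>j f(\<rho> z)\<close>, \<open>j < n\<close>, and of the integral of \<open>(- ln t)\<^sup>n\<^sup>-\<^sup>1 / (n-1)! R\<^sup>n f(t z) / t\<close> over
  \<open>\<rho> < t < 1\<close>.  By Minkowski's integral inequality the mean of the remainder is at most a constant times the
  integral of \<open>(1 - t)\<^sup>n\<^sup>-\<^sup>1 M\<^sub>p(t, R\<^sup>n f)\<close> over the same interval.  With \<open>\<rho> = 1/2\<close> this puts \<open>f\<close> into the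
  Hardy space; for the modulus of smoothness take \<open>\<rho> = 1 - \<delta>/2\<close>.

  Composition with a linear contraction \<open>U\<close> does not increase the means (\<open>Lp_le_ball_operator\<close>), so \<open>n\<close>
  differences of the remainder cost at most a factor \<open>2\<^sup>n\<close>.  For the Taylor polynomial the key is the
  first-order estimate \<open>M\<^sub>p(r, \<Delta>\<^sub>U g) \<le> K \<delta> M\<^sub>p(r, R g)\<close> (\<open>Lp_le_op_diff\<close>).  Since \<open>R\<close> commutes with composition
  by \<open>U\<close>, it can be iterated: of the \<open>n\<close> differences applied to the \<open>j\<close>th term, \<open>n - j\<close> are turned into
  radial derivatives, and every term is bounded by \<open>\<delta>\<^sup>n M\<^sub>p(\<rho>, R\<^sup>n f)\<close>.  As \<open>M\<^sub>p\<close> increases with the radius, this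
  is again at most a constant times the integral over \<open>\<rho> < t < 1\<close>.

  The first-order estimate amounts to bounding all partial derivatives of \<open>g\<close> in the mean by \<open>R g\<close>.  The
  derivative in a complex tangential direction \<open>w\<close> is the integral over \<open>0 < t < 1\<close> of the same derivative of \<open>R g\<close>
  at \<open>t z\<close>.  A Cauchy estimate loses the reciprocal of the radius of a disc around \<open>t z\<close> inside the ball of radius
  \<open>norm z\<close>.  In a tangential direction that radius is of the order of \<open>\<surd>(1 - t)\<close>, and the loss is
  integrable; the radius \<open>1 - t\<close> of a radial disc would lead to a logarithmically divergent integral.

  That contractions do not increase the means is a maximum principle: the mean of \<open>h \<circ> U\<close> is subharmonic
  in the matrix \<open>U\<close>, and a contraction that is not unitary is the centre of a disc of contractions
  (\<open>contraction_perturbation\<close>).  So the largest value is attained at unitary matrices, which preserve the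
  measure on the sphere.
\<close>

section \<open>Cauchy integrals on complex lines\<close>

lemma circle_mean_value:
  assumes hol: "\<phi> holomorphic_on cball 0 \<rho>" and \<rho>: "\<rho> > 0"
  shows "((\<lambda>t. \<phi> (of_real \<rho> * cis (2 * pi * t))) has_integral \<phi> 0) {0..1}"
    and "((\<lambda>t. \<phi> (of_real \<rho> * cis (2 * pi * t)) * cis (- (2 * pi * t)) / of_real \<rho>)
            has_integral deriv \<phi> 0) {0..1}"
proof -
  have c: "continuous_on (cball 0 \<rho>) \<phi>" and h: "\<phi> holomorphic_on ball 0 \<rho>"
    using hol by (auto intro: holomorphic_on_imp_continuous_on holomorphic_on_subset)
  have e: "exp (2 * of_real pi * \<i> * of_real x) = cis (2 * pi * x)" for x
    by (simp add: cis_conv_exp mult_ac)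
  have *: "((\<lambda>t. (\<phi> (of_real \<rho> * cis (2 * pi * t)) / (of_real \<rho> * cis (2 * pi * t)) ^ Suc k)
             * (2 * of_real pi * \<i> * of_real \<rho> * cis (2 * pi * t)))
            has_integral (2 * of_real pi * \<i> / fact k * (deriv ^^ k) \<phi> 0)) {0..1}" for k
  proof (rule has_integral_eq)
    show "((\<lambda>x. \<phi> (circlepath 0 \<rho> x) / circlepath 0 \<rho> x ^ Suc k *
            vector_derivative (circlepath 0 \<rho>) (at x within {0..1}))
            has_integral (2 * of_real pi * \<i> / fact k * (deriv ^^ k) \<phi> 0)) {0..1}"
      using Cauchy_has_contour_integral_higher_derivative_circlepath[OF c h, of 0 k] \<rho>
      unfolding has_contour_integral_def by simp
    fix t :: real assume "t \<in> {0..1}"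
    then have d: "vector_derivative (circlepath 0 \<rho>) (at t within {0..1}) =
        2 * of_real pi * \<i> * of_real \<rho> * cis (2 * pi * t)"
      using vector_derivative_circlepath01[of t 0 \<rho>] by (simp add: e)
    have p: "circlepath 0 \<rho> t = of_real \<rho> * cis (2 * pi * t)"
      by (simp add: circlepath e)
    show "\<phi> (circlepath 0 \<rho> t) / circlepath 0 \<rho> t ^ Suc k *
            vector_derivative (circlepath 0 \<rho>) (at t within {0..1}) =
          (\<phi> (of_real \<rho> * cis (2 * pi * t)) / (of_real \<rho> * cis (2 * pi * t)) ^ Suc k)
             * (2 * of_real pi * \<i> * of_real \<rho> * cis (2 * pi * t))"
      unfolding d p ..
  qed
  have **: "((\<lambda>t. (1 / (2 * of_real pi * \<i>)) * ((\<phi> (of_real \<rho> * cis (2 * pi * t)) / (of_real \<rho> * cis (2 * pi * t)) ^ Suc k)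
             * (2 * of_real pi * \<i> * of_real \<rho> * cis (2 * pi * t))))
            has_integral (1 / (2 * of_real pi * \<i>)) * (2 * of_real pi * \<i> / fact k * (deriv ^^ k) \<phi> 0)) {0..1}" for k
    by (rule has_integral_mult_right[OF *])
  show "((\<lambda>t. \<phi> (of_real \<rho> * cis (2 * pi * t))) has_integral \<phi> 0) {0..1}"
    using **[of 0] \<rho> by (simp add: field_simps)
  show "((\<lambda>t. \<phi> (of_real \<rho> * cis (2 * pi * t)) * cis (- (2 * pi * t)) / of_real \<rho>)
            has_integral deriv \<phi> 0) {0..1}"
    using **[of 1] \<rho> by (simp add: field_simps power2_eq_square cis_inverse[symmetric] del: cis_inverse)
qed

abbreviation cderiv :: "(complex ^ 'd \<Rightarrow> complex) \<Rightarrow> complex ^ 'd \<Rightarrow> complex ^ 'd \<Rightarrow> complex"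
  where "cderiv f z \<equiv> frechet_derivative f (at z)"

lemma holomorphic_fun_on_alt:
  "holomorphic_fun_on f S \<longleftrightarrow>
    (\<forall>z\<in>S. (f has_derivative cderiv f z) (at z) \<and> (\<forall>c v. cderiv f z (c *s v) = c * cderiv f z v))"
  (is "?l \<longleftrightarrow> ?r")
proof
  assume ?l
  then show ?r unfolding holomorphic_fun_on_def
    by (metis frechet_derivative_at vec.linear_scale_left Vector_Spaces.linear_def module_hom.scale module_hom_iff)
next
  assume r: ?r
  show ?l unfolding holomorphic_fun_on_def
  proof
    fix z assume "z \<in> S"
    with r have d: "(f has_derivative cderiv f z) (at z)" and
      s: "\<And>c v. cderiv f z (c *s v) = c * cderiv f z v" by auto
    have "linear (cderiv f z)" using d has_derivative_linear by blast
    then have "Vector_Spaces.linear (*s) (*) (cderiv f z)"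
      unfolding Vector_Spaces.linear_def module_hom_def module_hom_axioms_def
      using s vector_space_over_itself.vector_space_axioms 
      by (auto simp: linear_add vec.vector_space_axioms vector_space_over_itself.module_axioms vec.module_axioms)
    with d show "\<exists>D. Vector_Spaces.linear (*s) (*) D \<and> (f has_derivative D) (at z)" by blast
  qed
qed

lemma has_derivative_vector_smult:
  "((\<lambda>l. a + l *s v) has_derivative (\<lambda>l. l *s v)) (at (l0::complex) within T)" for a v :: "complex ^ 'd"
proof -
  have "bounded_linear (\<lambda>l::complex. l *s v)"
    by (rule linear_conv_bounded_linear[THEN iffD1], rule linearI)
       (simp_all add: vec_eq_iff algebra_simps)
  from bounded_linear.has_derivative[OF this has_derivative_ident] show ?thesis
    by (auto intro!: derivative_eq_intros)
qed

lemma norm_vector_smult: "norm (c *s v) = norm c * norm (v :: complex ^ 'd)"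
  unfolding norm_vec_def L2_set_def
  by (simp add: norm_mult power_mult_distrib sum_distrib_left[symmetric] real_sqrt_mult)

lemma continuous_on_vector_smult [continuous_intros]:
  assumes "continuous_on S f" "continuous_on S g"
  shows "continuous_on S (\<lambda>x. f x *s (g x :: complex ^ 'd))"
proof -
  have "continuous_on S (\<lambda>x. \<chi> i. f x * g x $ i)"
    using assms by (intro continuous_intros)
  then show ?thesis by (simp add: vector_scalar_mult_def)
qed

lemma holomorphic_fun_on_slice:
  assumes f: "holomorphic_fun_on f S" and l: "z + l *s v \<in> S"
  shows "((\<lambda>l. f (z + l *s v)) has_field_derivative cderiv f (z + l *s v) v) (at l)"
proof -
  from f l have d: "(f has_derivative cderiv f (z + l *s v)) (at (z + l *s v))"
    and s: "cderiv f (z + l *s v) (c *s w) = c * cderiv f (z + l *s v) w" for c w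
    by (auto simp: holomorphic_fun_on_alt)
  have "((\<lambda>l. f (z + l *s v)) has_derivative (\<lambda>h. cderiv f (z + l *s v) (h *s v))) (at l)"
    by (rule has_derivative_compose[OF has_derivative_vector_smult d])
  then show ?thesis
    by (simp add: has_field_derivative_def s mult.commute[of _ "cderiv f (z + l *s v) v"])
qed

lemma holomorphic_fun_on_imp_continuous_on:
  assumes "holomorphic_fun_on f S" shows "continuous_on S f"
  using assms unfolding holomorphic_fun_on_alt
  by (meson continuous_at_imp_continuous_on has_derivative_continuous)

lemma
  assumes f: "holomorphic_fun_on f S" and \<rho>: "\<rho> > 0"
    and S: "\<And>l. norm l \<le> \<rho> \<Longrightarrow> z + l *s v \<in> S"
  shows holomorphic_fun_on_circle_mean:
      "((\<lambda>t. f (z + (of_real \<rho> * cis (2 * pi * t)) *s v)) has_integral f z) {0..1}"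
    and holomorphic_fun_on_circle_deriv:
      "((\<lambda>t. f (z + (of_real \<rho> * cis (2 * pi * t)) *s v) * cis (- (2 * pi * t)) / of_real \<rho>)
          has_integral cderiv f z v) {0..1}"
proof -
  define \<phi> where "\<phi> = (\<lambda>l. f (z + l *s v))"
  have d: "(\<phi> has_field_derivative cderiv f (z + l *s v) v) (at l)" if "norm l \<le> \<rho>" for l
    unfolding \<phi>_def by (rule holomorphic_fun_on_slice[OF f S[OF that]])
  have h: "\<phi> holomorphic_on cball 0 \<rho>"
    unfolding holomorphic_on_def field_differentiable_def
    using d has_field_derivative_at_within by (metis dist_0_norm mem_cball)
  have "deriv \<phi> 0 = cderiv f z v" using DERIV_imp_deriv[OF d[of 0]] \<rho> by simp
  with circle_mean_value[OF h \<rho>]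
  show "((\<lambda>t. f (z + (of_real \<rho> * cis (2 * pi * t)) *s v)) has_integral f z) {0..1}"
    "((\<lambda>t. f (z + (of_real \<rho> * cis (2 * pi * t)) *s v) * cis (- (2 * pi * t)) / of_real \<rho>)
          has_integral cderiv f z v) {0..1}"
    by (simp_all add: \<phi>_def)
qed

lemma polydisc_room:
  fixes v :: "complex ^ 'd"
  assumes "open S" "z0 \<in> S"
  obtains e \<rho> where "e > 0" "\<rho> > 0" "\<And>z l::complex. z \<in> ball z0 e \<Longrightarrow> norm l \<le> \<rho> \<Longrightarrow> z + l *s v \<in> S"
proof -
  obtain e where e: "e > 0" "ball z0 e \<subseteq> S" using assms open_contains_ball by blast
  define \<rho> where "\<rho> = e / 2 / (1 + norm v)"
  have \<rho>: "\<rho> > 0" using e by (simp add: \<rho>_def add_pos_nonneg)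
  have \<rho>v: "\<rho> * norm v \<le> e / 2"
    using e by (simp add: \<rho>_def field_simps add_pos_nonneg mult_left_mono)
  show ?thesis
  proof
    fix z and l :: complex assume z: "z \<in> ball z0 (e/2)" and l: "norm l \<le> \<rho>"
    have "norm (l *s v) \<le> e/2"
      using mult_right_mono[OF l norm_ge_zero[of v]] \<rho>v by (simp add: norm_vector_smult)
    then have "dist z0 (z + l *s v) < e"
      using z norm_triangle_ineq4[of "z0 - z" "l *s v"]
      by (auto simp: dist_norm algebra_simps)
    then show "z + l *s v \<in> S" using e by auto
  qed (use e \<rho> in auto)
qed

lemma continuous_on_cderiv:
  assumes f: "holomorphic_fun_on f S" and S: "open S"
  shows "continuous_on S (\<lambda>z. cderiv f z v)"
proof -
  have "\<exists>T. open T \<and> z0 \<in> T \<and> T \<subseteq> S \<and> continuous_on T (\<lambda>z. cderiv f z v)" if z0: "z0 \<in> S" for z0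
  proof -
    obtain e \<rho> where e: "e > 0" and \<rho>: "\<rho> > 0"
      and in_S: "\<And>z l. z \<in> ball z0 e \<Longrightarrow> norm l \<le> \<rho> \<Longrightarrow> z + l *s v \<in> S"
      using polydisc_room[OF S z0] by metis
    have eq: "cderiv f z v = integral (cbox 0 1)
        (\<lambda>t. f (z + (of_real \<rho> * cis (2 * pi * t)) *s v) * cis (- (2 * pi * t)) / of_real \<rho>)"
      if "z \<in> ball z0 e" for z
      using integral_unique[OF holomorphic_fun_on_circle_deriv[OF f \<rho> in_S[OF that]]] by simp
    have "continuous_on (ball z0 e) (\<lambda>z. integral (cbox 0 1)
        (\<lambda>t::real. f (z + (of_real \<rho> * cis (2 * pi * t)) *s v) * cis (- (2 * pi * t)) / of_real \<rho>))"
      using in_S \<rho>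
      by (intro integral_continuous_on_param)
         (auto simp: case_prod_unfold norm_mult intro!: continuous_intros
            continuous_on_compose2[OF holomorphic_fun_on_imp_continuous_on[OF f]])
    then have "continuous_on (ball z0 e) (\<lambda>z. cderiv f z v)"
      using eq by (simp cong: continuous_on_cong_simp)
    moreover have "ball z0 e \<subseteq> S" using in_S[of _ 0] \<rho> by auto
    ultimately show ?thesis using e by (intro exI[of _ "ball z0 e"]) auto
  qed
  then show ?thesis
    by (metis S continuous_on_eq_continuous_at continuous_at_imp_continuous_on)
qed

text \<open>
  Differentiation of Cauchy's formula under the integral sign: the derivative in the direction \<open>w\<close> of
  the derivative in the direction \<open>v\<close> is the Cauchy integral, along the line in direction \<open>v\<close>, of the derivative
  in the direction \<open>w\<close>.  This gives both the complex linearity in \<open>w\<close> and the symmetry.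
\<close>

lemma
  assumes f: "holomorphic_fun_on f S" and S: "open S"
  shows holomorphic_fun_on_cderiv: "holomorphic_fun_on (\<lambda>z. cderiv f z v) S"
    and cderiv_commute: "z0 \<in> S \<Longrightarrow> cderiv (\<lambda>z. cderiv f z v) z0 w = cderiv (\<lambda>z. cderiv f z w) z0 v"
proof -
  let ?D = "\<lambda>\<rho> v z w. integral {0..1} (\<lambda>t. cderiv f (z + (of_real \<rho> * cis (2 * pi * t)) *s v) w * cis (- (2 * pi * t)) / of_real \<rho>)"
  have *: "\<exists>\<rho>>0. (\<forall>l. norm l \<le> \<rho> \<longrightarrow> z0 + l *s v \<in> S) \<and> ((\<lambda>z. cderiv f z v) has_derivative ?D \<rho> v z0) (at z0)"
    if z0: "z0 \<in> S" for z0 v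
  proof -
    obtain e \<rho> where e: "e > 0" and \<rho>: "\<rho> > 0"
      and in_S: "\<And>z l. z \<in> ball z0 e \<Longrightarrow> norm l \<le> \<rho> \<Longrightarrow> z + l *s v \<in> S"
      using polydisc_room[OF S z0] by metis
    define F where "F = (\<lambda>z (t::real). f (z + (of_real \<rho> * cis (2 * pi * t)) *s v) * (cis (- (2 * pi * t)) / of_real \<rho>))"
    define B where "B = (\<lambda>z. Blinfun (cderiv f z))"
    have bl: "bounded_linear (cderiv f z)" if "z \<in> S" for z
      using f that by (auto simp: holomorphic_fun_on_alt dest: has_derivative_bounded_linear)
    have B: "blinfun_apply (B z) = cderiv f z" if "z \<in> S" for z
      using bl[OF that] by (simp add: B_def bounded_linear_Blinfun_apply)
    have Bc: "continuous_on S B"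
    proof (rule continuous_on_blinfun_componentwise)
      fix i show "continuous_on S (\<lambda>x. blinfun_apply (B x) i)"
        using continuous_on_cderiv[OF f S, of i] B by (simp cong: continuous_on_cong_simp)
    qed
    define F' where "F' = (\<lambda>z (t::real). blinfun_mult_left (cis (- (2 * pi * t)) / of_real \<rho>)
        o\<^sub>L B (z + (of_real \<rho> * cis (2 * pi * t)) *s v))"
    have dF: "((\<lambda>z. F z t) has_derivative blinfun_apply (F' z t)) (at z within ball z0 e)"
      if z: "z \<in> ball z0 e" and t: "t \<in> cbox 0 1" for z t
    proof -
      let ?y = "z + (of_real \<rho> * cis (2 * pi * t)) *s v"
      have y: "?y \<in> S" using in_S[OF z] \<rho> by (simp add: norm_mult)
      have "(f has_derivative cderiv f ?y) (at ?y)" using f y by (auto simp: holomorphic_fun_on_alt)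
      then have "((\<lambda>z. f (z + (of_real \<rho> * cis (2 * pi * t)) *s v)) has_derivative cderiv f ?y) (at z)"
        by (rule has_derivative_compose[rotated]) (auto intro!: derivative_eq_intros)
      from has_derivative_mult_left[OF this, of "cis (- (2 * pi * t)) / of_real \<rho>"]
      moreover have "blinfun_apply (F' z t) = (\<lambda>w. cderiv f ?y w * (cis (- (2 * pi * t)) / of_real \<rho>))"
        by (simp add: fun_eq_iff F'_def B[OF y])
      ultimately show ?thesis
        unfolding F_def by (simp only: has_derivative_at_withinI)
    qed
    have cf: "continuous_on (cbox 0 1) (F z)" if "z \<in> ball z0 e" for z
      unfolding F_def using in_S[OF that] \<rho>
      by (auto simp: norm_mult intro!: continuous_intros
            continuous_on_compose2[OF holomorphic_fun_on_imp_continuous_on[OF f]])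
    have int: "F z integrable_on cbox 0 1" if "z \<in> ball z0 e" for z
      by (rule integrable_continuous[OF cf[OF that]])
    have cF': "continuous_on (ball z0 e \<times> cbox 0 1) (\<lambda>(z, t). F' z t)"
      unfolding F'_def case_prod_unfold using in_S \<rho>
      by (auto simp: norm_mult intro!: continuous_intros
            continuous_on_compose2[OF Bc] bounded_linear.continuous_on[OF bounded_linear_blinfun_mult_left])
    have z0e: "z0 \<in> ball z0 e" using e by simp
    have "((\<lambda>z. integral (cbox 0 1) (F z)) has_derivative integral (cbox 0 1) (F' z0)) (at z0 within ball z0 e)"
      by (rule leibniz_rule[OF dF int cF' z0e convex_ball])
    then have D: "((\<lambda>z. integral (cbox 0 1) (F z)) has_derivative integral (cbox 0 1) (F' z0)) (at z0)"
      using e by (simp add: at_within_open[OF z0e])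
    have *: "blinfun_apply (integral (cbox 0 1) (F' z0)) w = ?D \<rho> v z0 w" for w
    proof -
      have "F' z0 integrable_on cbox 0 1"
        by (rule integrable_continuous, rule continuous_on_compose2[OF cF', of _ "\<lambda>t. (z0, t)", simplified])
           (auto intro!: continuous_intros simp: e)
      then have "blinfun_apply (integral (cbox 0 1) (F' z0)) w = integral (cbox 0 1) (\<lambda>t. blinfun_apply (F' z0 t) w)"
        by (rule blinfun_apply_integral)
      also have "\<dots> = ?D \<rho> v z0 w"
        unfolding cbox_interval
        by (rule integral_cong) (use in_S[OF z0e] \<rho> in \<open>simp add: F'_def B norm_mult\<close>)
      finally show ?thesis .
    qed
    have **: "blinfun_apply (integral (cbox 0 1) (F' z0)) = (?D \<rho> v z0)"
      by (rule ext, rule *)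
    have D': "((\<lambda>z. integral (cbox 0 1) (F z)) has_derivative (?D \<rho> v z0)) (at z0)"
      using D unfolding ** .
 have eq: "integral (cbox 0 1) (F z) = cderiv f z v" if "z \<in> ball z0 e" for z
      using integral_unique[OF holomorphic_fun_on_circle_deriv[OF f \<rho> in_S[OF that]]] 
      by (simp add: F_def)
    have "((\<lambda>z. cderiv f z v) has_derivative (?D \<rho> v z0)) (at z0)"
      by (rule has_derivative_transform_within_open[OF D' open_ball z0e]) (rule eq)
    then show ?thesis using \<rho> in_S[OF z0e] by auto
  qed
  have hol: "holomorphic_fun_on (\<lambda>z. cderiv f z v) S" for v
    unfolding holomorphic_fun_on_alt
  proof (intro ballI conjI allI)
    fix z0 assume z0: "z0 \<in> S"
    obtain \<rho> where \<rho>: "\<rho> > 0" "\<And>l. norm l \<le> \<rho> \<Longrightarrow> z0 + l *s v \<in> S" and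
      d: "((\<lambda>z. cderiv f z v) has_derivative ?D \<rho> v z0) (at z0)" using *[OF z0] by blast
    have eq: "cderiv (\<lambda>z. cderiv f z v) z0 = (?D \<rho> v z0)"
      using frechet_derivative_at[OF d] by simp
    show "((\<lambda>z. cderiv f z v) has_derivative cderiv (\<lambda>z. cderiv f z v) z0) (at z0)"
      using d eq by simp
    fix c w
    show "cderiv (\<lambda>z. cderiv f z v) z0 (c *s w) = c * cderiv (\<lambda>z. cderiv f z v) z0 w"
      unfolding eq
    proof (subst integral_mult_right[symmetric], rule integral_cong)
      fix t :: real
      have "cderiv f (z0 + (of_real \<rho> * cis (2 * pi * t)) *s v) (c *s w) = c * cderiv f (z0 + (of_real \<rho> * cis (2 * pi * t)) *s v) w"
        using f \<rho> by (simp add: holomorphic_fun_on_alt norm_mult)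
      then show "cderiv f (z0 + (of_real \<rho> * cis (2 * pi * t)) *s v) (c *s w) * cis (- (2 * pi * t)) / of_real \<rho> =
          c * (cderiv f (z0 + (of_real \<rho> * cis (2 * pi * t)) *s v) w * cis (- (2 * pi * t)) / of_real \<rho>)"
        by simp
    qed
  qed
  then show "holomorphic_fun_on (\<lambda>z. cderiv f z v) S" .
  assume z0: "z0 \<in> S"
  obtain \<rho> where \<rho>: "\<rho> > 0" "\<And>l. norm l \<le> \<rho> \<Longrightarrow> z0 + l *s v \<in> S" and
      d: "((\<lambda>z. cderiv f z v) has_derivative ?D \<rho> v z0) (at z0)" using *[OF z0] by blast
  show "cderiv (\<lambda>z. cderiv f z v) z0 w = cderiv (\<lambda>z. cderiv f z w) z0 v"
    using integral_unique[OF holomorphic_fun_on_circle_deriv[OF hol[of w] \<rho>]]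
      frechet_derivative_at[OF d] by (simp add: fun_eq_iff)
qed

section \<open>Holomorphic functions and the radial derivative\<close>

lemma holomorphic_fun_onI:
  fixes f :: "complex ^ 'd \<Rightarrow> complex"
  assumes "\<And>z. z \<in> S \<Longrightarrow> (f has_derivative D z) (at z)"
    and "\<And>z c v. z \<in> S \<Longrightarrow> D z (c *s v) = c * D z v"
  shows "holomorphic_fun_on f S"
  unfolding holomorphic_fun_on_alt using assms
  by (metis frechet_derivative_at)

lemma holomorphic_fun_onD:
  assumes "holomorphic_fun_on f S" "z \<in> S"
  shows "(f has_derivative cderiv f z) (at z)" and "cderiv f z (c *s v) = c * cderiv f z v"
  using assms by (auto simp: holomorphic_fun_on_alt)

lemma cderiv_cong:
  assumes f: "holomorphic_fun_on f S" and S: "open S" and eq: "\<And>z. z \<in> S \<Longrightarrow> f z = g z" and z: "z \<in> S"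
  shows "cderiv g z = cderiv f z"
  using frechet_derivative_at[OF has_derivative_transform_within_open[OF holomorphic_fun_onD(1)[OF f z] S z eq]]
  by simp

lemma
  assumes f: "holomorphic_fun_on f S" and g: "holomorphic_fun_on g S"
  shows holomorphic_fun_on_diff: "holomorphic_fun_on (\<lambda>z. f z - g z) S"
    and cderiv_diff: "z \<in> S \<Longrightarrow> cderiv (\<lambda>z. f z - g z) z v = cderiv f z v - cderiv g z v"
proof -
  have d: "((\<lambda>z. f z - g z) has_derivative (\<lambda>v. cderiv f z v - cderiv g z v)) (at z)" if "z \<in> S" for z
    by (intro has_derivative_diff holomorphic_fun_onD(1)[OF f that] holomorphic_fun_onD(1)[OF g that])
  show "holomorphic_fun_on (\<lambda>z. f z - g z) S"
    by (rule holomorphic_fun_onI[OF d])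
       (auto simp: holomorphic_fun_onD(2)[OF f] holomorphic_fun_onD(2)[OF g] algebra_simps)
  show "z \<in> S \<Longrightarrow> cderiv (\<lambda>z. f z - g z) z v = cderiv f z v - cderiv g z v"
    using fun_cong[OF frechet_derivative_at[OF d]] by simp
qed

lemma
  assumes f: "holomorphic_fun_on f S"
  shows holomorphic_fun_on_cmult: "holomorphic_fun_on (\<lambda>z. c * f z) S"
    and cderiv_cmult: "z \<in> S \<Longrightarrow> cderiv (\<lambda>z. c * f z) z v = c * cderiv f z v"
proof -
  have d: "((\<lambda>z. c * f z) has_derivative (\<lambda>v. c * cderiv f z v)) (at z)" if "z \<in> S" for z
    by (intro has_derivative_mult_right holomorphic_fun_onD(1)[OF f that])
  show "holomorphic_fun_on (\<lambda>z. c * f z) S"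
    by (rule holomorphic_fun_onI[OF d]) (auto simp: holomorphic_fun_onD(2)[OF f])
  show "z \<in> S \<Longrightarrow> cderiv (\<lambda>z. c * f z) z v = c * cderiv f z v"
    using fun_cong[OF frechet_derivative_at[OF d]] by simp
qed

lemma holomorphic_fun_on_sum:
  assumes f: "\<And>i. i \<in> I \<Longrightarrow> holomorphic_fun_on (f i) S"
  shows "holomorphic_fun_on (\<lambda>z. \<Sum>i\<in>I. f i z) S"
proof (rule holomorphic_fun_onI)
  fix z assume z: "z \<in> S"
  show "((\<lambda>z. \<Sum>i\<in>I. f i z) has_derivative (\<lambda>v. \<Sum>i\<in>I. cderiv (f i) z v)) (at z)"
    by (intro has_derivative_sum holomorphic_fun_onD(1)[OF f] z)
  show "(\<Sum>i\<in>I. cderiv (f i) z (c *s v)) = c * (\<Sum>i\<in>I. cderiv (f i) z v)" for c v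
    by (auto simp: sum_distrib_left holomorphic_fun_onD(2)[OF f z] intro!: sum.cong)
qed

lemma
  fixes U :: "complex ^ 'd \<Rightarrow> complex ^ 'e"
  assumes "Vector_Spaces.linear (*s) (*s) U"
  shows clinear_scale: "U (c *s x) = c *s U x" and clinear_add: "U (x + y) = U x + U y"
proof -
  have "module_hom (*s) (*s) U" using assms by (simp add: Vector_Spaces.linear_def)
  from module_hom.scale[OF this] module_hom.add[OF this]
  show "U (c *s x) = c *s U x" "U (x + y) = U x + U y" by auto
qed

lemma of_real_smult: "complex_of_real r *s y = r *\<^sub>R (y :: complex ^ 'd)"
  by (auto simp: vec_eq_iff complex_eq_iff)

lemma clinear_imp_bounded_linear:
  fixes U :: "complex ^ 'd \<Rightarrow> complex ^ 'e"
  assumes "Vector_Spaces.linear (*s) (*s) U"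
  shows "bounded_linear U"
proof -
  have "U (r *\<^sub>R x) = r *\<^sub>R U x" for r x
  proof -
    have "U (complex_of_real r *s x) = complex_of_real r *s U x"
      using assms by (rule clinear_scale)
    then show ?thesis by (simp only: of_real_smult)
  qed
  then show ?thesis
    using clinear_add[OF assms] by (intro linear_conv_bounded_linear[THEN iffD1] linearI)
qed

lemma
  fixes f :: "complex ^ 'd \<Rightarrow> complex"
  assumes f: "holomorphic_fun_on f T" and U: "Vector_Spaces.linear (*s) (*s) U" and UST: "U ` S \<subseteq> T"
  shows holomorphic_fun_on_compose_linear: "holomorphic_fun_on (\<lambda>z. f (U z)) S"
    and cderiv_compose_linear: "z \<in> S \<Longrightarrow> cderiv (\<lambda>z. f (U z)) z v = cderiv f (U z) (U v)"
proof -
  have d: "((\<lambda>z. f (U z)) has_derivative (\<lambda>v. cderiv f (U z) (U v))) (at z)" if "z \<in> S" for z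
    by (rule has_derivative_compose[OF bounded_linear_imp_has_derivative holomorphic_fun_onD(1)[OF f]])
       (use that UST clinear_imp_bounded_linear[OF U] in auto)
  show "holomorphic_fun_on (\<lambda>z. f (U z)) S"
  proof (rule holomorphic_fun_onI[OF d])
    fix z c v assume "z \<in> S"
    then show "cderiv f (U z) (U (c *s v)) = c * cderiv f (U z) (U v)"
      using UST holomorphic_fun_onD(2)[OF f] clinear_scale[OF U] by auto
  qed
  show "z \<in> S \<Longrightarrow> cderiv (\<lambda>z. f (U z)) z v = cderiv f (U z) (U v)"
    using fun_cong[OF frechet_derivative_at[OF d]] by simp
qed

lemma cderiv_expand:
  assumes "holomorphic_fun_on f S" "z \<in> S"
  shows "cderiv f z v = (\<Sum>i\<in>UNIV. v $ i * cderiv f z (axis i 1))"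
proof -
  have l: "linear (cderiv f z)" using holomorphic_fun_onD(1)[OF assms] has_derivative_linear by blast
  have "cderiv f z v = cderiv f z (\<Sum>i\<in>UNIV. v $ i *s axis i 1)"
    by (simp add: basis_expansion)
  also have "\<dots> = (\<Sum>i\<in>UNIV. v $ i * cderiv f z (axis i 1))"
    by (simp add: linear_sum[OF l] holomorphic_fun_onD(2)[OF assms])
  finally show ?thesis .
qed

definition radial :: "(complex ^ 'd \<Rightarrow> complex) \<Rightarrow> complex ^ 'd \<Rightarrow> complex" where
  "radial f z = cderiv f z z"

text \<open>
  By the symmetry of second derivatives, the derivative of \<open>radial f\<close> at \<open>t z\<close> in the direction \<open>w\<close> is the
  derivative with respect to \<open>t\<close> of \<open>t\<close> times the derivative of \<open>f\<close> at \<open>t z\<close> in the direction \<open>w\<close>.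
\<close>

lemma
  assumes f: "holomorphic_fun_on f S" and S: "open S"
  shows holomorphic_fun_on_radial: "holomorphic_fun_on (radial f) S"
    and cderiv_radial: "z \<in> S \<Longrightarrow>
      cderiv (radial f) z w = cderiv f z w + cderiv (\<lambda>y. cderiv f y w) z z"
proof -
  let ?D = "\<lambda>z w. cderiv f z w + cderiv (\<lambda>y. cderiv f y w) z z"
  have d: "(radial f has_derivative ?D z) (at z)" if z: "z \<in> S" for z
  proof -
    have "((\<lambda>z. \<Sum>i\<in>UNIV. z $ i * cderiv f z (axis i 1)) has_derivative
        (\<lambda>w. \<Sum>i\<in>UNIV. z $ i * cderiv (\<lambda>y. cderiv f y (axis i 1)) z w + w $ i * cderiv f z (axis i 1))) (at z)"
      by (intro has_derivative_sum has_derivative_mult bounded_linear_imp_has_derivative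
          bounded_linear_vec_nth holomorphic_fun_onD(1)[OF holomorphic_fun_on_cderiv[OF f S] z])
    moreover have **: "(\<Sum>i\<in>UNIV. z $ i * cderiv (\<lambda>y. cderiv f y (axis i 1)) z w + w $ i * cderiv f z (axis i 1)) = ?D z w" for w
    proof -
      have "?D z w = (\<Sum>i\<in>UNIV. w $ i * cderiv f z (axis i 1)) +
          (\<Sum>i\<in>UNIV. z $ i * cderiv (\<lambda>y. cderiv f y w) z (axis i 1))"
        using cderiv_expand[OF f z, of w] cderiv_expand[OF holomorphic_fun_on_cderiv[OF f S] z, of w z] by simp
      also have "\<dots> = (\<Sum>i\<in>UNIV. z $ i * cderiv (\<lambda>y. cderiv f y (axis i 1)) z w + w $ i * cderiv f z (axis i 1))"
        by (simp add: sum.distrib cderiv_commute[OF f S z, of _ w])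
      finally show ?thesis ..
    qed
    ultimately have "((\<lambda>z. \<Sum>i\<in>UNIV. z $ i * cderiv f z (axis i 1)) has_derivative ?D z) (at z)"
      by (simp only: **)
    then show ?thesis
      by (rule has_derivative_transform_within_open[OF _ S z])
         (simp add: radial_def flip: cderiv_expand[OF f])
  qed
  show "holomorphic_fun_on (radial f) S"
  proof (rule holomorphic_fun_onI[OF d])
    fix z c w assume z: "z \<in> S"
    have "cderiv (\<lambda>y. cderiv f y (c *s w)) z = cderiv (\<lambda>y. c * cderiv f y w) z"
      by (rule cderiv_cong[OF _ S _ z])
         (auto intro: holomorphic_fun_on_cmult holomorphic_fun_on_cderiv[OF f S] simp: holomorphic_fun_onD(2)[OF f])
    then show "?D z (c *s w) = c * ?D z w"
      using z by (simp add: holomorphic_fun_onD(2)[OF f] cderiv_cmult[OF holomorphic_fun_on_cderiv[OF f S]] algebra_simps)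
  qed
  show "z \<in> S \<Longrightarrow> cderiv (radial f) z w = ?D z w"
    using fun_cong[OF frechet_derivative_at[OF d]] by simp
qed

lemma holomorphic_fun_on_radial_funpow:
  assumes "holomorphic_fun_on f S" "open S"
  shows "holomorphic_fun_on ((radial ^^ m) f) S"
  by (induction m) (auto simp: assms holomorphic_fun_on_radial)

section \<open>Homogeneous expansions\<close>

text \<open>The coefficient of \<open>\<lambda>\<^sup>k\<close> in the restriction of \<open>f\<close> to the complex line through \<open>z\<close>.\<close>

definition line_coeff :: "nat \<Rightarrow> (complex ^ 'd \<Rightarrow> complex) \<Rightarrow> complex ^ 'd \<Rightarrow> complex" where
  "line_coeff k f z = (deriv ^^ k) (\<lambda>l. f (l *s z)) 0 / fact k"

lemma finite_multiindices: "finite {\<alpha> :: 'd::finite \<Rightarrow> nat. (\<Sum>i\<in>UNIV. \<alpha> i) = k}"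
proof (rule finite_subset)
  show "{\<alpha> :: 'd \<Rightarrow> nat. (\<Sum>i\<in>UNIV. \<alpha> i) = k} \<subseteq> PiE UNIV (\<lambda>_. {..k})"
    by (auto simp: PiE_iff intro: member_le_sum)
qed (auto intro: finite_PiE)

lemma homogeneous_polynomial_scale:
  assumes "homogeneous_polynomial k P"
  shows "P (l *s z) = l ^ k * P z"
proof -
  obtain c where P: "\<And>z. P z = (\<Sum>\<alpha> | (\<Sum>i\<in>UNIV. \<alpha> i) = k. c \<alpha> * (\<Prod>i\<in>UNIV. (z $ i) ^ \<alpha> i))"
    using assms unfolding homogeneous_polynomial_def by blast
  have "(\<Prod>i\<in>UNIV. ((l *s z) $ i) ^ \<alpha> i) = l ^ k * (\<Prod>i\<in>UNIV. (z $ i) ^ \<alpha> i)"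
    if "(\<Sum>i\<in>UNIV. \<alpha> i) = k" for \<alpha>
    using that by (simp add: power_mult_distrib prod.distrib flip: power_sum)
  then show ?thesis by (simp add: P sum_distrib_left mult_ac)
qed

lemma homogeneous_polynomial_sum:
  assumes "finite I" "\<And>i. i \<in> I \<Longrightarrow> homogeneous_polynomial k (P i)"
  shows "homogeneous_polynomial k (\<lambda>z. \<Sum>i\<in>I. P i z)"
proof -
  have "\<exists>c. \<forall>i\<in>I. \<forall>z. P i z = (\<Sum>\<alpha> | (\<Sum>i\<in>UNIV. \<alpha> i) = k. c i \<alpha> * (\<Prod>i\<in>UNIV. (z $ i) ^ \<alpha> i))"
    using assms(2) unfolding homogeneous_polynomial_def by metis
  then obtain c where c: "\<And>i z. i \<in> I \<Longrightarrow> P i z = (\<Sum>\<alpha> | (\<Sum>i\<in>UNIV. \<alpha> i) = k. c i \<alpha> * (\<Prod>i\<in>UNIV. (z $ i) ^ \<alpha> i))"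
    by blast
  show ?thesis
    unfolding homogeneous_polynomial_def
  proof (intro exI[of _ "\<lambda>\<alpha>. \<Sum>i\<in>I. c i \<alpha>"] allI)
    fix z
    have "(\<Sum>i\<in>I. P i z) = (\<Sum>i\<in>I. \<Sum>\<alpha> | (\<Sum>i\<in>UNIV. \<alpha> i) = k. c i \<alpha> * (\<Prod>i\<in>UNIV. (z $ i) ^ \<alpha> i))"
      by (intro sum.cong refl c)
    also have "\<dots> = (\<Sum>\<alpha> | (\<Sum>i\<in>UNIV. \<alpha> i) = k. (\<Sum>i\<in>I. c i \<alpha>) * (\<Prod>i\<in>UNIV. (z $ i) ^ \<alpha> i))"
      by (subst sum.swap) (simp add: sum_distrib_right)
    finally show "(\<Sum>i\<in>I. P i z) = \<dots>" .
  qed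
qed

lemma homogeneous_polynomial_cmult:
  assumes "homogeneous_polynomial k P"
  shows "homogeneous_polynomial k (\<lambda>z. a * P z)"
proof -
  obtain c where P: "\<And>z. P z = (\<Sum>\<alpha> | (\<Sum>i\<in>UNIV. \<alpha> i) = k. c \<alpha> * (\<Prod>i\<in>UNIV. (z $ i) ^ \<alpha> i))"
    using assms unfolding homogeneous_polynomial_def by blast
  show ?thesis unfolding homogeneous_polynomial_def
    by (rule exI[of _ "\<lambda>\<alpha>. a * c \<alpha>"]) (simp add: P sum_distrib_left mult_ac)
qed

lemma homogeneous_polynomial_coordinate_mult:
  fixes P :: "complex ^ 'd \<Rightarrow> complex"
  assumes "homogeneous_polynomial k P"
  shows "homogeneous_polynomial (Suc k) (\<lambda>z. z $ j * P z)"
proof -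
  obtain c where P: "\<And>z. P z = (\<Sum>\<alpha> | (\<Sum>i\<in>UNIV. \<alpha> i) = k. c \<alpha> * (\<Prod>i\<in>UNIV. (z $ i) ^ \<alpha> i))"
    using assms unfolding homogeneous_polynomial_def by blast
  let ?up = "\<lambda>\<alpha> :: 'd \<Rightarrow> nat. \<alpha>(j := Suc (\<alpha> j))" and ?down = "\<lambda>\<beta> :: 'd \<Rightarrow> nat. \<beta>(j := \<beta> j - 1)"
  have sum_upd: "(\<Sum>i\<in>UNIV. (\<alpha>(j := m)) i) + \<alpha> j = (\<Sum>i\<in>UNIV. \<alpha> i) + m" for \<alpha> :: "_ \<Rightarrow> nat" and m
    by (simp add: sum.remove[of UNIV j] sum.remove[of UNIV j \<alpha>])
  define c' where "c' = (\<lambda>\<beta>. if \<beta> j = 0 then 0 else c (?down \<beta>))"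
  show ?thesis
    unfolding homogeneous_polynomial_def
  proof (intro exI[of _ c'] allI)
    fix z
    have "z $ j * P z = (\<Sum>\<alpha> | (\<Sum>i\<in>UNIV. \<alpha> i) = k. c \<alpha> * (\<Prod>i\<in>UNIV. (z $ i) ^ (?up \<alpha>) i))"
      unfolding P sum_distrib_left
    proof (rule sum.cong)
      fix \<alpha> :: "'d \<Rightarrow> nat"
      have "(\<Prod>i\<in>UNIV. (z $ i) ^ (?up \<alpha>) i) = z $ j * (\<Prod>i\<in>UNIV. (z $ i) ^ \<alpha> i)"
        by (simp add: prod.remove[of UNIV j] prod.remove[of UNIV j "\<lambda>i. z $ i ^ \<alpha> i"] mult.assoc)
      then show "z $ j * (c \<alpha> * (\<Prod>i\<in>UNIV. (z $ i) ^ \<alpha> i)) = c \<alpha> * (\<Prod>i\<in>UNIV. (z $ i) ^ (?up \<alpha>) i)"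
        by simp
    qed simp
    also have "\<dots> = (\<Sum>\<beta> | (\<Sum>i\<in>UNIV. \<beta> i) = Suc k \<and> \<beta> j \<noteq> 0. c' \<beta> * (\<Prod>i\<in>UNIV. (z $ i) ^ \<beta> i))"
    proof (rule sum.reindex_bij_witness[of _ ?down ?up])
      fix \<alpha> :: "'d \<Rightarrow> nat" assume "\<alpha> \<in> {\<alpha>. (\<Sum>i\<in>UNIV. \<alpha> i) = k}"
      then show "?up \<alpha> \<in> {\<beta>. (\<Sum>i\<in>UNIV. \<beta> i) = Suc k \<and> \<beta> j \<noteq> 0}"
        using sum_upd[of \<alpha> "Suc (\<alpha> j)"] by simp
    next
      fix \<beta> :: "'d \<Rightarrow> nat" assume "\<beta> \<in> {\<beta>. (\<Sum>i\<in>UNIV. \<beta> i) = Suc k \<and> \<beta> j \<noteq> 0}"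
      then show "?down \<beta> \<in> {\<alpha>. (\<Sum>i\<in>UNIV. \<alpha> i) = k}"
        using sum_upd[of \<beta> "\<beta> j - 1"] by simp
    qed (auto simp: c'_def)
    also have "\<dots> = (\<Sum>\<beta> | (\<Sum>i\<in>UNIV. \<beta> i) = Suc k. c' \<beta> * (\<Prod>i\<in>UNIV. (z $ i) ^ \<beta> i))"
      by (rule sum.mono_neutral_left) (auto simp: c'_def finite_multiindices)
    finally show "z $ j * P z = \<dots>" .
  qed
qed

text \<open>
  Two discs on the line through \<open>z\<close> whose image lies in the unit ball: the first one serves all \<open>z\<close>, the
  second one, for \<open>z\<close> in the ball, contains the point \<open>1\<close> in its interior.
\<close>

lemma
  fixes l :: complex
  shows norm_smult_less_1: "norm l < 1 / (1 + norm z) \<Longrightarrow> norm (l *s z) < 1"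
    and norm_smult_less_1': "norm z < 1 \<Longrightarrow> norm l < 2 / (1 + norm z) \<Longrightarrow> norm (l *s z) < 1"
proof -
  have pos: "1 + norm z > 0" by (simp add: add_pos_nonneg)
  show "norm (l *s z) < 1" if "norm l < 1 / (1 + norm z)"
  proof -
    have "norm l * (1 + norm z) < 1" using pos that by (simp add: field_simps)
    then have "norm l * norm z < 1" using norm_ge_zero[of l] unfolding ring_distribs by linarith
    then show ?thesis by (simp add: norm_vector_smult)
  qed
  show "norm (l *s z) < 1" if "norm z < 1" "norm l < 2 / (1 + norm z)"
  proof -
    have "norm l * (1 + norm z) < 2" using pos that by (simp add: field_simps)
    moreover have "norm l * norm z * 2 \<le> norm l * (1 + norm z)"
      using that mult_left_mono[of "norm z * 2" "1 + norm z" "norm l"] by (simp add: mult_ac)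
    ultimately show ?thesis by (simp add: norm_vector_smult)
  qed
qed

lemma line_holomorphic:
  assumes "holomorphic_fun_on f (ball 0 1)"
  shows "(\<lambda>l. f (l *s z)) holomorphic_on ball 0 (1 / (1 + norm z))"
    and "z \<in> ball 0 1 \<Longrightarrow> (\<lambda>l. f (l *s z)) holomorphic_on ball 0 (2 / (1 + norm z))"
    and "norm (l *s z) < 1 \<Longrightarrow> ((\<lambda>l. f (l *s z)) has_field_derivative cderiv f (l *s z) z) (at l)"
proof -
  show d: "((\<lambda>l. f (l *s z)) has_field_derivative cderiv f (l *s z) z) (at l)" if "norm (l *s z) < 1" for l
    using holomorphic_fun_on_slice[OF assms, of 0 l z] that by simp
  show "(\<lambda>l. f (l *s z)) holomorphic_on ball 0 (1 / (1 + norm z))"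
    by (rule holomorphic_onI)
       (use d[OF norm_smult_less_1] in \<open>auto simp: field_differentiable_def intro: has_field_derivative_at_within\<close>)
  assume "z \<in> ball 0 1"
  then show "(\<lambda>l. f (l *s z)) holomorphic_on ball 0 (2 / (1 + norm z))"
    by (intro holomorphic_onI)
       (use d[OF norm_smult_less_1'] in \<open>auto simp: field_differentiable_def intro: has_field_derivative_at_within\<close>)
qed

lemma higher_deriv_sum_at_0:
  assumes "finite I" "\<And>i. i \<in> I \<Longrightarrow> g i holomorphic_on ball 0 r" "r > 0"
  shows "(deriv ^^ k) (\<lambda>l. \<Sum>i\<in>I. c i * g i l) 0 = (\<Sum>i\<in>I. c i * (deriv ^^ k) (g i) (0::complex))"
  using assms(1,2)
proof (induction rule: finite_induct)
  case (insert i I)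
  have "(deriv ^^ k) (\<lambda>l. c i * g i l + (\<Sum>i\<in>I. c i * g i l)) 0 =
      (deriv ^^ k) (\<lambda>l. c i * g i l) 0 + (deriv ^^ k) (\<lambda>l. \<Sum>i\<in>I. c i * g i l) 0"
    using insert assms(3) by (intro higher_deriv_add[of _ "ball 0 r"] holomorphic_intros) auto
  also have "(deriv ^^ k) (\<lambda>l. c i * g i l) 0 = c i * (deriv ^^ k) (g i) 0"
    using insert assms(3) by (intro higher_deriv_cmult[of _ "ball 0 r"]) auto
  finally show ?case using insert by simp
qed simp

text \<open>
  By the chain rule the \<open>k+1\<close>st coefficient of \<open>f\<close> is, up to a factor, \<open>\<Sum>\<^sub>i z\<^sub>i\<close> times the \<open>k\<close>th
  coefficient of \<open>\<partial>\<^sub>i f\<close>; as the \<open>\<partial>\<^sub>i f\<close> are holomorphic again, induction applies.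
\<close>

lemma homogeneous_polynomial_line_coeff:
  assumes "holomorphic_fun_on f (ball 0 1)"
  shows "homogeneous_polynomial k (line_coeff k f)"
proof -
  have "homogeneous_polynomial k (\<lambda>z. (deriv ^^ k) (\<lambda>l. f (l *s z)) 0)"
    using assms
  proof (induction k arbitrary: f)
    case 0
    have "{\<alpha> :: 'a \<Rightarrow> nat. (\<Sum>i\<in>UNIV. \<alpha> i) = 0} = {\<lambda>_. 0}" by (auto simp: fun_eq_iff)
    then show ?case unfolding homogeneous_polynomial_def
      by (intro exI[of _ "\<lambda>_. f 0"]) simp
  next
    case (Suc k)
    let ?d = "\<lambda>i z. cderiv f z (axis i 1)"
    have hd: "holomorphic_fun_on (?d i) (ball 0 1)" for i
      by (rule holomorphic_fun_on_cderiv[OF Suc.prems open_ball])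
    have "(deriv ^^ Suc k) (\<lambda>l. f (l *s z)) 0 = (\<Sum>i\<in>UNIV. z $ i * (deriv ^^ k) (\<lambda>l. ?d i (l *s z)) 0)" for z
    proof -
      let ?B = "ball 0 (1 / (1 + norm z)) :: complex set"
      have pos: "1 + norm z > 0" by (simp add: add_pos_nonneg)
      have dl: "deriv (\<lambda>l. f (l *s z)) l = (\<Sum>i\<in>UNIV. z $ i * ?d i (l *s z))" if l: "l \<in> ?B" for l
      proof -
        have n: "norm (l *s z) < 1" using l by (intro norm_smult_less_1) simp
        show ?thesis
          using DERIV_imp_deriv[OF line_holomorphic(3)[OF Suc.prems n]] n
          by (simp add: cderiv_expand[OF Suc.prems, of "l *s z" z])
      qed
      have "(deriv ^^ Suc k) (\<lambda>l. f (l *s z)) 0 = (deriv ^^ k) (deriv (\<lambda>l. f (l *s z))) 0"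
        by (simp add: funpow_swap1)
      also have "\<dots> = (deriv ^^ k) (\<lambda>l. \<Sum>i\<in>UNIV. z $ i * ?d i (l *s z)) 0"
        by (rule higher_deriv_transform_within_open[of _ ?B])
           (use dl pos in \<open>auto intro!: holomorphic_intros holomorphic_deriv line_holomorphic(1)[OF Suc.prems] line_holomorphic(1)[OF hd]\<close>)
      also have "\<dots> = (\<Sum>i\<in>UNIV. z $ i * (deriv ^^ k) (\<lambda>l. ?d i (l *s z)) 0)"
        by (rule higher_deriv_sum_at_0[of _ _ "1 / (1 + norm z)"]) (use pos line_holomorphic(1)[OF hd] in auto)
      finally show ?thesis .
    qed
    moreover have "homogeneous_polynomial (Suc k) (\<lambda>z. \<Sum>i\<in>UNIV. z $ i * (deriv ^^ k) (\<lambda>l. ?d i (l *s z)) 0)"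
      by (intro homogeneous_polynomial_sum homogeneous_polynomial_coordinate_mult Suc.IH hd) simp
    ultimately show ?case by presburger
  qed
  from homogeneous_polynomial_cmult[OF this, of "1 / fact k"] show ?thesis
    by (simp add: line_coeff_def[abs_def])
qed

lemma is_homogeneous_expansion_line_coeff:
  assumes f: "holomorphic_fun_on f (ball 0 1)"
  shows "is_homogeneous_expansion f (\<lambda>k. line_coeff k f)"
  unfolding is_homogeneous_expansion_def
proof (intro conjI allI ballI homogeneous_polynomial_line_coeff[OF f])
  fix z :: "complex ^ 'a" assume z: "z \<in> ball 0 1"
  then have "(1::complex) \<in> ball 0 (2 / (1 + norm z))" by (simp add: field_simps add_pos_nonneg)
  from holomorphic_power_series[OF line_holomorphic(2)[OF f z] this]
  show "(\<lambda>k. line_coeff k f z) sums f z" by (simp add: line_coeff_def)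
qed

lemma is_homogeneous_expansion_scale:
  assumes "is_homogeneous_expansion f F" "norm (l *s z) < 1"
  shows "(\<lambda>k. F k z * l ^ k) sums f (l *s z)"
  using assms homogeneous_polynomial_scale[of _ "F _" l z]
  unfolding is_homogeneous_expansion_def by (metis (no_types, lifting) dist_0_norm mem_ball mult.commute sums_cong)

lemma is_homogeneous_expansion_unique:
  assumes F: "is_homogeneous_expansion f F" and G: "is_homogeneous_expansion f G"
  shows "F = G"
proof -
  have eq: "F k z = G k z" for k z
  proof -
    define a where "a = (\<lambda>k. F k z - G k z)"
    define r where "r = 1 / (1 + norm z)"
    have pos: "1 + norm z > 0" by (simp add: add_pos_nonneg)
    have sm: "(\<lambda>n. a n * (l - 0) ^ n) sums 0" if "norm (l - 0) < r" for l
    proof -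
      have n: "norm (l *s z) < 1" using that by (intro norm_smult_less_1) (simp add: r_def)
      from sums_diff[OF is_homogeneous_expansion_scale[OF F n] is_homogeneous_expansion_scale[OF G n]]
      show ?thesis by (simp add: a_def algebra_simps)
    qed
    have r: "r > 0" using pos by (simp add: r_def)
    have a0: "a 0 = 0" using sm[of 0] r by simp
    have "a k = 0"
    proof (rule ccontr)
      assume k: "a k \<noteq> 0"
      with a0 have "k > 0" by (cases k) auto
      from powser_0_nonzero[where f = "\<lambda>_. 0", OF r sm _ k this]
      obtain s where "0 < s" "\<And>z::complex. z \<in> cball 0 s - {0} \<Longrightarrow> (0::complex) \<noteq> 0" by metis
      from this(2)[of "of_real s"] this(1) show False by simp
    qed
    then show ?thesis by (simp add: a_def)
  qed
  show ?thesis by (intro ext eq)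
qed

lemma is_homogeneous_expansion_homogeneous_part:
  assumes "holomorphic_fun_on f (ball 0 1)"
  shows "is_homogeneous_expansion f (homogeneous_part f)"
  unfolding homogeneous_part_def
  by (rule theI[where a = "\<lambda>k. line_coeff k f"])
     (rule is_homogeneous_expansion_line_coeff[OF assms], rule is_homogeneous_expansion_unique[OF _ is_homogeneous_expansion_line_coeff[OF assms]])

text \<open>On each complex line \<open>radial\<close> is \<open>\<lambda> d/d\<lambda>\<close>, which multiplies the coefficient of \<open>\<lambda>\<^sup>k\<close> by \<open>k\<close>.\<close>

lemma sums_radial_funpow:
  assumes f: "holomorphic_fun_on f (ball 0 1)" and F: "is_homogeneous_expansion f F" and z: "norm z < 1"
  shows "(\<lambda>k. of_nat k ^ m * F k z) sums (radial ^^ m) f z"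
  using z
proof (induction m arbitrary: z)
  case 0
  then show ?case using F by (simp add: is_homogeneous_expansion_def)
next
  case (Suc m)
  let ?h = "(radial ^^ m) f"
  have h: "holomorphic_fun_on ?h (ball 0 1)" by (rule holomorphic_fun_on_radial_funpow[OF f open_ball])
  have pos: "1 + norm z > 0" by (simp add: add_pos_nonneg)
  define K where "K = 2 / (1 + norm z)"
  have n: "norm (l *s z) < 1" if "norm l < K" for l
    using that Suc.prems by (intro norm_smult_less_1') (simp_all add: K_def)
  have hom: "F k (l *s z) = l ^ k * F k z" for k l
    using F homogeneous_polynomial_scale unfolding is_homogeneous_expansion_def by blast
  have sm: "(\<lambda>k. of_nat k ^ m * F k z * l ^ k) sums ?h (l *s z)" if "norm l < K" for l
    using Suc.IH[OF n[OF that]] by (simp add: hom mult_ac)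
  have K1: "norm (1::complex) < K" using Suc.prems pos by (simp add: K_def field_simps)
  have "((\<lambda>l. ?h (l *s z)) has_field_derivative cderiv ?h (1 *s z) z) (at 1)"
    by (rule line_holomorphic(3)[OF h n[OF K1]])
  from termdiffs_sums_strong[OF sm this K1]
  have "(\<lambda>k. of_nat (Suc k) * (of_nat (Suc k) ^ m * F (Suc k) z)) sums radial ?h z"
    by (simp add: diffs_def radial_def)
  then have "(\<lambda>k. of_nat (Suc k) ^ Suc m * F (Suc k) z) sums radial ?h z"
    by (simp add: mult_ac)
  from sums_Suc[OF this] show ?case by simp
qed

lemma radial_deriv_eq_funpow:
  assumes f: "holomorphic_fun_on f (ball 0 1)" and z: "norm z < 1" and n: "n \<ge> 1"
  shows "radial_deriv n f z = (radial ^^ n) f z"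
proof -
  let ?s = "\<lambda>k. of_nat k ^ n * homogeneous_part f k z"
  have "?s sums (radial ^^ n) f z"
    by (rule sums_radial_funpow[OF f is_homogeneous_expansion_homogeneous_part[OF f] z])
  then have "(\<lambda>k. ?s (Suc k)) sums ((radial ^^ n) f z - ?s 0)"
    by (subst sums_Suc_iff) simp
  then show ?thesis
    using n by (simp add: radial_deriv_def sums_iff del: of_nat_Suc)
qed

section \<open>Minkowski's integral inequality\<close>

text \<open>
  An upper bound for the \<open>p\<close>-norm.  Working with real bounds instead of the norm keeps the two cases
  \<open>p < \<infinity>\<close> and \<open>p = \<infinity>\<close> behind a few lemmas and avoids infinite values.
\<close>

definition Lp_le :: "'a measure \<Rightarrow> ennreal \<Rightarrow> real \<Rightarrow> ('a \<Rightarrow> complex) \<Rightarrow> bool" where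
  "Lp_le M p b u \<longleftrightarrow> u \<in> borel_measurable M \<and> 0 \<le> b \<and>
     (if p = \<top> then AE x in M. norm (u x) \<le> b
      else (\<integral>\<^sup>+ x. ennreal (norm (u x) powr enn2real p) \<partial>M) \<le> ennreal (b powr enn2real p))"

lemma Lp_leD: "Lp_le M p b u \<Longrightarrow> 0 \<le> b" "Lp_le M p b u \<Longrightarrow> u \<in> borel_measurable M"
  by (auto simp: Lp_le_def)

lemma Lp_le_cong:
  assumes "\<And>x. x \<in> space M \<Longrightarrow> u x = v x"
  shows "Lp_le M p b u \<longleftrightarrow> Lp_le M p b v"
proof -
  have "u \<in> borel_measurable M \<longleftrightarrow> v \<in> borel_measurable M" by (rule measurable_cong) (rule assms)
  moreover have "(\<integral>\<^sup>+ x. ennreal (norm (u x) powr enn2real p) \<partial>M) = (\<integral>\<^sup>+ x. ennreal (norm (v x) powr enn2real p) \<partial>M)"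
    by (rule nn_integral_cong) (simp add: assms)
  moreover have "(AE x in M. norm (u x) \<le> b) \<longleftrightarrow> (AE x in M. norm (v x) \<le> b)"
    by (rule AE_cong) (simp add: assms)
  ultimately show ?thesis by (simp add: Lp_le_def)
qed

lemma enn2real_ge_1: "1 \<le> enn2real p" if "1 \<le> p" "p \<noteq> \<top>"
proof -
  have "enn2real 1 \<le> enn2real p" by (rule enn2real_mono) (use that in \<open>auto simp: less_top\<close>)
  then show ?thesis by simp
qed

lemma Lp_le_mono:
  assumes p: "1 \<le> p" and u: "Lp_le M p b u" and v: "v \<in> borel_measurable M"
    and le: "\<And>x. x \<in> space M \<Longrightarrow> norm (v x) \<le> norm (u x)" and bc: "b \<le> c"
  shows "Lp_le M p c v"
proof (cases "p = \<top>")
  case True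
  then have "AE x in M. norm (u x) \<le> b" using u by (simp add: Lp_le_def)
  then have "AE x in M. norm (v x) \<le> c"
    by (rule AE_mp) (auto intro!: AE_I2 dest!: le bc[THEN order_trans[rotated]] intro: order_trans)
  with True u v bc show ?thesis by (auto simp: Lp_le_def)
next
  case False
  let ?q = "enn2real p"
  have q: "?q \<ge> 1" by (rule enn2real_ge_1[OF p False])
  have "(\<integral>\<^sup>+ x. ennreal (norm (v x) powr ?q) \<partial>M) \<le> (\<integral>\<^sup>+ x. ennreal (norm (u x) powr ?q) \<partial>M)"
    using q by (intro nn_integral_mono ennreal_leI powr_mono2 le) auto
  also have "\<dots> \<le> ennreal (b powr ?q)" using u False by (simp add: Lp_le_def)
  also have "\<dots> \<le> ennreal (c powr ?q)" using q bc Lp_leD(1)[OF u] by (intro ennreal_leI powr_mono2) auto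
  finally show ?thesis using False u v bc by (auto simp: Lp_le_def)
qed

lemma Lp_le_cmult:
  assumes p: "1 \<le> p" and u: "Lp_le M p b u"
  shows "Lp_le M p (norm c * b) (\<lambda>x. c * u x)"
proof (cases "p = \<top>")
  case True
  then have "AE x in M. norm (u x) \<le> b" using u by (simp add: Lp_le_def)
  then have "AE x in M. norm (c * u x) \<le> norm c * b"
    by (rule AE_mp) (auto intro!: AE_I2 mult_left_mono simp: norm_mult)
  with True u show ?thesis by (auto simp: Lp_le_def)
next
  case False
  let ?q = "enn2real p"
  have [measurable]: "u \<in> borel_measurable M" using u by (rule Lp_leD)
  have "(\<integral>\<^sup>+ x. ennreal (norm (c * u x) powr ?q) \<partial>M) =
      (\<integral>\<^sup>+ x. ennreal (norm c powr ?q) * ennreal (norm (u x) powr ?q) \<partial>M)"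
    by (simp add: norm_mult powr_mult ennreal_mult)
  also have "\<dots> = ennreal (norm c powr ?q) * (\<integral>\<^sup>+ x. ennreal (norm (u x) powr ?q) \<partial>M)"
    by (rule nn_integral_cmult) measurable
  also have "\<dots> \<le> ennreal (norm c powr ?q) * ennreal (b powr ?q)"
    using u False by (intro mult_left_mono) (auto simp: Lp_le_def)
  also have "\<dots> = ennreal ((norm c * b) powr ?q)"
    using Lp_leD(1)[OF u] by (simp add: powr_mult ennreal_mult)
  finally show ?thesis using False u by (auto simp: Lp_le_def)
qed

lemma Lp_le_bounded:
  assumes p: "1 \<le> p" and u: "u \<in> borel_measurable M" and M: "emeasure M (space M) \<le> 1"
    and le: "\<And>x. x \<in> space M \<Longrightarrow> norm (u x) \<le> b" and b: "0 \<le> b"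
  shows "Lp_le M p b u"
proof (cases "p = \<top>")
  case True
  with assms show ?thesis by (auto simp: Lp_le_def)
next
  case False
  let ?q = "enn2real p"
  have q: "?q \<ge> 1" by (rule enn2real_ge_1[OF p False])
  have "(\<integral>\<^sup>+ x. ennreal (norm (u x) powr ?q) \<partial>M) \<le> (\<integral>\<^sup>+ x. ennreal (b powr ?q) \<partial>M)"
    using q by (intro nn_integral_mono ennreal_leI powr_mono2 le) auto
  also have "\<dots> = ennreal (b powr ?q) * emeasure M (space M)" by simp
  also have "\<dots> \<le> ennreal (b powr ?q)" using M mult_left_mono by fastforce
  finally show ?thesis using False u b by (auto simp: Lp_le_def)
qed

lemma powr_tangent:
  fixes x c q :: real
  assumes "x \<ge> 0" "c > 0" "q \<ge> 1"
  shows "q * c powr (q - 1) * x \<le> x powr q + (q - 1) * c powr q"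
proof (cases "x = 0")
  case False
  then have "x > 0" using assms by simp
  then have "(x powr q) powr (1/q) * (c powr q) powr (1 - 1/q) \<le> (1/q) * x powr q + (1 - 1/q) * c powr q"
    using assms by (intro Youngs_inequality_0) auto
  also have "(x powr q) powr (1/q) * (c powr q) powr (1 - 1/q) = x * c powr (q - 1)"
    using assms \<open>x > 0\<close> by (simp add: powr_powr algebra_simps)
  finally have "q * (x * c powr (q - 1)) \<le> q * ((1/q) * x powr q + (1 - 1/q) * c powr q)"
    using assms by (intro mult_left_mono) auto
  also have "\<dots> = x powr q + (q - 1) * c powr q" using assms by (simp add: field_simps)
  finally show ?thesis by (simp add: mult_ac)
qed (use assms in auto)

text \<open>
  Jensen's inequality for \<open>x \<mapsto> x\<^sup>q\<close>: integrate the inequality between the graph and its tangent at \<open>c\<close>.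
\<close>

lemma powr_le_nn_integral:
  assumes q: "q \<ge> 1" and [measurable]: "X \<in> borel_measurable N" "w \<in> borel_measurable N"
    and nn: "\<And>t. t \<in> space N \<Longrightarrow> X t \<ge> 0" "\<And>t. t \<in> space N \<Longrightarrow> w t \<ge> 0"
    and w: "(\<integral>\<^sup>+ t. ennreal (w t) \<partial>N) \<le> 1"
    and c: "c \<ge> 0" "ennreal c \<le> (\<integral>\<^sup>+ t. ennreal (X t * w t) \<partial>N)"
  shows "ennreal (c powr q) \<le> (\<integral>\<^sup>+ t. ennreal (X t powr q * w t) \<partial>N)" (is "_ \<le> ?I")
proof (cases "c = 0 \<or> ?I = \<top>")
  case True
  then show ?thesis using q by auto
next
  case False
  then have c0: "c > 0" using c by simp
  obtain i where i: "?I = ennreal i" "i \<ge> 0" using False by (cases ?I) auto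
  have "ennreal (q * c powr q) = ennreal (q * c powr (q - 1)) * ennreal c"
    using c0 q by (simp add: ennreal_mult'[symmetric] powr_diff)
  also have "\<dots> \<le> ennreal (q * c powr (q - 1)) * (\<integral>\<^sup>+ t. ennreal (X t * w t) \<partial>N)"
    by (intro mult_left_mono c) auto
  also have "\<dots> = (\<integral>\<^sup>+ t. ennreal (q * c powr (q - 1)) * ennreal (X t * w t) \<partial>N)"
    by (rule nn_integral_cmult[symmetric]) measurable
  also have "\<dots> \<le> (\<integral>\<^sup>+ t. ennreal (X t powr q * w t) + ennreal ((q - 1) * c powr q) * ennreal (w t) \<partial>N)"
  proof (rule nn_integral_mono)
    fix t assume t: "t \<in> space N"
    have "q * c powr (q - 1) * X t * w t \<le> (X t powr q + (q - 1) * c powr q) * w t"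
      by (intro mult_right_mono powr_tangent nn t c0 q)
    then have "ennreal (q * c powr (q - 1) * X t * w t) \<le> ennreal (X t powr q * w t + (q - 1) * c powr q * w t)"
      by (intro ennreal_leI) (simp add: algebra_simps)
    then show "ennreal (q * c powr (q - 1)) * ennreal (X t * w t) \<le>
        ennreal (X t powr q * w t) + ennreal ((q - 1) * c powr q) * ennreal (w t)"
      using nn[OF t] q by (simp add: ennreal_mult'[symmetric] ennreal_plus[symmetric] mult_ac del: ennreal_plus)
  qed
  also have "\<dots> = ?I + ennreal ((q - 1) * c powr q) * (\<integral>\<^sup>+ t. ennreal (w t) \<partial>N)"
    by (subst nn_integral_add) (auto simp: nn_integral_cmult)
  also have "\<dots> \<le> ?I + ennreal ((q - 1) * c powr q) * 1"
    by (intro add_left_mono mult_left_mono w) auto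
  also have "\<dots> = ennreal (i + (q - 1) * c powr q)"
    using i q by simp
  finally have "q * c powr q \<le> i + (q - 1) * c powr q"
    using i q by (subst (asm) ennreal_le_iff) auto
  then show ?thesis using i by (simp add: algebra_simps)
qed

text \<open>
  For finite \<open>p\<close> this is Jensen's inequality for \<open>norm (F t x) / b t\<close> with the weights \<open>b t / B\<close>, integrated
  over \<open>M\<close>; a small constant \<open>e\<close> is added to \<open>b\<close> to keep the denominators positive.  For \<open>p = \<infinity>\<close> exchange the
  order of the two almost-everywhere quantifiers.
\<close>

lemma Lp_le_Minkowski:
  fixes F :: "'t \<Rightarrow> 'a \<Rightarrow> complex"
  assumes p: "1 \<le> p" and "finite_measure N" and "finite_measure M"
    and F [measurable]: "(\<lambda>(t, x). F t x) \<in> borel_measurable (N \<Otimes>\<^sub>M M)"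
    and G [measurable]: "G \<in> borel_measurable M" and b [measurable]: "b \<in> borel_measurable N"
    and Fb: "\<And>t. t \<in> space N \<Longrightarrow> Lp_le M p (b t) (F t)"
    and GF: "\<And>x. x \<in> space M \<Longrightarrow> ennreal (norm (G x)) \<le> (\<integral>\<^sup>+ t. ennreal (norm (F t x)) \<partial>N)"
    and B: "(\<integral>\<^sup>+ t. ennreal (b t) \<partial>N) \<le> ennreal B" "0 \<le> B"
  shows "Lp_le M p B G"
proof -
  interpret N: finite_measure N by fact
  interpret M: finite_measure M by fact
  interpret NM: pair_sigma_finite N M ..
  have b0: "b t \<ge> 0" if "t \<in> space N" for t using Lp_leD(1)[OF Fb[OF that]] .
  show ?thesis
  proof (cases "p = \<top>")
    case True
    have "AE t in N. AE x in M. norm (F t x) \<le> b t"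
      using Fb True by (auto simp: Lp_le_def)
    then have "AE x in M. AE t in N. norm (F t x) \<le> b t"
      by (subst (asm) NM.AE_commute) measurable
    then have "AE x in M. norm (G x) \<le> B"
    proof (rule AE_mp, intro AE_I2 impI)
      fix x assume x: "x \<in> space M" and ae: "AE t in N. norm (F t x) \<le> b t"
      have "ennreal (norm (G x)) \<le> (\<integral>\<^sup>+ t. ennreal (norm (F t x)) \<partial>N)" by (rule GF[OF x])
      also have "\<dots> \<le> (\<integral>\<^sup>+ t. ennreal (b t) \<partial>N)"
      proof (rule nn_integral_mono_AE)
        show "AE t in N. ennreal (norm (F t x)) \<le> ennreal (b t)"
          using ae by eventually_elim (rule ennreal_leI)
      qed
      also have "\<dots> \<le> ennreal B" by (rule B)
      finally show "norm (G x) \<le> B" using B by simp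
    qed
    then show ?thesis using True G B by (auto simp: Lp_le_def)
  next
    case False
    let ?q = "enn2real p"
    have q: "?q \<ge> 1" by (rule enn2real_ge_1[OF p False])
    define m where "m = measure N (space N)"
    have *: "(\<integral>\<^sup>+ x. ennreal (norm (G x) powr ?q) \<partial>M) \<le> ennreal ((B + e * (m + 1)) powr ?q)" if e: "e > 0" for e
    proof -
      define B' where "B' = B + e * (m + 1)"
      have m: "m \<ge> 0" by (simp add: m_def)
      have B': "B' > 0" using e m B by (simp add: B'_def add_nonneg_pos)
      define w where "w = (\<lambda>t. (b t + e) / B')"
      have [measurable]: "w \<in> borel_measurable N" by (simp add: w_def)
      have w0: "w t > 0" if "t \<in> space N" for t using b0[OF that] e B' by (simp add: w_def add_nonneg_pos)
      have "(\<integral>\<^sup>+ t. ennreal (w t) \<partial>N) = (\<integral>\<^sup>+ t. ennreal (1 / B') * (ennreal (b t) + ennreal e) \<partial>N)"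
        using b0 e B' by (intro nn_integral_cong) (simp add: w_def ennreal_mult'[symmetric] ennreal_plus[symmetric] del: ennreal_plus)
      also have "\<dots> = ennreal (1 / B') * ((\<integral>\<^sup>+ t. ennreal (b t) \<partial>N) + ennreal e * emeasure N (space N))"
        by (subst nn_integral_cmult, measurable) (subst nn_integral_add, auto)
      also have "\<dots> \<le> ennreal (1 / B') * (ennreal B + ennreal e * ennreal m)"
        by (intro mult_left_mono add_mono B) (auto simp: m_def N.emeasure_eq_measure)
      also have "\<dots> = ennreal ((B + e * m) / B')"
        using B e m B' by (simp add: ennreal_mult'[symmetric] ennreal_plus[symmetric] del: ennreal_plus)
      also have "\<dots> \<le> 1" using B' e by (simp add: B'_def field_simps ennreal_le_1)
      finally have w1: "(\<integral>\<^sup>+ t. ennreal (w t) \<partial>N) \<le> 1" .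
      define X where "X = (\<lambda>t x. norm (F t x) / (b t + e))"
      have [measurable]: "(\<lambda>(t, x). X t x) \<in> borel_measurable (N \<Otimes>\<^sub>M M)"
        unfolding X_def by measurable
      have X0: "X t x \<ge> 0" if "t \<in> space N" for t x using b0[OF that] e by (simp add: X_def)
      have J: "ennreal ((norm (G x) / B') powr ?q) \<le> (\<integral>\<^sup>+ t. ennreal (X t x powr ?q * w t) \<partial>N)"
        if x: "x \<in> space M" for x
      proof (rule powr_le_nn_integral[OF q _ _ X0 less_imp_le[OF w0] w1])
        show "(\<lambda>t. X t x) \<in> borel_measurable N" using x by measurable
        have "ennreal (norm (G x) / B') = ennreal (1 / B') * ennreal (norm (G x))"
          using B' by (simp add: ennreal_mult'[symmetric])
        also have "\<dots> \<le> ennreal (1 / B') * (\<integral>\<^sup>+ t. ennreal (norm (F t x)) \<partial>N)"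
          by (intro mult_left_mono GF x) auto
        also have "\<dots> = (\<integral>\<^sup>+ t. ennreal (1 / B') * ennreal (norm (F t x)) \<partial>N)"
          using x by (intro nn_integral_cmult[symmetric]) measurable
        also have "\<dots> = (\<integral>\<^sup>+ t. ennreal (X t x * w t) \<partial>N)"
        proof (rule nn_integral_cong)
          fix t assume "t \<in> space N"
          then have "b t + e > 0" using b0 e by (simp add: add_nonneg_pos)
          then show "ennreal (1 / B') * ennreal (norm (F t x)) = ennreal (X t x * w t)"
            using B' by (simp add: X_def w_def ennreal_mult'[symmetric])
        qed
        finally show "ennreal (norm (G x) / B') \<le> (\<integral>\<^sup>+ t. ennreal (X t x * w t) \<partial>N)" .
      qed (use B' in auto)
      have "(\<integral>\<^sup>+ x. ennreal ((norm (G x) / B') powr ?q) \<partial>M) \<le>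
          (\<integral>\<^sup>+ x. \<integral>\<^sup>+ t. ennreal (X t x powr ?q * w t) \<partial>N \<partial>M)"
        by (intro nn_integral_mono J)
      also have "\<dots> = (\<integral>\<^sup>+ t. \<integral>\<^sup>+ x. ennreal (X t x powr ?q * w t) \<partial>M \<partial>N)"
        by (rule NM.Fubini') measurable
      also have "\<dots> \<le> (\<integral>\<^sup>+ t. ennreal (w t) \<partial>N)"
      proof (rule nn_integral_mono)
        fix t assume t: "t \<in> space N"
        have be: "b t + e > 0" using b0[OF t] e by (simp add: add_nonneg_pos)
        have [measurable]: "F t \<in> borel_measurable M" using Lp_leD(2)[OF Fb[OF t]] .
        have "(\<integral>\<^sup>+ x. ennreal (X t x powr ?q * w t) \<partial>M) =
            (\<integral>\<^sup>+ x. ennreal (w t / (b t + e) powr ?q) * ennreal (norm (F t x) powr ?q) \<partial>M)"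
          using be w0[OF t] by (intro nn_integral_cong) (simp add: X_def powr_divide ennreal_mult'[symmetric])
        also have "\<dots> = ennreal (w t / (b t + e) powr ?q) * (\<integral>\<^sup>+ x. ennreal (norm (F t x) powr ?q) \<partial>M)"
          by (rule nn_integral_cmult) measurable
        also have "\<dots> \<le> ennreal (w t / (b t + e) powr ?q) * ennreal ((b t) powr ?q)"
          using Fb[OF t] False by (intro mult_left_mono) (auto simp: Lp_le_def)
        also have "\<dots> \<le> ennreal (w t / (b t + e) powr ?q) * ennreal ((b t + e) powr ?q)"
          using q e b0[OF t] by (intro mult_left_mono ennreal_leI powr_mono2) auto
        also have "\<dots> = ennreal (w t)"
          using be w0[OF t] by (simp add: ennreal_mult'[symmetric])
        finally show "(\<integral>\<^sup>+ x. ennreal (X t x powr ?q * w t) \<partial>M) \<le> ennreal (w t)" .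
      qed
      also have "\<dots> \<le> 1" by (rule w1)
      finally have *: "(\<integral>\<^sup>+ x. ennreal ((norm (G x) / B') powr ?q) \<partial>M) \<le> 1" .
      have "(\<integral>\<^sup>+ x. ennreal (norm (G x) powr ?q) \<partial>M) =
          (\<integral>\<^sup>+ x. ennreal (B' powr ?q) * ennreal ((norm (G x) / B') powr ?q) \<partial>M)"
        using B' by (intro nn_integral_cong) (simp add: powr_divide ennreal_mult'[symmetric])
      also have "\<dots> = ennreal (B' powr ?q) * (\<integral>\<^sup>+ x. ennreal ((norm (G x) / B') powr ?q) \<partial>M)"
        by (rule nn_integral_cmult) measurable
      also have "\<dots> \<le> ennreal (B' powr ?q) * 1" by (intro mult_left_mono *) auto
      finally show ?thesis by (simp add: B'_def)
    qed
    have "(\<lambda>k. ennreal ((B + 1 / real (Suc k) * (m + 1)) powr ?q)) \<longlonglongrightarrow> ennreal ((B + 0 * (m + 1)) powr ?q)"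
      using q B by (intro tendsto_ennrealI tendsto_powr' tendsto_intros LIMSEQ_Suc[OF lim_1_over_n]) (auto simp: m_def add_nonneg_nonneg intro!: always_eventually)
    then have "(\<integral>\<^sup>+ x. ennreal (norm (G x) powr ?q) \<partial>M) \<le> ennreal ((B + 0 * (m + 1)) powr ?q)"
      by (rule LIMSEQ_le_const) (intro exI[of _ 0] allI impI *, simp)
    then show ?thesis using False G B by (auto simp: Lp_le_def)
  qed
qed

lemma Lp_le_sum:
  assumes p: "1 \<le> p" and M: "finite_measure M" and I: "finite I"
    and u: "\<And>i. i \<in> I \<Longrightarrow> Lp_le M p (b i) (u i)"
    and v: "v \<in> borel_measurable M" "\<And>x. x \<in> space M \<Longrightarrow> norm (v x) \<le> (\<Sum>i\<in>I. norm (u i x))"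
  shows "Lp_le M p (\<Sum>i\<in>I. b i) v"
proof (rule Lp_le_Minkowski[OF p finite_measure_count_space[OF I] M _ v(1) _, where F = u and b = b])
  have b0: "b i \<ge> 0" if "i \<in> I" for i using Lp_leD(1)[OF u[OF that]] .
  show "(\<lambda>(t, x). u t x) \<in> borel_measurable (count_space I \<Otimes>\<^sub>M M)"
    using Lp_leD(2)[OF u] by (intro measurable_pair_measure_countable1 countable_finite I) auto
  show "(\<integral>\<^sup>+ t. ennreal (b t) \<partial>count_space I) \<le> ennreal (\<Sum>i\<in>I. b i)"
    using b0 by (simp add: nn_integral_count_space_finite I)
  show "0 \<le> (\<Sum>i\<in>I. b i)" using b0 by (rule sum_nonneg)
  show "ennreal (norm (v x)) \<le> (\<integral>\<^sup>+ t. ennreal (norm (u t x)) \<partial>count_space I)" if "x \<in> space M" for x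
    using v(2)[OF that] by (simp add: nn_integral_count_space_finite I ennreal_leI)
qed (use u in auto)

lemma Lp_le_add:
  assumes p: "1 \<le> p" and M: "finite_measure M" and u: "Lp_le M p a u" and v: "Lp_le M p b v"
  shows "Lp_le M p (a + b) (\<lambda>x. u x + v x)" "Lp_le M p (a + b) (\<lambda>x. u x - v x)"
proof -
  have *: "Lp_le M p (a + b) w" if "w \<in> borel_measurable M" "\<And>x. norm (w x) \<le> norm (u x) + norm (v x)" for w
    using Lp_le_sum[OF p M, of "UNIV :: bool set" "\<lambda>i. if i then b else a" "\<lambda>i. if i then v else u" w] u v that
    by (auto simp: UNIV_bool)
  note [measurable] = Lp_leD(2)[OF u] Lp_leD(2)[OF v]
  show "Lp_le M p (a + b) (\<lambda>x. u x + v x)" by (rule *) (auto intro: norm_triangle_ineq)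
  show "Lp_le M p (a + b) (\<lambda>x. u x - v x)" by (rule *) (auto intro: norm_triangle_ineq4)
qed

lemma Lp_le_measure_preserving:
  assumes T: "T \<in> measurable M M" "distr M M T = M" and u: "Lp_le M p b u"
  shows "Lp_le M p b (\<lambda>x. u (T x))"
proof -
  have [measurable]: "u \<in> borel_measurable M" "T \<in> measurable M M" using u T by (auto simp: Lp_le_def)
  have "(\<integral>\<^sup>+ x. ennreal (norm (u (T x)) powr enn2real p) \<partial>M) = (\<integral>\<^sup>+ x. ennreal (norm (u x) powr enn2real p) \<partial>distr M M T)"
    by (subst nn_integral_distr) auto
  moreover have "(AE x in M. norm (u (T x)) \<le> b) \<longleftrightarrow> (AE x in distr M M T. norm (u x) \<le> b)"
    by (subst AE_distr_iff) auto
  ultimately show ?thesis using u unfolding T(2) by (auto simp: Lp_le_def)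
qed

section \<open>The sphere and its integral means\<close>

lemma nn_integral_lborel_translate:
  fixes f :: "'a::euclidean_space \<Rightarrow> ennreal"
  assumes [measurable]: "f \<in> borel_measurable borel"
  shows "(\<integral>\<^sup>+ x. f (x + c) \<partial>lborel) = (\<integral>\<^sup>+ x. f x \<partial>lborel)"
proof -
  have "(\<integral>\<^sup>+ x. f x \<partial>lborel) = (\<integral>\<^sup>+ x. f x \<partial>distr lborel borel ((+) c))" by (simp add: lborel_distr_plus)
  also have "\<dots> = (\<integral>\<^sup>+ x. f (c + x) \<partial>lborel)" by (subst nn_integral_distr) auto
  finally show ?thesis by (simp add: add.commute)
qed

text \<open>
  Compare Lebesgue measure with its image by integrating \<open>f (Q x) g (Q x - y)\<close> over both
  variables, where \<open>g\<close> is the indicator of the unit ball: integrating \<open>y\<close> first gives the mass of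
  \<open>f\<close> under the image measure, and shifting \<open>x\<close> by \<open>Q\<^sup>-\<^sup>1 y\<close> first gives its Lebesgue integral.
\<close>

lemma distr_lborel_isometry:
  fixes Q :: "'a::euclidean_space \<Rightarrow> 'a"
  assumes Q: "orthogonal_transformation Q"
  shows "distr lborel borel Q = lborel"
proof (rule measure_eqI)
  have lin: "linear Q" using Q by (rule orthogonal_transformation_linear)
  have n: "norm (Q x) = norm x" for x using Q by (rule orthogonal_transformation_norm)
  have Q_add: "Q (x + y) = Q x + Q y" for x y by (rule linear_add[OF lin])
  have [measurable]: "Q \<in> borel_measurable borel"
    by (intro borel_measurable_continuous_onI linear_continuous_on linear_conv_bounded_linear[THEN iffD1] lin)
  fix A assume "A \<in> sets (distr lborel borel Q)"
  then have [measurable]: "A \<in> sets borel" by simp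
  define f :: "'a \<Rightarrow> ennreal" where "f = indicator A"
  define g :: "'a \<Rightarrow> ennreal" where "g = indicator (ball 0 1)"
  have [measurable]: "f \<in> borel_measurable borel" "g \<in> borel_measurable borel" by (auto simp: f_def g_def intro!: borel_measurable_indicator)
  have gQ: "g (Q x) = g x" and g_diff: "g (x - y) = g (y - x)" for x y
    by (auto simp: g_def n norm_minus_commute indicator_def)
  define V where "V = (\<integral>\<^sup>+ y. g y \<partial>lborel)"
  have V: "V = emeasure lborel (ball 0 1 :: 'a set)" by (simp add: V_def g_def)
  have V0: "V \<noteq> 0"
    unfolding V using content_ball_pos[of 1 "0::'a"] by (auto simp: measure_def)
  have Vf: "V \<noteq> \<top>"
    unfolding V using emeasure_lborel_ball_finite[of "0::'a" 1] by simp
  have "(\<integral>\<^sup>+ x. f (Q x) \<partial>lborel) * V = (\<integral>\<^sup>+ x. f (Q x) * (\<integral>\<^sup>+ y. g y \<partial>lborel) \<partial>lborel)"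
    by (simp add: nn_integral_multc V_def)
  also have "\<dots> = (\<integral>\<^sup>+ x. f (Q x) * (\<integral>\<^sup>+ y. g (y + - Q x) \<partial>lborel) \<partial>lborel)"
    by (subst nn_integral_lborel_translate) auto
  also have "\<dots> = (\<integral>\<^sup>+ x. (\<integral>\<^sup>+ y. f (Q x) * g (Q x - y) \<partial>lborel) \<partial>lborel)"
    by (simp add: g_diff[of "Q _"] nn_integral_cmult)
  also have "\<dots> = (\<integral>\<^sup>+ y. (\<integral>\<^sup>+ x. f (Q x) * g (Q x - y) \<partial>lborel) \<partial>lborel)"
    by (rule lborel_pair.Fubini'[symmetric]) measurable
  also have "\<dots> = (\<integral>\<^sup>+ y. (\<integral>\<^sup>+ x. f (Q x + y) * g x \<partial>lborel) \<partial>lborel)"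
  proof (rule nn_integral_cong)
    fix y :: 'a
    obtain c where c: "y = Q c" using orthogonal_transformation_surj[OF Q] by (metis surjD)
    have "(\<integral>\<^sup>+ x. f (Q x) * g (Q x - y) \<partial>lborel) = (\<integral>\<^sup>+ x. f (Q (x + c)) * g (Q (x + c) - y) \<partial>lborel)"
      by (rule nn_integral_lborel_translate[symmetric]) measurable
    also have "\<dots> = (\<integral>\<^sup>+ x. f (Q x + y) * g x \<partial>lborel)" by (simp add: Q_add c gQ)
    finally show "(\<integral>\<^sup>+ x. f (Q x) * g (Q x - y) \<partial>lborel) = (\<integral>\<^sup>+ x. f (Q x + y) * g x \<partial>lborel)" .
  qed
  also have "\<dots> = (\<integral>\<^sup>+ x. (\<integral>\<^sup>+ y. f (Q x + y) * g x \<partial>lborel) \<partial>lborel)"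
    by (rule lborel_pair.Fubini') measurable
  also have "\<dots> = (\<integral>\<^sup>+ x. (\<integral>\<^sup>+ y. f (y + Q x) \<partial>lborel) * g x \<partial>lborel)"
    by (simp add: nn_integral_multc add.commute)
  also have "\<dots> = (\<integral>\<^sup>+ x. (\<integral>\<^sup>+ y. f y \<partial>lborel) * g x \<partial>lborel)"
    by (subst nn_integral_lborel_translate) auto
  also have "\<dots> = (\<integral>\<^sup>+ y. f y \<partial>lborel) * V"
    by (simp add: nn_integral_cmult V_def)
  finally have "(\<integral>\<^sup>+ x. f (Q x) \<partial>lborel) = (\<integral>\<^sup>+ y. f y \<partial>lborel)"
    using V0 Vf by (simp add: mult.commute[of _ V] ennreal_mult_cancel_left)
  moreover have "(\<integral>\<^sup>+ x. f (Q x) \<partial>lborel) = emeasure (distr lborel borel Q) A"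
  proof -
    have "(\<integral>\<^sup>+ x. f (Q x) \<partial>lborel) = (\<integral>\<^sup>+ x. f x \<partial>distr lborel borel Q)" by (subst nn_integral_distr) auto
    then show ?thesis by (simp add: f_def)
  qed
  ultimately show "emeasure (distr lborel borel Q) A = emeasure lborel A" by (simp add: f_def)
qed simp

lemma space_sphere_measure: "space sphere_measure = sphere 0 1"
  by (simp add: sphere_measure_def space_restrict_space)

lemma sets_sphere_measure: "sets sphere_measure = sets (restrict_space borel (sphere 0 1))"
  unfolding sphere_measure_def by (rule sets_restrict_space_cong) simp

lemma emeasure_sphere_measure:
  fixes A :: "(complex ^ 'd) set"
  assumes A: "A \<in> sets sphere_measure"
  shows "emeasure sphere_measure A =
    emeasure lborel (ball 0 1 \<inter> sgn -` A) / emeasure lborel (ball 0 1 :: (complex ^ 'd) set)"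
proof -
  have AS: "A \<subseteq> sphere 0 1" using sets.sets_into_space[OF A] by (simp add: space_sphere_measure)
  have [measurable]: "A \<in> sets borel"
    using A by (simp add: sets_sphere_measure sets_restrict_space_iff)
  have [measurable]: "sgn \<in> borel_measurable (borel :: (complex ^ 'd) measure)"
    unfolding sgn_div_norm[abs_def] by measurable
  have sA: "sgn -` A \<in> sets borel" using measurable_sets[OF \<open>sgn \<in> _\<close> \<open>A \<in> sets borel\<close>] by simp
  have "emeasure sphere_measure A = emeasure (distr (uniform_measure lborel (ball 0 1)) borel sgn) A"
    unfolding sphere_measure_def using AS by (intro emeasure_restrict_space) auto
  also have "\<dots> = emeasure (uniform_measure lborel (ball 0 1)) (sgn -` A)"
    by (subst emeasure_distr) auto
  also have "\<dots> = emeasure lborel (ball 0 1 \<inter> sgn -` A) / emeasure lborel (ball 0 1 :: (complex ^ 'd) set)"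
    using sA by (intro emeasure_uniform_measure) auto
  finally show ?thesis .
qed

lemma emeasure_sphere_measure_le_1: "emeasure sphere_measure (space sphere_measure :: (complex ^ 'd) set) \<le> 1"
proof -
  have V: "emeasure lborel (ball 0 1 :: (complex ^ 'd) set) \<noteq> 0" "emeasure lborel (ball 0 1 :: (complex ^ 'd) set) \<noteq> \<top>"
    using content_ball_pos[of 1 "0::complex ^ 'd"] emeasure_lborel_ball_finite[of "0::complex ^ 'd" 1]
    by (auto simp: measure_def)
  have "emeasure sphere_measure (space sphere_measure :: (complex ^ 'd) set) \<le>
      emeasure lborel (ball 0 1 :: (complex ^ 'd) set) / emeasure lborel (ball 0 1 :: (complex ^ 'd) set)"
    by (subst emeasure_sphere_measure[OF sets.top]) (auto intro!: divide_right_mono_ennreal emeasure_mono)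
  also have "\<dots> = 1" using V by (simp add: ennreal_divide_self less_top)
  finally show ?thesis .
qed

lemma finite_measure_sphere_measure: "finite_measure sphere_measure"
  by (rule finite_measureI)
     (simp only: infinity_ennreal_def, rule less_imp_neq[OF le_less_trans[OF emeasure_sphere_measure_le_1 ennreal_one_less_top]])

lemma borel_measurable_sphere_measure:
  "continuous_on (sphere 0 1) u \<Longrightarrow> u \<in> borel_measurable sphere_measure"
  using borel_measurable_continuous_on_restrict measurable_cong_sets[OF sets_sphere_measure refl] by blast

lemma Lp_le_sphere_isometry:
  fixes Q :: "complex ^ 'd \<Rightarrow> complex ^ 'd"
  assumes Q: "orthogonal_transformation Q" and u: "Lp_le sphere_measure p b u"
  shows "Lp_le sphere_measure p b (\<lambda>\<zeta>. u (Q \<zeta>))"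
proof (rule Lp_le_measure_preserving[OF _ _ u])
  have lin: "linear Q" using Q by (rule orthogonal_transformation_linear)
  have n: "norm (Q x) = norm x" for x using Q by (rule orthogonal_transformation_norm)
  have Qb [measurable]: "Q \<in> borel_measurable borel"
    by (intro borel_measurable_continuous_onI linear_continuous_on linear_conv_bounded_linear[THEN iffD1] lin)
  show Qm: "Q \<in> measurable sphere_measure sphere_measure"
  proof -
    have "Q \<in> measurable (restrict_space borel (sphere 0 1)) (restrict_space borel (sphere 0 1))"
      by (rule measurable_restrict_space3[OF Qb]) (auto simp: n)
    then show ?thesis by (simp add: measurable_cong_sets[OF sets_sphere_measure sets_sphere_measure])
  qed
  show "distr sphere_measure sphere_measure Q = sphere_measure"
  proof (rule measure_eqI)
    fix A assume "A \<in> sets (distr sphere_measure sphere_measure Q)"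
    then have A: "A \<in> sets sphere_measure" by simp
    have AS: "A \<subseteq> sphere 0 1" using sets.sets_into_space[OF A] by (simp add: space_sphere_measure)
    have A': "A \<in> sets borel" using A by (simp add: sets_sphere_measure sets_restrict_space_iff)
    have sgnm: "sgn \<in> borel_measurable (borel :: (complex ^ 'd) measure)"
      unfolding sgn_div_norm[abs_def] by measurable
    have X: "ball 0 1 \<inter> sgn -` A \<in> sets borel" using measurable_sets[OF sgnm A'] by auto
    have sgnQ: "sgn (Q z) = Q (sgn z)" for z by (simp add: sgn_div_norm n linear_scale[OF lin])
    have "emeasure (distr sphere_measure sphere_measure Q) A = emeasure sphere_measure (Q -` A \<inter> space sphere_measure)"
      by (rule emeasure_distr[OF Qm A])
    also have "\<dots> = emeasure lborel (ball 0 1 \<inter> sgn -` (Q -` A \<inter> space sphere_measure)) / emeasure lborel (ball 0 1 :: (complex ^ 'd) set)"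
      by (rule emeasure_sphere_measure[OF measurable_sets[OF Qm A]])
    also have "ball 0 1 \<inter> sgn -` (Q -` A \<inter> space sphere_measure) = Q -` (ball 0 1 \<inter> sgn -` A) \<inter> space lborel"
    proof -
      have "sgn z \<in> space sphere_measure" if "Q (sgn z) \<in> A" for z
        using that AS n[of "sgn z"] by (auto simp: space_sphere_measure)
      then show ?thesis by (auto simp: n sgnQ)
    qed
    also have "emeasure lborel (Q -` (ball 0 1 \<inter> sgn -` A) \<inter> space lborel) = emeasure (distr lborel borel Q) (ball 0 1 \<inter> sgn -` A)"
      using X by (subst emeasure_distr) auto
    also have "\<dots> = emeasure lborel (ball 0 1 \<inter> sgn -` A)" by (simp add: distr_lborel_isometry[OF Q])
    also have "emeasure lborel (ball 0 1 \<inter> sgn -` A) / emeasure lborel (ball 0 1 :: (complex ^ 'd) set) = emeasure sphere_measure A"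
      by (rule emeasure_sphere_measure[OF A, symmetric])
    finally show "emeasure (distr sphere_measure sphere_measure Q) A = emeasure sphere_measure A" .
  qed simp
qed

abbreviation mean_le :: "ennreal \<Rightarrow> real \<Rightarrow> (complex ^ 'd \<Rightarrow> complex) \<Rightarrow> real \<Rightarrow> bool" where
  "mean_le p r g b \<equiv> Lp_le sphere_measure p b (\<lambda>\<zeta>. g (r *\<^sub>R \<zeta>))"

lemma integral_mean_le_iff:
  assumes p: "1 \<le> p" and b: "0 \<le> b" and g: "continuous_on (sphere 0 1) (\<lambda>\<zeta>. g (r *\<^sub>R \<zeta>))"
  shows "integral_mean p r g \<le> ennreal b \<longleftrightarrow> mean_le p r g b"
proof -
  have [measurable]: "(\<lambda>\<zeta>. g (r *\<^sub>R \<zeta>)) \<in> borel_measurable sphere_measure"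
    by (rule borel_measurable_sphere_measure[OF g])
  show ?thesis
  proof (cases "p = \<top>")
    case True
    let ?e = "esssup sphere_measure (\<lambda>\<zeta>. ennreal (norm (g (r *\<^sub>R \<zeta>))))"
    have "?e \<le> ennreal b \<longleftrightarrow> (AE \<zeta> in sphere_measure. norm (g (r *\<^sub>R \<zeta>)) \<le> b)"
    proof
      assume le: "?e \<le> ennreal b"
      have "AE \<zeta> in sphere_measure. ennreal (norm (g (r *\<^sub>R \<zeta>))) \<le> ?e" by (rule esssup_AE)
      then show "AE \<zeta> in sphere_measure. norm (g (r *\<^sub>R \<zeta>)) \<le> b"
        by eventually_elim (use le b in \<open>auto dest: order_trans\<close>)
    next
      assume "AE \<zeta> in sphere_measure. norm (g (r *\<^sub>R \<zeta>)) \<le> b"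
      then have "AE \<zeta> in sphere_measure. ennreal (norm (g (r *\<^sub>R \<zeta>))) \<le> ennreal b"
        by eventually_elim (rule ennreal_leI)
      then show "?e \<le> ennreal b" by (intro esssup_I) measurable
    qed
    then show ?thesis using True b by (auto simp: integral_mean_def Lp_le_def)
  next
    case False
    let ?q = "enn2real p"
    have q: "?q \<ge> 1" by (rule enn2real_ge_1[OF p False])
    define I where "I = (\<integral>\<^sup>+ \<zeta>. ennreal (norm (g (r *\<^sub>R \<zeta>)) powr ?q) \<partial>sphere_measure)"
    have L: "Lp_le sphere_measure p b (\<lambda>\<zeta>. g (r *\<^sub>R \<zeta>)) \<longleftrightarrow> I \<le> ennreal (b powr ?q)"
      using False b by (simp add: Lp_le_def I_def)
    have M: "integral_mean p r g = (if I = \<top> then \<top> else ennreal (enn2real I powr (1 / ?q)))"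
      using False by (simp add: integral_mean_def I_def Let_def)
    show ?thesis
    proof (cases I)
      case (real i)
      have "i powr (1 / ?q) \<le> b \<longleftrightarrow> i \<le> b powr ?q"
      proof
        assume "i powr (1 / ?q) \<le> b"
        then have "(i powr (1 / ?q)) powr ?q \<le> b powr ?q" using q by (intro powr_mono2) auto
        then show "i \<le> b powr ?q" using q real by (simp add: powr_powr)
      next
        assume "i \<le> b powr ?q"
        then have "i powr (1 / ?q) \<le> (b powr ?q) powr (1 / ?q)" using q real by (intro powr_mono2) auto
        then show "i powr (1 / ?q) \<le> b" using q b by (simp add: powr_powr)
      qed
      then show ?thesis unfolding L M using real b by simp
    next
      case top
      then show ?thesis unfolding L M by (simp add: top_unique)
    qed
  qed
qed

lemma Lp_le_integral:
  fixes F :: "real \<Rightarrow> complex ^ 'd \<Rightarrow> complex"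
  assumes p: "1 \<le> p" and F: "continuous_on ({a..b} \<times> sphere 0 1) (\<lambda>(t, \<zeta>). F t \<zeta>)"
    and \<beta> [measurable]: "\<beta> \<in> borel_measurable borel"
    and F\<beta>: "\<And>t. a < t \<Longrightarrow> t < b \<Longrightarrow> Lp_le sphere_measure p (\<beta> t) (F t)"
    and B: "(\<integral>\<^sup>+ t\<in>{a<..<b}. ennreal (\<beta> t) \<partial>lborel) \<le> ennreal B" "0 \<le> B"
  shows "Lp_le sphere_measure p B (\<lambda>\<zeta>. integral {a..b} (\<lambda>t. F t \<zeta>))"
proof -
  let ?N = "restrict_space lborel {a<..<b}"
  have sp: "space ?N = {a<..<b}" by (simp add: space_restrict_space)
  have fin: "finite_measure ?N"
    by (rule finite_measureI) (cases "a \<le> b"; simp add: emeasure_restrict_space sp)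
  show ?thesis
  proof (rule Lp_le_Minkowski[OF p fin finite_measure_sphere_measure, where F = F and b = \<beta>])
    have "(\<lambda>x. indicator ({a..b} \<times> sphere 0 1) x *\<^sub>R (case x of (t, \<zeta>) \<Rightarrow> F t \<zeta>)) \<in> borel_measurable borel"
      by (intro borel_measurable_continuous_on_indicator F) (auto intro!: borel_closed closed_Times)
    then have "(\<lambda>x. indicator ({a..b} \<times> sphere 0 1) x *\<^sub>R (case x of (t, \<zeta>) \<Rightarrow> F t \<zeta>)) \<in> borel_measurable (borel \<Otimes>\<^sub>M borel)"
      by (simp add: borel_prod)
    moreover have "(\<lambda>x. x) \<in> measurable (?N \<Otimes>\<^sub>M sphere_measure) (borel \<Otimes>\<^sub>M (borel :: (complex ^ 'd) measure))"
    proof -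
      have "(\<lambda>\<zeta>. \<zeta>) \<in> measurable sphere_measure (borel :: (complex ^ 'd) measure)"
        by (rule borel_measurable_sphere_measure) (intro continuous_intros)
      then have [measurable]: "snd \<in> measurable (?N \<Otimes>\<^sub>M sphere_measure) (borel :: (complex ^ 'd) measure)"
        using measurable_compose[OF measurable_snd] by auto
      have "(\<lambda>t. t) \<in> measurable ?N borel" by (rule measurable_restrict_space1) simp
      then have [measurable]: "fst \<in> measurable (?N \<Otimes>\<^sub>M (sphere_measure :: (complex ^ 'd) measure)) borel"
        using measurable_compose[OF measurable_fst] by auto
      have "(\<lambda>x. (fst x, snd x)) \<in> measurable (?N \<Otimes>\<^sub>M sphere_measure) (borel \<Otimes>\<^sub>M (borel :: (complex ^ 'd) measure))"
        by measurable
      then show ?thesis by simp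
    qed
    ultimately have "(\<lambda>x. indicator ({a..b} \<times> sphere 0 1) x *\<^sub>R (case x of (t, \<zeta>) \<Rightarrow> F t \<zeta>)) \<in> borel_measurable (?N \<Otimes>\<^sub>M sphere_measure)"
      by (rule measurable_compose[rotated])
    then show "(\<lambda>(t, \<zeta>). F t \<zeta>) \<in> borel_measurable (?N \<Otimes>\<^sub>M sphere_measure)"
      by (rule measurable_cong[THEN iffD1, rotated])
         (auto simp: space_pair_measure sp space_sphere_measure indicator_def)
    have "continuous_on (sphere 0 1) (\<lambda>\<zeta>. integral (cbox a b) (\<lambda>t. F t \<zeta>))"
    proof (rule integral_continuous_on_param)
      have "continuous_on (sphere 0 1 \<times> cbox a b) (\<lambda>x. (\<lambda>(t, \<zeta>). F t \<zeta>) (snd x, fst x))"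
        by (rule continuous_on_compose2[OF F]) (auto intro!: continuous_intros)
      then show "continuous_on (sphere 0 1 \<times> cbox a b) (\<lambda>(\<zeta>, t). F t \<zeta>)"
        by (simp add: case_prod_unfold)
    qed
    then show "(\<lambda>\<zeta>. integral {a..b} (\<lambda>t. F t \<zeta>)) \<in> borel_measurable sphere_measure"
      by (intro borel_measurable_sphere_measure) simp
    show "\<beta> \<in> borel_measurable ?N" by (rule measurable_restrict_space1) simp
    show "Lp_le sphere_measure p (\<beta> t) (F t)" if "t \<in> space ?N" for t
      using F\<beta> that by (auto simp: sp)
    show "(\<integral>\<^sup>+ t. ennreal (\<beta> t) \<partial>?N) \<le> ennreal B" using B by (simp add: nn_integral_restrict_space)
    fix \<zeta> :: "complex ^ 'd" assume "\<zeta> \<in> space sphere_measure"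
    then have \<zeta>: "\<zeta> \<in> sphere 0 1" by (simp add: space_sphere_measure)
    have c: "continuous_on {a..b} (\<lambda>t. F t \<zeta>)"
    proof -
      have "continuous_on {a..b} (\<lambda>t. (\<lambda>(t, \<zeta>). F t \<zeta>) (t, \<zeta>))"
        by (rule continuous_on_compose2[OF F]) (use \<zeta> in \<open>auto intro!: continuous_intros\<close>)
      then show ?thesis by simp
    qed
    have i: "(\<lambda>t. norm (F t \<zeta>)) integrable_on {a..b}"
      by (intro integrable_continuous_real continuous_intros c)
    have "norm (integral {a..b} (\<lambda>t. F t \<zeta>)) \<le> integral {a..b} (\<lambda>t. norm (F t \<zeta>))"
      by (rule integral_norm_bound_integral[OF integrable_continuous_real[OF c] i]) simp
    also have "ennreal (integral {a..b} (\<lambda>t. norm (F t \<zeta>))) = (\<integral>\<^sup>+ t. ennreal (indicator {a<..<b} t * norm (F t \<zeta>)) \<partial>lborel)"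
      by (rule nn_integral_has_integral_lebesgue[symmetric])
         (use i in \<open>auto simp: has_integral_Icc_iff_Ioo[symmetric] has_integral_integral\<close>)
    also have "\<dots> = (\<integral>\<^sup>+ t. ennreal (norm (F t \<zeta>)) \<partial>?N)"
      by (subst nn_integral_restrict_space) (auto intro!: nn_integral_cong simp: indicator_def)
    finally show "ennreal (norm (integral {a..b} (\<lambda>t. F t \<zeta>))) \<le> (\<integral>\<^sup>+ t. ennreal (norm (F t \<zeta>)) \<partial>?N)"
      by (simp add: ennreal_leI)
  qed (use B in auto)
qed

section \<open>Composition with linear contractions\<close>

definition hermitian_inner :: "complex ^ 'd \<Rightarrow> complex ^ 'd \<Rightarrow> complex" where
  "hermitian_inner x y = (\<Sum>i\<in>UNIV. x $ i * cnj (y $ i))"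

lemma hermitian_inner_diff_left: "hermitian_inner (x - y) z = hermitian_inner x z - hermitian_inner y z"
  and hermitian_inner_scale_left: "hermitian_inner (c *s x) z = c * hermitian_inner x z"
  and hermitian_inner_scale_right: "hermitian_inner x (c *s z) = cnj c * hermitian_inner x z"
  by (simp_all add: hermitian_inner_def algebra_simps sum.distrib sum_subtractf sum_distrib_left)

lemma Re_hermitian_inner: "Re (hermitian_inner x y) = inner x y"
  by (simp add: hermitian_inner_def inner_vec_def inner_complex_def)

lemma hermitian_inner_self: "hermitian_inner x x = of_real ((norm x)\<^sup>2)"
proof (rule complex_eqI)
  show "Re (hermitian_inner x x) = Re (of_real ((norm x)\<^sup>2))"
    by (simp add: Re_hermitian_inner power2_norm_eq_inner)
  show "Im (hermitian_inner x x) = Im (of_real ((norm x)\<^sup>2))"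
    by (simp add: hermitian_inner_def)
qed

lemma hermitian_inner_eq_0_iff:
  "hermitian_inner x y = 0 \<longleftrightarrow> inner x y = 0 \<and> inner (\<i> *s x) y = 0"
proof -
  have "inner (\<i> *s x) y = - Im (hermitian_inner x y)"
    by (simp add: Re_hermitian_inner[symmetric] hermitian_inner_scale_left)
  then show ?thesis by (auto simp: complex_eq_iff Re_hermitian_inner)
qed

definition contraction_matrices :: "(complex ^ 'd ^ 'd) set" where
  "contraction_matrices = {A. \<forall>x. norm (A *v x) \<le> norm x}"

lemma contraction_matricesD: "A \<in> contraction_matrices \<Longrightarrow> norm (A *v x) \<le> norm x"
  by (simp add: contraction_matrices_def)

definition outer :: "complex ^ 'd \<Rightarrow> complex ^ 'd \<Rightarrow> complex ^ 'd ^ 'd" where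
  "outer w v = (\<chi> i j. w $ i * cnj (v $ j))"

lemma outer_mult_vec: "outer w v *v x = hermitian_inner x v *s w"
  by (simp add: vec_eq_iff outer_def matrix_vector_mult_def hermitian_inner_def sum_distrib_left mult_ac)

lemma continuous_on_matrix_vector_mult [continuous_intros]:
  fixes A :: "'a::topological_space \<Rightarrow> complex ^ 'd ^ 'e"
  assumes "continuous_on S A" "continuous_on S x"
  shows "continuous_on S (\<lambda>t. A t *v x t)"
  unfolding matrix_vector_mult_def using assms by (intro continuous_intros)

lemma linear_matrix_vector_mult: "linear (\<lambda>x. (A :: complex ^ 'd ^ 'd) *v x)"
proof (rule linearI)
  show "A *v (r *\<^sub>R x) = r *\<^sub>R (A *v x)" for r x
    using vector_scalar_commute[of A "of_real r" x] by (simp add: of_real_smult)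
qed (simp add: matrix_vector_right_distrib)

text \<open>
  A single step of the singular value decomposition.  Let \<open>v\<close> be the unit vector that \<open>A\<close> shortens
  most, say to length \<open>s < 1\<close>.  Minimality forces \<open>A\<close> to map the orthogonal complement of \<open>v\<close> into the
  orthogonal complement of \<open>A v\<close>, so the image of \<open>v\<close> can be moved in a disc of radius \<open>1 - s\<close>
  without affecting the rest.
\<close>

lemma contraction_perturbation:
  fixes A :: "complex ^ 'd ^ 'd"
  assumes A: "A \<in> contraction_matrices" and noniso: "\<exists>x. norm (A *v x) \<noteq> norm x"
  obtains w v where "w \<noteq> 0" "norm v = 1"
    "\<And>l. norm l = 1 \<Longrightarrow> A + outer (l *s w) v \<in> contraction_matrices"
proof -
  have contr: "norm (A *v x) \<le> norm x" for x using A by (simp add: contraction_matrices_def)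
  note lin = linear_matrix_vector_mult[of A]
  have ne: "sphere (0::complex ^ 'd) 1 \<noteq> {}"
    by simp
  have "continuous_on (sphere 0 1) (\<lambda>x. norm (A *v x))" by (intro continuous_intros)
  then obtain v where v: "norm v = 1" and vmin: "\<And>x. norm x = 1 \<Longrightarrow> norm (A *v v) \<le> norm (A *v x)"
    using continuous_attains_inf[OF compact_sphere ne] by (metis dist_0_norm mem_sphere)
  define s where "s = norm (A *v v)"
  have smin: "s * norm x \<le> norm (A *v x)" for x
  proof (cases "x = 0")
    case False
    have "s \<le> norm (A *v (sgn x))" unfolding s_def by (rule vmin) (simp add: norm_sgn False)
    also have "A *v sgn x = (1 / norm x) *\<^sub>R (A *v x)"
      by (simp add: sgn_div_norm linear_scale[OF lin] divide_inverse_commute)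
    finally show ?thesis using False by (simp add: field_simps)
  qed simp
  have s1: "s < 1"
  proof (rule ccontr)
    assume "\<not> s < 1"
    then have "norm x \<le> norm (A *v x)" for x using smin[of x] mult_right_mono[of 1 s "norm x"] by simp
    with noniso contr show False by (metis antisym)
  qed
  have s0: "s \<ge> 0" by (simp add: s_def)
  have i_commute: "A *v (\<i> *s y) = \<i> *s (A *v y)" for y by (rule vector_scalar_commute)
  have i_orth: "hermitian_inner (\<i> *s y) v = 0" if "hermitian_inner y v = 0" for y
    using that by (simp add: hermitian_inner_scale_left)
  obtain u where u: "norm u = 1" and Av: "A *v v = of_real s *s u"
    and orth: "\<And>y. hermitian_inner y v = 0 \<Longrightarrow> hermitian_inner (A *v y) u = 0"
  proof (cases "s = 0")
    \<comment> \<open>Here \<open>A v = 0\<close> has no direction, but \<open>A\<close> is not onto and \<open>u\<close> can be chosen orthogonal to its range.\<close>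
    case True
    then have Av0: "A *v v = 0" by (simp add: s_def)
    then have "\<not> inj (\<lambda>x. A *v x)"
      using v linear_0[OF lin] by (metis injD norm_zero zero_neq_one)
    then have "\<not> surj (\<lambda>x. A *v x)" using linear_surjective_imp_injective[OF lin] by blast
    moreover have "subspace (range (\<lambda>x. A *v x))" by (rule linear_subspace_image[OF lin subspace_UNIV])
    ultimately have "dim (range (\<lambda>x. A *v x)) < DIM(complex ^ 'd)"
      by (metis dim_eq_full dim_subset_UNIV le_neq_implies_less span_eq_iff)
    then obtain x where x: "x \<noteq> 0" "\<And>y. y \<in> span (range (\<lambda>x. A *v x)) \<Longrightarrow> orthogonal x y"
      using orthogonal_to_subspace_exists by blast
    have inn: "inner (A *v y) (sgn x) = 0" for y
    proof -
      have "A *v y \<in> span (range (\<lambda>x. A *v x))" by (intro span_base rangeI)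
      from x(2)[OF this] show ?thesis by (simp add: orthogonal_def sgn_div_norm inner_commute)
    qed
    show ?thesis
    proof (rule that)
      show "norm (sgn x) = 1" using x by (simp add: norm_sgn)
      show "A *v v = of_real s *s sgn x" using Av0 True by simp
      show "hermitian_inner (A *v y) (sgn x) = 0" for y
        by (simp add: hermitian_inner_eq_0_iff inn i_commute[symmetric])
    qed
  next
    case False
    then have s: "s > 0" using s0 by simp
    have inn: "inner (A *v y) (A *v v) = 0" if y: "inner y v = 0" for y
    proof -
      define a where "a = inner (A *v y) (A *v v)"
      define k where "k = (norm (A *v y))\<^sup>2"
      have k: "k \<ge> 0" by (simp add: k_def)
      \<comment> \<open>The first-order condition for the minimum at \<open>v\<close>, along the real line through \<open>v\<close> in the direction \<open>y\<close>.\<close>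
      have quad: "0 \<le> 2 * t * a + t\<^sup>2 * k" for t :: real
      proof -
        have "(s * norm (v + t *\<^sub>R y))\<^sup>2 \<le> (norm (A *v (v + t *\<^sub>R y)))\<^sup>2"
          using s0 by (intro power_mono smin) auto
        also have "A *v (v + t *\<^sub>R y) = A *v v + t *\<^sub>R (A *v y)"
          by (simp add: linear_add[OF lin] linear_scale[OF lin])
        also have "(norm (A *v v + t *\<^sub>R (A *v y)))\<^sup>2 = s\<^sup>2 + 2 * t * a + t\<^sup>2 * k"
          unfolding a_def k_def s_def power2_norm_eq_inner
          by (simp add: inner_add_left inner_add_right inner_commute power2_eq_square algebra_simps)
        also have "(s * norm (v + t *\<^sub>R y))\<^sup>2 = s\<^sup>2 * (1 + t\<^sup>2 * (norm y)\<^sup>2)"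
        proof -
          have "(norm (v + t *\<^sub>R y))\<^sup>2 = (norm v)\<^sup>2 + t\<^sup>2 * (norm y)\<^sup>2"
            using y unfolding power2_norm_eq_inner
            by (simp add: inner_add_left inner_add_right inner_commute[of v y] power2_eq_square)
          then show ?thesis using v by (simp add: power_mult_distrib)
        qed
        finally have "s\<^sup>2 * (t\<^sup>2 * (norm y)\<^sup>2) \<le> 2 * t * a + t\<^sup>2 * k" by (simp add: algebra_simps)
        moreover have "0 \<le> s\<^sup>2 * (t\<^sup>2 * (norm y)\<^sup>2)" by simp
        ultimately show ?thesis by linarith
      qed
      define q where "q = a / (k + 1)"
      have a: "a = q * (k + 1)" using k by (simp add: q_def)
      have "0 \<le> 2 * (- q) * a + (- q)\<^sup>2 * k" by (rule quad)
      also have "\<dots> = - (q\<^sup>2 * (k + 2))" by (simp add: a algebra_simps power2_eq_square)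
      finally have "q\<^sup>2 * (k + 2) \<le> 0" by simp
      then have "q = 0" using k by (auto simp: mult_le_0_iff)
      then show ?thesis using a by (simp add: a_def)
    qed
    show ?thesis
    proof (rule that)
      show "norm ((1 / of_real s) *s (A *v v)) = 1"
        using s by (simp add: norm_vector_smult s_def norm_divide)
      show "A *v v = of_real s *s ((1 / of_real s) *s (A *v v))"
        using s by (simp add: vec_eq_iff)
      show "hermitian_inner (A *v y) ((1 / of_real s) *s (A *v v)) = 0" if y: "hermitian_inner y v = 0" for y
        using inn[of y] inn[of "\<i> *s y"] y
        by (simp add: hermitian_inner_scale_right hermitian_inner_eq_0_iff i_commute)
    qed
  qed
  show ?thesis
  proof (rule that)
    show "of_real (1 - s) *s u \<noteq> 0"
      using u s1 by (metis norm_vector_smult norm_zero mult_cancel_right2 norm_of_real abs_eq_0 diff_gt_0_iff_gt less_irrefl mult_1_right)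
    show "norm v = 1" by (rule v)
    fix l :: complex assume l: "norm l = 1"
    show "A + outer (l *s (of_real (1 - s) *s u)) v \<in> contraction_matrices"
      unfolding contraction_matrices_def
    proof (intro CollectI allI)
      fix x
      define \<alpha> where "\<alpha> = hermitian_inner x v"
      define y where "y = x - \<alpha> *s v"
      define c where "c = \<alpha> * (of_real s + l * of_real (1 - s))"
      have y: "hermitian_inner y v = 0"
        by (simp add: y_def \<alpha>_def hermitian_inner_diff_left hermitian_inner_scale_left hermitian_inner_self v)
      have x: "x = y + \<alpha> *s v" by (simp add: y_def)
      have "(A + outer (l *s (of_real (1 - s) *s u)) v) *v x = A *v x + \<alpha> *s (l *s (of_real (1 - s) *s u))"
        by (simp add: matrix_vector_mult_add_rdistrib outer_mult_vec \<alpha>_def)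
      also have "A *v x = A *v y + \<alpha> *s (of_real s *s u)"
        by (subst x) (simp add: matrix_vector_right_distrib vector_scalar_commute Av)
      also have "A *v y + \<alpha> *s (of_real s *s u) + \<alpha> *s (l *s (of_real (1 - s) *s u)) = A *v y + c *s u"
        by (simp add: vec_eq_iff c_def algebra_simps)
      finally have eq: "(A + outer (l *s (of_real (1 - s) *s u)) v) *v x = A *v y + c *s u" .
      have pyth: "(norm (a + b))\<^sup>2 = (norm a)\<^sup>2 + (norm b)\<^sup>2" if "hermitian_inner a b = 0" for a b :: "complex ^ 'd"
        using that norm_add_Pythagorean[of a b] by (simp add: hermitian_inner_eq_0_iff orthogonal_def)
      have "(norm ((A + outer (l *s (of_real (1 - s) *s u)) v) *v x))\<^sup>2 = (norm (A *v y))\<^sup>2 + (norm (c *s u))\<^sup>2"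
        unfolding eq by (rule pyth) (simp add: hermitian_inner_scale_right orth[OF y])
      also have "\<dots> \<le> (norm y)\<^sup>2 + (norm (\<alpha> *s v))\<^sup>2"
      proof (intro add_mono power_mono contr norm_ge_zero)
        have "norm (of_real s + l * of_real (1 - s)) \<le> norm (of_real s :: complex) + norm (l * of_real (1 - s))"
          by (rule norm_triangle_ineq)
        also have "\<dots> = 1" using s0 s1 l by (simp add: norm_mult del: of_real_diff)
        finally have "norm c \<le> norm \<alpha>" unfolding c_def norm_mult by (simp add: mult_left_le)
        then show "norm (c *s u) \<le> norm (\<alpha> *s v)" by (simp add: norm_vector_smult u v)
      qed
      also have "\<dots> = (norm x)\<^sup>2"
        using pyth[of y "\<alpha> *s v"] y by (simp add: x[symmetric] hermitian_inner_scale_right)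
      finally show "norm ((A + outer (l *s (of_real (1 - s) *s u)) v) *v x) \<le> norm x"
        by (rule power2_le_imp_le) simp
    qed
  qed
qed

lemma compact_contraction_matrices: "compact (contraction_matrices :: (complex ^ 'd ^ 'd) set)"
proof (rule compact_eq_bounded_closed[THEN iffD2, OF conjI])
  have "norm A \<le> (\<Sum>i\<in>(UNIV::'d set). \<Sum>j\<in>(UNIV::'d set). 1)" if A: "A \<in> contraction_matrices" for A :: "complex ^ 'd ^ 'd"
  proof -
    have L: "norm x \<le> (\<Sum>i\<in>UNIV. norm (x $ i))" for x :: "'b::real_normed_vector ^ 'd"
      unfolding norm_vec_def by (rule L2_set_le_sum) simp
    have e: "norm (A $ i $ j) \<le> 1" for i j
    proof -
      have "norm (A $ i $ j) = norm ((A *v axis j 1) $ i)"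
        by (simp add: matrix_vector_mult_def axis_def if_distrib cong: if_cong)
      also have "\<dots> \<le> norm (A *v axis j 1)" by (rule Finite_Cartesian_Product.norm_nth_le)
      also have "\<dots> \<le> 1"
      proof -
        have "norm (axis j 1 :: complex ^ 'd) = 1"
          by (simp add: norm_vec_def L2_set_def axis_def if_distribR if_distrib[of norm] if_distrib[of "\<lambda>x. x\<^sup>2"] cong: if_cong)
        then show ?thesis using contraction_matricesD[OF A] by metis
      qed
      finally show ?thesis .
    qed
    have "norm A \<le> (\<Sum>i\<in>UNIV. norm (A $ i))" unfolding norm_vec_def[of A] by (rule L2_set_le_sum) simp
    also have "\<dots> \<le> (\<Sum>i\<in>UNIV. \<Sum>j\<in>UNIV. norm (A $ i $ j))"
      unfolding norm_vec_def[of "A $ _"] by (intro sum_mono L2_set_le_sum) simp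
    also have "\<dots> \<le> (\<Sum>i\<in>(UNIV::'d set). \<Sum>j\<in>(UNIV::'d set). 1)" by (intro sum_mono e)
    finally show ?thesis by simp
  qed
  then show "bounded (contraction_matrices :: (complex ^ 'd ^ 'd) set)" unfolding bounded_iff by blast
  show "closed (contraction_matrices :: (complex ^ 'd ^ 'd) set)"
    unfolding contraction_matrices_def
    by (intro closed_Collect_all closed_Collect_le continuous_intros)
qed

definition Lp_norm :: "ennreal \<Rightarrow> (complex ^ 'd \<Rightarrow> complex) \<Rightarrow> real" where
  "Lp_norm p u = enn2real (integral_mean p 1 u)"

lemma Lp_norm_nonneg: "0 \<le> Lp_norm p u"
  by (simp add: Lp_norm_def)

lemma Lp_le_cball_bound:
  assumes p: "1 \<le> p" and u: "continuous_on (sphere 0 1) u"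
    and K: "\<And>\<zeta>. norm \<zeta> = 1 \<Longrightarrow> norm (u \<zeta>) \<le> K" "0 \<le> K"
  shows "Lp_le sphere_measure p K u"
  by (rule Lp_le_bounded[OF p borel_measurable_sphere_measure[OF u] emeasure_sphere_measure_le_1])
     (use K in \<open>auto simp: space_sphere_measure\<close>)

lemma continuous_on_sphere_bounded:
  fixes u :: "complex ^ 'd \<Rightarrow> complex"
  assumes u: "continuous_on (sphere 0 1) u"
  obtains K where "0 \<le> K" "\<And>\<zeta>. norm \<zeta> = 1 \<Longrightarrow> norm (u \<zeta>) \<le> K"
proof -
  have "bounded (u ` sphere 0 1)" by (intro compact_imp_bounded compact_continuous_image u compact_sphere)
  then obtain K where "K > 0" "\<And>\<zeta>. \<zeta> \<in> sphere 0 1 \<Longrightarrow> norm (u \<zeta>) \<le> K"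
    unfolding bounded_pos by blast
  with that[of K] show ?thesis by auto
qed

lemma ennreal_Lp_norm:
  assumes p: "1 \<le> p" and u: "continuous_on (sphere 0 1) u"
  shows "ennreal (Lp_norm p u) = integral_mean p 1 u"
proof -
  obtain K where K: "0 \<le> K" "\<And>\<zeta>. norm \<zeta> = 1 \<Longrightarrow> norm (u \<zeta>) \<le> K"
    using continuous_on_sphere_bounded[OF u] by blast
  have "Lp_le sphere_measure p K u" by (rule Lp_le_cball_bound[OF p u K(2,1)])
  then have "integral_mean p 1 u \<le> ennreal K"
    using integral_mean_le_iff[OF p K(1), of u 1] u by simp
  then have "integral_mean p 1 u < \<top>" using le_less_trans ennreal_less_top by blast
  then show ?thesis by (simp add: Lp_norm_def)
qed

lemma Lp_norm_le_iff:
  assumes p: "1 \<le> p" and u: "continuous_on (sphere 0 1) u" and c: "0 \<le> c"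
  shows "Lp_norm p u \<le> c \<longleftrightarrow> Lp_le sphere_measure p c u"
proof -
  have "integral_mean p 1 u \<le> ennreal c \<longleftrightarrow> Lp_le sphere_measure p c u"
    using integral_mean_le_iff[OF p c, of u 1] u by simp
  then show ?thesis using c by (simp add: ennreal_Lp_norm[OF p u, symmetric])
qed

lemma Lp_le_Lp_norm:
  assumes p: "1 \<le> p" and u: "continuous_on (sphere 0 1) u"
  shows "Lp_le sphere_measure p (Lp_norm p u) u"
  using Lp_norm_le_iff[OF p u Lp_norm_nonneg] by blast

lemma Lp_norm_diff_le:
  assumes p: "1 \<le> p" and u: "continuous_on (sphere 0 1) u" and v: "continuous_on (sphere 0 1) v"
    and e: "\<And>\<zeta>. norm \<zeta> = 1 \<Longrightarrow> norm (u \<zeta> - v \<zeta>) \<le> e" "0 \<le> e"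
  shows "Lp_norm p u \<le> Lp_norm p v + e"
proof -
  have "Lp_le sphere_measure p e (\<lambda>\<zeta>. u \<zeta> - v \<zeta>)"
    by (rule Lp_le_cball_bound[OF p continuous_on_diff[OF u v] e])
  from Lp_le_add(1)[OF p finite_measure_sphere_measure Lp_le_Lp_norm[OF p v] this]
  show ?thesis using Lp_norm_le_iff[OF p u] Lp_norm_nonneg[of p v] e(2) by simp
qed

lemma scaleR_mem_unit_ball:
  fixes x :: "complex ^ 'd"
  assumes "norm x \<le> 1" "0 < r" "r < 1"
  shows "r *\<^sub>R x \<in> ball 0 1"
proof -
  have "r * norm x \<le> r" using assms by (simp add: mult_left_le)
  then have "r * norm x < 1" using assms by linarith
  then show ?thesis using assms by simp
qed

text \<open>
  Among the contractions choose one, \<open>V\<close>, where the norm of \<open>h \<circ> V\<close> plus a small multiple of the squared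
  Frobenius norm of \<open>V\<close> is largest.  If \<open>V\<close> were not isometric, it would be the centre of a circle of
  contractions; by the mean value property and Minkowski the norm of \<open>h \<circ> V\<close> is at most its mean over
  the circle, whereas the squared Frobenius norm is strictly smaller than its mean.  Hence \<open>V\<close> is
  isometric and \<open>h \<circ> V\<close> has the norm of \<open>h\<close>.
\<close>

lemma Lp_le_contraction_matrix:
  fixes h :: "complex ^ 'd \<Rightarrow> complex"
  assumes p: "1 \<le> p" and h: "holomorphic_fun_on h (ball 0 1)" and r: "0 < r" "r < 1"
    and A: "A \<in> contraction_matrices" and b: "mean_le p r h b"
  shows "Lp_le sphere_measure p b (\<lambda>\<zeta>. h (r *\<^sub>R (A *v \<zeta>)))"
proof -
  let ?C = "contraction_matrices :: (complex ^ 'd ^ 'd) set"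
  define f where "f = (\<lambda>(A :: complex ^ 'd ^ 'd) \<zeta>. h (r *\<^sub>R (A *v \<zeta>)))"
  define \<Phi> where "\<Phi> = (\<lambda>A. Lp_norm p (f A))"
  have in_ball: "r *\<^sub>R (A *v \<zeta>) \<in> ball 0 1" if "A \<in> ?C" "norm \<zeta> = 1" for A \<zeta>
    using contraction_matricesD[OF that(1), of \<zeta>] that(2) r by (intro scaleR_mem_unit_ball) simp_all
  have cf2: "continuous_on (?C \<times> sphere 0 1) (\<lambda>(A, \<zeta>). f A \<zeta>)"
    unfolding f_def case_prod_unfold
    by (rule continuous_on_compose2[OF holomorphic_fun_on_imp_continuous_on[OF h]])
       (use in_ball in \<open>auto intro!: continuous_intros simp del: mem_ball\<close>)
  have cf: "continuous_on (sphere 0 1) (f A)" if "A \<in> ?C" for A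
  proof -
    have "continuous_on (sphere 0 1) (\<lambda>\<zeta>. (\<lambda>(A, \<zeta>). f A \<zeta>) (A, \<zeta>))"
      by (rule continuous_on_compose2[OF cf2]) (use that in \<open>auto intro!: continuous_intros\<close>)
    then show ?thesis by simp
  qed
  have c\<Phi>: "continuous_on ?C \<Phi>"
  proof -
    have uc: "uniformly_continuous_on (?C \<times> sphere 0 1) (\<lambda>(A, \<zeta>). f A \<zeta>)"
      by (intro compact_uniformly_continuous cf2 compact_Times compact_contraction_matrices compact_sphere)
    have "\<exists>d>0. \<forall>A\<in>?C. \<forall>A'\<in>?C. dist A' A < d \<longrightarrow> dist (\<Phi> A') (\<Phi> A) < e" if e: "e > 0" for e
    proof -
      obtain d where d: "d > 0" "\<And>x x'. x \<in> ?C \<times> sphere 0 1 \<Longrightarrow> x' \<in> ?C \<times> sphere 0 1 \<Longrightarrow> dist x' x < d \<Longrightarrow>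
          dist ((\<lambda>(A, \<zeta>). f A \<zeta>) x') ((\<lambda>(A, \<zeta>). f A \<zeta>) x) < e / 2"
        using uc e unfolding uniformly_continuous_on_def by (metis half_gt_zero)
      have le: "\<Phi> A' \<le> \<Phi> A + e / 2" if A: "A \<in> ?C" "A' \<in> ?C" and dd: "dist A' A < d" for A A'
        unfolding \<Phi>_def
      proof (rule Lp_norm_diff_le[OF p cf[OF A(2)] cf[OF A(1)]])
        fix \<zeta> :: "complex ^ 'd" assume "norm \<zeta> = 1"
        then have "dist (f A' \<zeta>) (f A \<zeta>) < e / 2"
          using d(2)[of "(A, \<zeta>)" "(A', \<zeta>)"] A dd by (simp add: dist_Pair_Pair)
        then show "norm (f A' \<zeta> - f A \<zeta>) \<le> e / 2" by (simp add: dist_norm)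
      qed (use e in auto)
      have "dist (\<Phi> A') (\<Phi> A) < e" if "A \<in> ?C" "A' \<in> ?C" "dist A' A < d" for A A'
        using le[OF that] le[OF that(2,1)] that(3) e by (simp add: dist_commute dist_real_def)
      with d(1) show ?thesis by blast
    qed
    then show ?thesis
      by (intro uniformly_continuous_imp_continuous) (auto simp: uniformly_continuous_on_def)
  qed
  have b0: "b \<ge> 0" using Lp_leD(1)[OF b] .
  have key: "\<exists>V\<in>?C. \<Phi> A \<le> b + \<epsilon> * (norm V)\<^sup>2" if \<epsilon>: "\<epsilon> > 0" for \<epsilon>
  proof -
    have "continuous_on ?C (\<lambda>A. \<Phi> A + \<epsilon> * (norm A)\<^sup>2)" by (intro continuous_intros c\<Phi>)
    moreover have "?C \<noteq> {}" using A by auto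
    ultimately obtain V where V: "V \<in> ?C" and
        Vall: "\<forall>B\<in>?C. \<Phi> B + \<epsilon> * (norm B)\<^sup>2 \<le> \<Phi> V + \<epsilon> * (norm V)\<^sup>2"
      using continuous_attains_sup[OF compact_contraction_matrices] by blast
    then have Vmax: "\<Phi> B + \<epsilon> * (norm B)\<^sup>2 \<le> \<Phi> V + \<epsilon> * (norm V)\<^sup>2" if "B \<in> ?C" for B
      using that by blast
    have "\<forall>x. norm (V *v x) = norm x"
    proof (rule ccontr)
      assume "\<not> (\<forall>x. norm (V *v x) = norm x)"
      then obtain w v where w: "w \<noteq> 0" and v: "norm v = 1"
        and circ: "\<And>l. norm l = 1 \<Longrightarrow> V + outer (l *s w) v \<in> ?C"
        using contraction_perturbation[OF V] by blast
      define W where "W = (\<lambda>t. V + outer (cis (2 * pi * t) *s w) v)"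
      have W: "W t \<in> ?C" for t unfolding W_def by (rule circ) simp
      define T where "T = (\<lambda>l. inner V (outer (l *s w) v))"
      define \<kappa> where "\<kappa> = (norm (outer w v))\<^sup>2"
      have "outer w v \<noteq> 0"
      proof
        assume "outer w v = 0"
        then have "outer w v *v v = 0" by simp
        then show False using w v by (simp add: outer_mult_vec hermitian_inner_self)
      qed
      then have \<kappa>: "\<kappa> > 0" by (simp add: \<kappa>_def)
      have normW: "(norm (W t))\<^sup>2 = (norm V)\<^sup>2 + 2 * T (cis (2 * pi * t)) + \<kappa>" for t
      proof -
        let ?l = "cis (2 * pi * t)"
        have "outer (?l *s w) v $ i = ?l *s (outer w v $ i)" for i
          by (simp add: vec_eq_iff outer_def mult.assoc)
        then have "norm (outer (?l *s w) v) = norm (outer w v)"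
          by (simp add: norm_vec_def[of "outer _ v"] norm_vector_smult)
        moreover have "(norm (V + B))\<^sup>2 = (norm V)\<^sup>2 + 2 * inner V B + (norm B)\<^sup>2" for B
          unfolding power2_norm_eq_inner by (simp add: inner_add_left inner_add_right inner_commute)
        ultimately show ?thesis unfolding W_def \<kappa>_def T_def by presburger
      qed
      have T: "bounded_linear T"
      proof -
        have "linear T" unfolding T_def
        proof (rule linearI)
          have "outer ((a + c) *s w) v = outer (a *s w) v + outer (c *s w) v" for a c
            by (simp add: vec_eq_iff outer_def algebra_simps)
          then show "inner V (outer ((a + c) *s w) v) = inner V (outer (a *s w) v) + inner V (outer (c *s w) v)" for a c
            by (simp add: inner_add_right)
          have "outer ((a *\<^sub>R c) *s w) v = a *\<^sub>R outer (c *s w) v" for a c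
            by (simp add: vec_eq_iff outer_def)
          then show "inner V (outer ((a *\<^sub>R c) *s w) v) = a *\<^sub>R inner V (outer (c *s w) v)" for a c
            by simp
        qed
        then show ?thesis by (simp add: linear_conv_bounded_linear)
      qed
      have "((\<lambda>t. cis (2 * pi * t)) has_integral 0) {0..1}"
        using circle_mean_value(1)[of "\<lambda>z. z" 1] by simp
      from has_integral_linear[OF this T] have "((\<lambda>t. T (cis (2 * pi * t))) has_integral 0) {0..1}"
        using linear_0[OF bounded_linear.linear[OF T]] by (simp add: o_def)
      note T_mean = has_integral_mult_right[OF this, of "2 * \<epsilon>"]
      have const: "((\<lambda>t. \<Phi> V - \<epsilon> * \<kappa>) has_integral (\<Phi> V - \<epsilon> * \<kappa>)) {0..1::real}"
        using has_integral_const_real[of "\<Phi> V - \<epsilon> * \<kappa>" 0 1] by simp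
      define \<beta> where "\<beta> = (\<lambda>t. (\<Phi> V - \<epsilon> * \<kappa>) - 2 * \<epsilon> * T (cis (2 * pi * t)))"
      have \<beta>int: "(\<beta> has_integral (\<Phi> V - \<epsilon> * \<kappa>)) {0..1}"
        using has_integral_diff[OF const T_mean] by (simp add: \<beta>_def)
      \<comment> \<open>The choice of \<open>V\<close> bounds the norm at every point of the circle by \<open>\<beta>\<close>, whose mean is too small.\<close>
      have \<Phi>\<beta>: "\<Phi> (W t) \<le> \<beta> t" for t
        using Vmax[OF W[of t]] unfolding normW \<beta>_def by (simp add: algebra_simps)
      have \<beta>0: "0 \<le> \<beta> t" for t using \<Phi>\<beta>[of t] Lp_norm_nonneg[of p "f (W t)"] by (simp add: \<Phi>_def)
      have nn: "0 \<le> \<Phi> V - \<epsilon> * \<kappa>" by (rule has_integral_nonneg[OF \<beta>int]) (rule \<beta>0)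
      have c\<beta>: "continuous_on UNIV \<beta>"
        unfolding \<beta>_def
        by (intro continuous_intros bounded_linear.continuous_on[OF T])
      have cW: "continuous_on S W" for S
        unfolding W_def outer_def by (intro continuous_intros)
      have "Lp_le sphere_measure p (\<Phi> V - \<epsilon> * \<kappa>) (\<lambda>\<zeta>. integral {0..1} (\<lambda>t. f (W t) \<zeta>))"
      proof (rule Lp_le_integral[OF p _ _ _ _ nn, where \<beta> = \<beta>])
        have "continuous_on ({0..1} \<times> sphere 0 1) (\<lambda>x. (\<lambda>(A, \<zeta>). f A \<zeta>) (W (fst x), snd x))"
          by (rule continuous_on_compose2[OF cf2])
             (use W in \<open>auto intro!: continuous_intros continuous_on_compose2[OF cW]\<close>)
        then show "continuous_on ({0..1} \<times> sphere 0 1) (\<lambda>(t, \<zeta>). f (W t) \<zeta>)"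
          by (simp add: case_prod_unfold)
        show "\<beta> \<in> borel_measurable borel" by (rule borel_measurable_continuous_onI[OF c\<beta>])
        show "Lp_le sphere_measure p (\<beta> t) (f (W t))" for t
          using Lp_norm_le_iff[OF p cf[OF W] \<beta>0] \<Phi>\<beta>[of t] by (simp add: \<Phi>_def)
        have "(\<integral>\<^sup>+ t\<in>{0<..<1}. ennreal (\<beta> t) \<partial>lborel) = (\<integral>\<^sup>+ t. ennreal (indicator {0<..<1} t * \<beta> t) \<partial>lborel)"
          by (intro nn_integral_cong) (simp add: indicator_def)
        also have "\<dots> = ennreal (\<Phi> V - \<epsilon> * \<kappa>)"
          by (rule nn_integral_has_integral_lebesgue[OF \<beta>0]) (use \<beta>int in \<open>simp add: has_integral_Icc_iff_Ioo\<close>)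
        finally show "(\<integral>\<^sup>+ t\<in>{0<..<1}. ennreal (\<beta> t) \<partial>lborel) \<le> ennreal (\<Phi> V - \<epsilon> * \<kappa>)" by simp
      qed
      moreover have "integral {0..1} (\<lambda>t. f (W t) \<zeta>) = f V \<zeta>" if \<zeta>: "norm \<zeta> = 1" for \<zeta>
      proof -
        let ?z = "r *\<^sub>R (V *v \<zeta>)" and ?d = "r *\<^sub>R (hermitian_inner \<zeta> v *s w)"
        have eq: "?z + l *s ?d = r *\<^sub>R ((V + outer (l *s w) v) *v \<zeta>)" for l
          by (simp add: matrix_vector_mult_add_rdistrib outer_mult_vec vec_eq_iff algebra_simps)
        have disc: "V + outer (l *s w) v \<in> ?C" if l: "norm l \<le> 1" for l
        proof (cases "l = 0")
          case True
          have "outer (0 *s w) v = 0" by (simp add: vec_eq_iff outer_def)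
          then show ?thesis using V True by simp
        next
          case False
          let ?s = "sgn l"
          have "norm l *\<^sub>R (?s * a) = l * a" for a using False by (simp add: sgn_div_norm)
          then have "outer (l *s w) v = norm l *\<^sub>R outer (?s *s w) v"
            by (simp add: vec_eq_iff outer_def mult.assoc)
          then have "V + outer (l *s w) v = (1 - norm l) *\<^sub>R V + norm l *\<^sub>R (V + outer (?s *s w) v)"
            by (simp add: scaleR_add_right scaleR_diff_left)
          moreover have "norm (((1 - norm l) *\<^sub>R V + norm l *\<^sub>R (V + outer (?s *s w) v)) *v x) \<le> norm x" for x
          proof -
            let ?B = "V + outer (?s *s w) v"
            have scale: "(a *\<^sub>R M) *v x = a *\<^sub>R (M *v x)" for a and M :: "complex ^ 'd ^ 'd"
              by (simp add: vec_eq_iff matrix_vector_mult_def scaleR_sum_right)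
            have Bc: "?B \<in> ?C" by (rule circ) (use False in \<open>simp add: norm_sgn\<close>)
            have "norm (((1 - norm l) *\<^sub>R V + norm l *\<^sub>R ?B) *v x) \<le> norm ((1 - norm l) *\<^sub>R (V *v x)) + norm (norm l *\<^sub>R (?B *v x))"
              unfolding matrix_vector_mult_add_rdistrib[of "_ *\<^sub>R _"] scale by (rule norm_triangle_ineq)
            also have "\<dots> \<le> (1 - norm l) * norm x + norm l * norm x"
              using l V Bc unfolding norm_scaleR
              by (intro add_mono mult_mono) (auto simp: contraction_matrices_def)
            finally show ?thesis by (simp add: algebra_simps)
          qed
          ultimately show ?thesis by (simp add: contraction_matrices_def)
        qed
        have "((\<lambda>t. h (?z + (of_real 1 * cis (2 * pi * t)) *s ?d)) has_integral h ?z) {0..1}"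
          by (rule holomorphic_fun_on_circle_mean[OF h zero_less_one])
             (unfold eq, intro in_ball disc \<zeta>)
        then show ?thesis
          unfolding eq by (intro integral_unique) (simp add: f_def W_def)
      qed
      ultimately have "Lp_le sphere_measure p (\<Phi> V - \<epsilon> * \<kappa>) (f V)"
        using Lp_le_cong[of sphere_measure "\<lambda>\<zeta>. integral {0..1} (\<lambda>t. f (W t) \<zeta>)" "f V"] by (simp add: space_sphere_measure)
      then have "\<Phi> V \<le> \<Phi> V - \<epsilon> * \<kappa>"
        unfolding \<Phi>_def using Lp_norm_le_iff[OF p cf[OF V]] nn by (simp add: \<Phi>_def)
      then show False using \<epsilon> \<kappa> by (simp add: mult_le_0_iff)
    qed
    then have "orthogonal_transformation (\<lambda>x. V *v x)"
      by (simp add: orthogonal_transformation linear_matrix_vector_mult)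
    from Lp_le_sphere_isometry[OF this b] have "\<Phi> V \<le> b"
      unfolding \<Phi>_def using Lp_norm_le_iff[OF p cf[OF V] b0] by (simp add: f_def)
    moreover have "0 \<le> \<epsilon> * (norm A)\<^sup>2" using \<epsilon> by simp
    ultimately have "\<Phi> A \<le> b + \<epsilon> * (norm V)\<^sup>2" using Vmax[OF A] by linarith
    with V show ?thesis by blast
  qed
  obtain K where K: "K > 0" "\<And>V. V \<in> ?C \<Longrightarrow> norm V \<le> K"
    using compact_imp_bounded[OF compact_contraction_matrices] unfolding bounded_pos by blast
  have "\<Phi> A \<le> b + e" if e: "e > 0" for e
  proof -
    obtain V where V: "V \<in> ?C" "\<Phi> A \<le> b + e / K\<^sup>2 * (norm V)\<^sup>2" using key[of "e / K\<^sup>2"] e K by auto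
    have "e / K\<^sup>2 * (norm V)\<^sup>2 \<le> e / K\<^sup>2 * K\<^sup>2"
      using e K V by (intro mult_left_mono power_mono) auto
    then show ?thesis using V K by simp
  qed
  then have "\<Phi> A \<le> b" by (rule field_le_epsilon)
  then show ?thesis using Lp_norm_le_iff[OF p cf[OF A] b0] by (simp add: \<Phi>_def f_def)
qed

lemma ball_operators_norm_le:
  assumes U: "U \<in> ball_operators"
  shows "norm (U x) \<le> norm x"
proof (rule ccontr)
  assume n: "\<not> norm (U x) \<le> norm x"
  then have pos: "norm (U x) > 0" using norm_ge_zero[of x] by linarith
  have lin: "bounded_linear U" using U by (auto simp: ball_operators_def intro: clinear_imp_bounded_linear)
  have "(1 / norm (U x)) *\<^sub>R x \<in> ball 0 1" using n pos by (simp add: field_simps)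
  then have "U ((1 / norm (U x)) *\<^sub>R x) \<in> ball 0 1" using U unfolding ball_operators_def by blast
  then show False using pos by (simp add: linear_scale[OF bounded_linear.linear[OF lin]])
qed

lemma Lp_le_ball_operator:
  fixes h :: "complex ^ 'd \<Rightarrow> complex"
  assumes p: "1 \<le> p" and h: "holomorphic_fun_on h (ball 0 1)" and r: "0 < r" "r < 1"
    and U: "U \<in> ball_operators" and b: "mean_le p r h b"
  shows "Lp_le sphere_measure p b (\<lambda>\<zeta>. h (r *\<^sub>R U \<zeta>))"
proof -
  have m: "matrix U *v x = U x" for x using U by (intro matrix_works) (simp add: ball_operators_def)
  have "matrix U \<in> contraction_matrices"
    by (simp add: contraction_matrices_def m ball_operators_norm_le[OF U])
  from Lp_le_contraction_matrix[OF p h r this b] show ?thesis by (simp add: m)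
qed

section \<open>Tangential derivatives\<close>

lemma continuous_on_cderiv_compose:
  fixes h :: "complex ^ 'd \<Rightarrow> complex"
  assumes h: "holomorphic_fun_on h S" "open S"
    and a: "continuous_on T a" "\<And>x. x \<in> T \<Longrightarrow> a x \<in> S" and b: "continuous_on T b"
  shows "continuous_on T (\<lambda>x. cderiv h (a x) (b x))"
proof -
  have "continuous_on T (\<lambda>x. \<Sum>i\<in>UNIV. b x $ i * cderiv h (a x) (axis i 1))"
    using a by (intro continuous_intros b continuous_on_compose2[OF continuous_on_cderiv[OF h] a(1)]) auto
  then show ?thesis
    by (rule continuous_on_cong[THEN iffD1, rotated 2]) (use a in \<open>simp_all flip: cderiv_expand[OF h(1)]\<close>)
qed

text \<open>
  For \<open>i \<noteq> j\<close> a real-linear vector field that is complex orthogonal to \<open>\<zeta>\<close>, the infinitesimal generator of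
  rotations of the sphere.
\<close>

definition rotation_field :: "'d \<Rightarrow> 'd \<Rightarrow> complex ^ 'd \<Rightarrow> complex ^ 'd" where
  "rotation_field i j \<zeta> = cnj (\<zeta> $ i) *s axis j 1 - cnj (\<zeta> $ j) *s axis i 1"

lemma rotation_field_nth:
  "rotation_field i j \<zeta> $ k = (if k = j then cnj (\<zeta> $ i) else 0) - (if k = i then cnj (\<zeta> $ j) else 0)"
  by (auto simp: rotation_field_def axis_def)

lemma rotation_field_same: "rotation_field i i \<zeta> = 0"
  by (simp add: rotation_field_def)

lemma continuous_on_rotation_field [continuous_intros]:
  "continuous_on S a \<Longrightarrow> continuous_on S (\<lambda>x. rotation_field i j (a x))"
  unfolding rotation_field_def by (intro continuous_intros)

lemma power2_norm_vec: "(norm x)\<^sup>2 = (\<Sum>i\<in>UNIV. (norm (x $ i))\<^sup>2)"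
  by (simp add: norm_vec_def L2_set_def sum_nonneg)

lemma power2_norm_vec_split:
  fixes x :: "complex ^ 'd"
  assumes "i \<noteq> j"
  shows "(norm x)\<^sup>2 = (norm (x $ i))\<^sup>2 + (norm (x $ j))\<^sup>2 + (\<Sum>k\<in>UNIV - {i, j}. (norm (x $ k))\<^sup>2)"
proof -
  have "(\<Sum>k\<in>UNIV. (norm (x $ k))\<^sup>2) = (\<Sum>k\<in>{i, j}. (norm (x $ k))\<^sup>2) + (\<Sum>k\<in>UNIV - {i, j}. (norm (x $ k))\<^sup>2)"
    by (rule sum.subset_diff[THEN trans[OF _ add.commute]]) auto
  then show ?thesis using assms by (simp add: power2_norm_vec)
qed

lemma norm_rotation_field_le: "norm (rotation_field i j \<zeta>) \<le> norm \<zeta>"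
proof (cases "i = j")
  case False
  have "(norm (rotation_field i j \<zeta>))\<^sup>2 = (norm (\<zeta> $ j))\<^sup>2 + (norm (\<zeta> $ i))\<^sup>2"
    using False by (simp add: power2_norm_vec_split[OF False] rotation_field_nth)
  also have "\<dots> \<le> (norm \<zeta>)\<^sup>2"
    by (simp add: power2_norm_vec_split[OF False, of \<zeta>] sum_nonneg)
  finally show ?thesis by (rule power2_le_imp_le) simp
qed (simp add: rotation_field_same)

lemma norm_rotate_le:
  assumes "norm \<zeta> \<le> 1" "t \<ge> 0" "s \<ge> 0" "t\<^sup>2 + s\<^sup>2 = 1" "norm l \<le> s"
  shows "norm (t *\<^sub>R \<zeta> + l *s rotation_field i j \<zeta>) \<le> 1"
proof -
  have "hermitian_inner \<zeta> (rotation_field i j \<zeta>) =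
      (\<Sum>k\<in>UNIV. if k = j then \<zeta> $ j * \<zeta> $ i else 0) - (\<Sum>k\<in>UNIV. if k = i then \<zeta> $ i * \<zeta> $ j else 0)"
    unfolding hermitian_inner_def sum_subtractf[symmetric]
    by (rule sum.cong) (auto simp: rotation_field_nth algebra_simps)
  also have "\<dots> = 0" by (simp add: mult.commute)
  finally have "hermitian_inner (of_real t *s \<zeta>) (l *s rotation_field i j \<zeta>) = 0"
    by (simp add: hermitian_inner_scale_left hermitian_inner_scale_right)
  then have "(norm (of_real t *s \<zeta> + l *s rotation_field i j \<zeta>))\<^sup>2 = (norm (of_real t *s \<zeta>))\<^sup>2 + (norm (l *s rotation_field i j \<zeta>))\<^sup>2"
    by (intro norm_add_Pythagorean) (simp add: hermitian_inner_eq_0_iff orthogonal_def)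
  also have "\<dots> \<le> t\<^sup>2 + s\<^sup>2"
  proof (intro add_mono power_mono)
    show "norm (of_real t *s \<zeta>) \<le> t" using assms by (simp add: norm_vector_smult mult_left_le)
    have "norm l * norm (rotation_field i j \<zeta>) \<le> s * 1"
      using assms by (intro mult_mono order_trans[OF norm_rotation_field_le]) auto
    then show "norm (l *s rotation_field i j \<zeta>) \<le> s" by (simp add: norm_vector_smult)
  qed auto
  finally have "(norm (of_real t *s \<zeta> + l *s rotation_field i j \<zeta>))\<^sup>2 \<le> 1\<^sup>2" using assms by simp
  then show ?thesis by (metis of_real_smult power2_le_imp_le zero_le_one)
qed

lemma complex_rotation_norm:
  fixes a b e :: complex
  assumes "t\<^sup>2 + s\<^sup>2 = 1" "norm e = 1"
  shows "(norm (of_real t * a - of_real s * e * cnj b))\<^sup>2 + (norm (of_real t * b + of_real s * e * cnj a))\<^sup>2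
      = (norm a)\<^sup>2 + (norm b)\<^sup>2"
proof -
  have e: "e * cnj e = 1" using assms(2) by (simp add: complex_norm_square[symmetric])
  have ts: "(of_real t)\<^sup>2 + (of_real s)\<^sup>2 = (1::complex)"
    using assms(1) by (metis of_real_1 of_real_add of_real_power)
  have "complex_of_real ((norm (of_real t * a - of_real s * e * cnj b))\<^sup>2 + (norm (of_real t * b + of_real s * e * cnj a))\<^sup>2)
      = ((of_real t)\<^sup>2 + (of_real s)\<^sup>2 * (e * cnj e)) * (a * cnj a + b * cnj b)"
    unfolding of_real_add complex_norm_square by (simp add: algebra_simps power2_eq_square)
  also have "\<dots> = complex_of_real ((norm a)\<^sup>2 + (norm b)\<^sup>2)"
    unfolding e of_real_add complex_norm_square using ts by simp
  finally show ?thesis by (simp only: of_real_eq_iff)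
qed

lemma clinearI:
  fixes U :: "complex ^ 'd \<Rightarrow> complex ^ 'e"
  assumes "\<And>x y. U (x + y) = U x + U y" "\<And>c x. U (c *s x) = c *s U x"
  shows "Vector_Spaces.linear (*s) (*s) U"
  unfolding Vector_Spaces.linear_def module_hom_def module_hom_axioms_def
  using assms by (auto simp: vec.vector_space_axioms vec.module_axioms)

lemma ball_operatorsI:
  fixes U :: "complex ^ 'd \<Rightarrow> complex ^ 'd"
  assumes "\<And>x y. U (x + y) = U x + U y" "\<And>c x. U (c *s x) = c *s U x" "\<And>x. norm (U x) \<le> norm x"
  shows "U \<in> ball_operators"
  unfolding ball_operators_def
proof (intro CollectI conjI)
  show "U ` ball 0 1 \<subseteq> ball 0 1" using le_less_trans[OF assms(3)] by auto
qed (rule clinearI[OF assms(1,2)])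

lemma scaling_ball_operator:
  assumes "0 \<le> t" "t \<le> 1"
  shows "(\<lambda>x. t *\<^sub>R x) \<in> (ball_operators :: (complex ^ 'd \<Rightarrow> complex ^ 'd) set)"
  by (rule ball_operatorsI) (use assms in \<open>auto simp: scaleR_add_right vec_eq_iff mult_left_le_one_le\<close>)

text \<open>
  The map \<open>t I + s e J\<close>, with \<open>J\<close> the rotation field, is only real linear, but it is a real isometry
  followed by a complex-linear contraction: on the coordinates \<open>i, j\<close> it is an isometry, the
  others are multiplied by \<open>t\<close>.
\<close>

lemma Lp_le_rotate:
  fixes g :: "complex ^ 'd \<Rightarrow> complex"
  assumes p: "1 \<le> p" and g: "holomorphic_fun_on g (ball 0 1)" and r: "0 < r" "r < 1"
    and b: "mean_le p r g b"
    and ts: "t \<ge> 0" "t \<le> 1" "t\<^sup>2 + s\<^sup>2 = 1" and e: "norm e = 1"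
  shows "Lp_le sphere_measure p b (\<lambda>\<zeta>. g (r *\<^sub>R (t *\<^sub>R \<zeta> + (of_real s * e) *s rotation_field i j \<zeta>)))"
proof (cases "i = j")
  case True
  show ?thesis
    using Lp_le_ball_operator[OF p g r scaling_ball_operator[OF ts(1,2)] b] True
    by (simp add: rotation_field_same)
next
  case False
  define A where "A = (\<lambda>\<zeta>. t *\<^sub>R \<zeta> + (of_real s * e) *s rotation_field i j \<zeta>)"
  define Q :: "complex ^ 'd \<Rightarrow> complex ^ 'd" where
    "Q = (\<lambda>\<zeta>. \<chi> k. if k = i \<or> k = j then A \<zeta> $ k else \<zeta> $ k)"
  define D :: "complex ^ 'd \<Rightarrow> complex ^ 'd" where
    "D = (\<lambda>z. \<chi> k. if k = i \<or> k = j then z $ k else of_real t * z $ k)"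
  have DQ: "D (Q \<zeta>) = A \<zeta>" for \<zeta>
    by (simp add: vec_eq_iff D_def Q_def A_def rotation_field_nth) (simp add: scaleR_conv_of_real)
  have D: "D \<in> ball_operators"
  proof (rule ball_operatorsI)
    show "D (x + y) = D x + D y" for x y by (simp add: D_def vec_eq_iff algebra_simps)
    show "D (c *s x) = c *s D x" for c x by (simp add: D_def vec_eq_iff)
    show "norm (D x) \<le> norm x" for x
      unfolding norm_vec_def
      by (rule L2_set_mono) (use ts in \<open>auto simp: D_def norm_mult mult_left_le_one_le\<close>)
  qed
  have Q: "orthogonal_transformation Q"
    unfolding orthogonal_transformation
  proof
    show "linear Q"
      by (rule linearI) (simp_all add: Q_def A_def vec_eq_iff rotation_field_nth algebra_simps)
    show "\<forall>v. norm (Q v) = norm v"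
    proof
      fix v
      have "(norm (Q v))\<^sup>2 = (norm v)\<^sup>2"
      proof -
        have "Q v $ i = of_real t * v $ i - of_real s * e * cnj (v $ j)"
          "Q v $ j = of_real t * v $ j + of_real s * e * cnj (v $ i)"
          using False by (simp_all add: Q_def A_def rotation_field_nth) (simp_all add: scaleR_conv_of_real)
        moreover have "Q v $ k = v $ k" if "k \<in> UNIV - {i, j}" for k using that by (simp add: Q_def)
        ultimately show ?thesis
          using complex_rotation_norm[OF ts(3) e, of "v $ i" "v $ j"]
          unfolding power2_norm_vec_split[OF False] by simp
      qed
      then show "norm (Q v) = norm v" by simp
    qed
  qed
  have "Lp_le sphere_measure p b (\<lambda>\<zeta>. g (r *\<^sub>R D \<zeta>))" by (rule Lp_le_ball_operator[OF p g r D b])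
  from Lp_le_sphere_isometry[OF Q this] show ?thesis by (simp add: DQ A_def)
qed

text \<open>
  A Cauchy estimate in a complex tangential direction at the point \<open>t r \<zeta>\<close>: since \<open>J \<zeta>\<close> is
  orthogonal to \<open>\<zeta>\<close>, the disc has radius \<open>r \<surd>(1 - t\<^sup>2)\<close>, whereas a radial one would only have radius \<open>r (1 - t)\<close>.
\<close>

lemma Lp_le_tangential_cderiv:
  fixes g :: "complex ^ 'd \<Rightarrow> complex"
  assumes p: "1 \<le> p" and g: "holomorphic_fun_on g (ball 0 1)" and r: "0 < r" "r < 1"
    and b: "mean_le p r g b" and t: "0 < t" "t < 1"
  shows "Lp_le sphere_measure p (b / (r * sqrt (1 - t\<^sup>2))) (\<lambda>\<zeta>. cderiv g ((t * r) *\<^sub>R \<zeta>) (rotation_field i j \<zeta>))"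
proof -
  define s where "s = sqrt (1 - t\<^sup>2)"
  have "t\<^sup>2 < 1" using t by (simp add: power_less_one_iff abs_square_less_1)
  then have s: "s > 0" "t\<^sup>2 + s\<^sup>2 = 1" by (simp_all add: s_def)
  define \<rho> where "\<rho> = r * s"
  have \<rho>: "\<rho> > 0" using r s by (simp add: \<rho>_def)
  have b0: "b \<ge> 0" using Lp_leD(1)[OF b] .
  have eq: "(t * r) *\<^sub>R \<zeta> + (of_real \<rho> * l) *s v = r *\<^sub>R (t *\<^sub>R \<zeta> + (of_real s * l) *s v)" for \<zeta> v and l :: complex
    by (simp add: vec_eq_iff \<rho>_def algebra_simps) (simp add: scaleR_conv_of_real)
  have in_ball: "r *\<^sub>R (t *\<^sub>R \<zeta> + (of_real s * l) *s rotation_field i j \<zeta>) \<in> ball 0 1"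
    if "norm \<zeta> = 1" "norm l \<le> 1" for \<zeta> :: "complex ^ 'd" and l
    using that t s r
    by (intro scaleR_mem_unit_ball norm_rotate_le[of _ _ s]) (auto simp: norm_mult mult_left_le)
  define F where "F = (\<lambda>u \<zeta>. (cis (- (2 * pi * u)) / of_real \<rho>) *
      g (r *\<^sub>R (t *\<^sub>R \<zeta> + (of_real s * cis (2 * pi * u)) *s rotation_field i j \<zeta>)))"
  have int: "integral {0..1} (\<lambda>u. F u \<zeta>) = cderiv g ((t * r) *\<^sub>R \<zeta>) (rotation_field i j \<zeta>)"
    if \<zeta>: "norm \<zeta> = 1" for \<zeta>
  proof -
    have "(t * r) *\<^sub>R \<zeta> + l *s rotation_field i j \<zeta> \<in> ball 0 1" if "norm l \<le> \<rho>" for l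
      using in_ball[OF \<zeta>, of "l / of_real \<rho>"] eq[of \<zeta> "l / of_real \<rho>" "rotation_field i j \<zeta>"] \<rho> that
      by (simp add: norm_divide)
    from integral_unique[OF holomorphic_fun_on_circle_deriv[OF g \<rho> this]]
    show ?thesis unfolding eq by (simp add: F_def mult_ac)
  qed
  have "Lp_le sphere_measure p (b / \<rho>) (\<lambda>\<zeta>. integral {0..1} (\<lambda>u. F u \<zeta>))"
  proof (rule Lp_le_integral[OF p, where \<beta> = "\<lambda>_. b / \<rho>"])
    show "continuous_on ({0..1} \<times> sphere 0 1) (\<lambda>(u, \<zeta>). F u \<zeta>)"
      unfolding F_def case_prod_unfold using \<rho>
      by (auto intro!: continuous_intros in_ball simp del: mem_ball
          intro!: continuous_on_compose2[OF holomorphic_fun_on_imp_continuous_on[OF g]])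
    show "Lp_le sphere_measure p (b / \<rho>) (F u)" for u
      using Lp_le_cmult[OF p Lp_le_rotate[OF p g r b _ _ s(2), of "cis (2 * pi * u)" i j], of "cis (- (2 * pi * u)) / of_real \<rho>"] t \<rho>
      by (simp add: F_def norm_divide)
    show "(\<integral>\<^sup>+ t\<in>{0::real<..<1}. ennreal (b / \<rho>) \<partial>lborel) \<le> ennreal (b / \<rho>)"
      by (simp add: nn_integral_cmult_indicator)
  qed (use b0 \<rho> in auto)
  then have "Lp_le sphere_measure p (b / \<rho>) (\<lambda>\<zeta>. cderiv g ((t * r) *\<^sub>R \<zeta>) (rotation_field i j \<zeta>))"
    by (rule Lp_le_cong[THEN iffD1, rotated]) (simp add: space_sphere_measure int)
  then show ?thesis by (simp add: \<rho>_def s_def)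
qed

lemma cderiv_eq_integral_radial:
  assumes f: "holomorphic_fun_on f (ball 0 1)" and z: "norm z < 1"
  shows "((\<lambda>t. cderiv (radial f) (t *\<^sub>R z) w) has_integral cderiv f z w) {0..1}"
proof -
  let ?h = "\<lambda>y. cderiv f y w"
  have h: "holomorphic_fun_on ?h (ball 0 1)" by (rule holomorphic_fun_on_cderiv[OF f open_ball])
  have "((\<lambda>t. of_real t * ?h (t *\<^sub>R z)) has_vector_derivative cderiv (radial f) (t *\<^sub>R z) w) (at t within {0..1})"
    if t: "t \<in> {0..1}" for t :: real
  proof -
    have tz: "t *\<^sub>R z \<in> ball 0 1"
      using t z mult_left_le_one_le[of "norm z" t] by auto
    have "(?h has_derivative cderiv ?h (t *\<^sub>R z)) (at (t *\<^sub>R z))" by (rule holomorphic_fun_onD(1)[OF h tz])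
    then have "((\<lambda>t. ?h (t *\<^sub>R z)) has_derivative (\<lambda>s. cderiv ?h (t *\<^sub>R z) (s *\<^sub>R z))) (at t)"
      by (rule has_derivative_compose[rotated]) (auto intro!: derivative_eq_intros)
    moreover have "cderiv ?h (t *\<^sub>R z) (s *\<^sub>R z) = of_real s * cderiv ?h (t *\<^sub>R z) z" for s
      using holomorphic_fun_onD(2)[OF h tz, of "of_real s" z] by (simp add: of_real_smult)
    ultimately have "((\<lambda>t. ?h (t *\<^sub>R z)) has_vector_derivative cderiv ?h (t *\<^sub>R z) z) (at t)"
      by (simp add: has_vector_derivative_def scaleR_conv_of_real)
    moreover have "((\<lambda>t. complex_of_real t) has_vector_derivative 1) (at t)"
      by (auto simp: has_vector_derivative_def scaleR_conv_of_real intro!: derivative_eq_intros)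
    ultimately have "((\<lambda>t. of_real t * ?h (t *\<^sub>R z)) has_vector_derivative
        (of_real t * cderiv ?h (t *\<^sub>R z) z + 1 * ?h (t *\<^sub>R z))) (at t)"
      by (intro has_vector_derivative_mult)
    moreover have "of_real t * cderiv ?h (t *\<^sub>R z) z + 1 * ?h (t *\<^sub>R z) = cderiv (radial f) (t *\<^sub>R z) w"
      using cderiv_radial[OF f open_ball tz, of w] holomorphic_fun_onD(2)[OF h tz, of "of_real t" z]
      by (simp add: of_real_smult)
    ultimately show ?thesis by (simp add: has_vector_derivative_at_within)
  qed
  from fundamental_theorem_of_calculus[OF zero_le_one this] show ?thesis by simp
qed

text \<open>
  Integrate the previous estimate, applied to \<open>radial f\<close>, over \<open>t\<close>: the factor \<open>1 / \<surd>(1 - t\<^sup>2)\<close> has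
  the integral \<open>\<pi> / 2\<close>.
\<close>

lemma Lp_le_rotation_cderiv:
  fixes f :: "complex ^ 'd \<Rightarrow> complex"
  assumes p: "1 \<le> p" and f: "holomorphic_fun_on f (ball 0 1)" and r: "0 < r" "r < 1"
    and b: "mean_le p r (radial f) b"
  shows "Lp_le sphere_measure p (pi / 2 * b) (\<lambda>\<zeta>. of_real r * cderiv f (r *\<^sub>R \<zeta>) (rotation_field i j \<zeta>))"
proof -
  let ?g = "radial f"
  have g: "holomorphic_fun_on ?g (ball 0 1)" by (rule holomorphic_fun_on_radial[OF f open_ball])
  have b0: "b \<ge> 0" using Lp_leD(1)[OF b] .
  define F where "F = (\<lambda>t \<zeta>. of_real r * cderiv ?g ((t * r) *\<^sub>R \<zeta>) (rotation_field i j \<zeta>))"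
  define \<beta> where "\<beta> = (\<lambda>t::real. b * inverse (sqrt \<bar>1 - t\<^sup>2\<bar>))"
  have \<beta>: "(\<beta> has_integral b * (arcsin 1 - arcsin 0)) {0..1}"
  proof -
    have "((\<lambda>t. inverse (sqrt \<bar>1 - t\<^sup>2\<bar>)) has_integral (arcsin 1 - arcsin 0)) {0..1::real}"
    proof (rule fundamental_theorem_of_calculus_interior)
      show "continuous_on {0..1} arcsin" by (rule continuous_on_subset[OF continuous_on_arcsin']) auto
      fix t :: real assume t: "t \<in> {0<..<1}"
      then have "t\<^sup>2 < 1" by (simp add: power_less_one_iff abs_square_less_1)
      then have "DERIV arcsin t :> inverse (sqrt \<bar>1 - t\<^sup>2\<bar>)" using DERIV_arcsin[of t] t by simp
      then show "(arcsin has_vector_derivative inverse (sqrt \<bar>1 - t\<^sup>2\<bar>)) (at t)"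
        by (simp add: has_real_derivative_iff_has_vector_derivative)
    qed simp
    then show ?thesis unfolding \<beta>_def by (rule has_integral_mult_right)
  qed
  have tr: "norm ((t * r) *\<^sub>R \<zeta>) < 1" if "0 \<le> t" "t \<le> 1" "norm \<zeta> = 1" for t and \<zeta> :: "complex ^ 'd"
    using scaleR_mem_unit_ball[of "t *\<^sub>R \<zeta>" r] that r by (simp add: mult.commute)
  have "Lp_le sphere_measure p (pi / 2 * b) (\<lambda>\<zeta>. integral {0..1} (\<lambda>t. F t \<zeta>))"
  proof (rule Lp_le_integral[OF p, where \<beta> = \<beta>])
    show "continuous_on ({0..1} \<times> sphere 0 1) (\<lambda>(t, \<zeta>). F t \<zeta>)"
      unfolding F_def case_prod_unfold
      by (intro continuous_on_mult continuous_on_const continuous_on_cderiv_compose[OF g open_ball])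
         (use tr in \<open>auto intro!: continuous_intros\<close>)
    show "\<beta> \<in> borel_measurable borel" unfolding \<beta>_def by measurable
    fix t :: real assume t: "0 < t" "t < 1"
    then have t2: "t\<^sup>2 < 1" by (simp add: power_less_one_iff abs_square_less_1)
    have "norm (complex_of_real r) * (b / (r * sqrt (1 - t\<^sup>2))) = \<beta> t"
      using r t2 by (simp add: \<beta>_def field_simps)
    then show "Lp_le sphere_measure p (\<beta> t) (F t)"
      using Lp_le_cmult[OF p Lp_le_tangential_cderiv[OF p g r b t, of i j], of "of_real r"] by (simp add: F_def)
  next
    have "(\<integral>\<^sup>+ t\<in>{0<..<1}. ennreal (\<beta> t) \<partial>lborel) = (\<integral>\<^sup>+ t. ennreal (indicator {0<..<1} t * \<beta> t) \<partial>lborel)"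
      by (intro nn_integral_cong) (simp add: indicator_def)
    also have "\<dots> = ennreal (b * (arcsin 1 - arcsin 0))"
      by (rule nn_integral_has_integral_lebesgue) (use \<beta> b0 in \<open>simp_all add: has_integral_Icc_iff_Ioo \<beta>_def\<close>)
    finally show "(\<integral>\<^sup>+ t\<in>{0<..<1}. ennreal (\<beta> t) \<partial>lborel) \<le> ennreal (pi / 2 * b)" by (simp add: mult.commute)
  qed (use b0 in auto)
  then show ?thesis
  proof (rule Lp_le_cong[THEN iffD1, rotated])
    fix \<zeta> :: "complex ^ 'd" assume "\<zeta> \<in> space sphere_measure"
    then have "norm (r *\<^sub>R \<zeta>) < 1" using r by (simp add: space_sphere_measure)
    from integral_unique[OF cderiv_eq_integral_radial[OF f this, of "rotation_field i j \<zeta>"]]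
    show "integral {0..1} (\<lambda>t. F t \<zeta>) = of_real r * cderiv f (r *\<^sub>R \<zeta>) (rotation_field i j \<zeta>)"
      by (simp add: F_def)
  qed
qed

lemma axis_eq_radial_plus_rotation:
  assumes "norm \<zeta> = 1"
  shows "axis j 1 = cnj (\<zeta> $ j) *s \<zeta> + (\<Sum>i\<in>UNIV. \<zeta> $ i *s rotation_field i j \<zeta>)"
proof (subst vec_eq_iff, rule allI)
  fix k
  have n: "(\<Sum>i\<in>UNIV. \<zeta> $ i * cnj (\<zeta> $ i)) = 1"
    using hermitian_inner_self[of \<zeta>] assms by (simp add: hermitian_inner_def)
  have "(\<Sum>i\<in>UNIV. \<zeta> $ i * rotation_field i j \<zeta> $ k) =
      (\<Sum>i\<in>UNIV. if k = j then \<zeta> $ i * cnj (\<zeta> $ i) else 0) - (\<Sum>i\<in>UNIV. if i = k then \<zeta> $ k * cnj (\<zeta> $ j) else 0)"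
    unfolding sum_subtractf[symmetric] by (rule sum.cong) (auto simp: rotation_field_nth algebra_simps)
  also have "\<dots> = (if k = j then 1 else 0) - \<zeta> $ k * cnj (\<zeta> $ j)"
    using n by simp
  finally show "axis j 1 $ k = (cnj (\<zeta> $ j) *s \<zeta> + (\<Sum>i\<in>UNIV. \<zeta> $ i *s rotation_field i j \<zeta>)) $ k"
    by (simp add: axis_def mult.commute)
qed

text \<open>
  A coordinate vector is the sum of a radial vector and of tangential vectors, with coefficients bounded by 1.
\<close>

lemma Lp_le_partial_deriv:
  fixes f :: "complex ^ 'd \<Rightarrow> complex"
  assumes p: "1 \<le> p" and f: "holomorphic_fun_on f (ball 0 1)" and r: "0 < r" "r < 1"
    and b: "mean_le p r (radial f) b"
  shows "Lp_le sphere_measure p ((1 + real CARD('d) * (pi / 2)) * b)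
    (\<lambda>\<zeta>. of_real r * cderiv f (r *\<^sub>R \<zeta>) (axis j 1))"
proof -
  define u :: "'d option \<Rightarrow> complex ^ 'd \<Rightarrow> complex" where
    "u = (\<lambda>k \<zeta>. case k of None \<Rightarrow> radial f (r *\<^sub>R \<zeta>)
      | Some i \<Rightarrow> of_real r * cderiv f (r *\<^sub>R \<zeta>) (rotation_field i j \<zeta>))"
  define \<beta> where "\<beta> = (\<lambda>k :: 'd option. case k of None \<Rightarrow> b | Some i \<Rightarrow> pi / 2 * b)"
  have "Lp_le sphere_measure p (\<Sum>k\<in>UNIV. \<beta> k) (\<lambda>\<zeta>. of_real r * cderiv f (r *\<^sub>R \<zeta>) (axis j 1))"
  proof (rule Lp_le_sum[OF p finite_measure_sphere_measure, where u = u])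
    show "Lp_le sphere_measure p (\<beta> k) (u k)" for k
      using b Lp_le_rotation_cderiv[OF p f r b] by (cases k) (auto simp: u_def \<beta>_def)
    show "(\<lambda>\<zeta>. of_real r * cderiv f (r *\<^sub>R \<zeta>) (axis j 1)) \<in> borel_measurable sphere_measure"
      by (intro borel_measurable_sphere_measure continuous_on_mult continuous_on_const
          continuous_on_cderiv_compose[OF f open_ball]) (use r in \<open>auto intro!: continuous_intros\<close>)
    fix \<zeta> :: "complex ^ 'd" assume "\<zeta> \<in> space sphere_measure"
    then have \<zeta>: "norm \<zeta> = 1" by (simp add: space_sphere_measure)
    have rz: "r *\<^sub>R \<zeta> \<in> ball 0 1" using \<zeta> r by simp
    note D = holomorphic_fun_onD[OF f rz]
    have lin: "linear (cderiv f (r *\<^sub>R \<zeta>))" using D(1) has_derivative_linear by blast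
    have comp: "norm (\<zeta> $ i) \<le> 1" for i using Finite_Cartesian_Product.norm_nth_le[of \<zeta> i] \<zeta> by simp
    have "of_real r * cderiv f (r *\<^sub>R \<zeta>) \<zeta> = radial f (r *\<^sub>R \<zeta>)"
      using D(2)[of "of_real r" \<zeta>] by (simp add: radial_def of_real_smult)
    then have "of_real r * cderiv f (r *\<^sub>R \<zeta>) (axis j 1) =
        cnj (\<zeta> $ j) * u None \<zeta> + (\<Sum>i\<in>UNIV. \<zeta> $ i * u (Some i) \<zeta>)"
      by (subst axis_eq_radial_plus_rotation[OF \<zeta>])
         (simp add: linear_add[OF lin] linear_sum[OF lin] D(2) u_def sum_distrib_left algebra_simps)
    also have "norm \<dots> \<le> norm (cnj (\<zeta> $ j) * u None \<zeta>) + (\<Sum>i\<in>UNIV. norm (\<zeta> $ i * u (Some i) \<zeta>))"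
      by (intro norm_triangle_le add_mono norm_sum order_refl)
    also have "\<dots> \<le> norm (u None \<zeta>) + (\<Sum>i\<in>UNIV. norm (u (Some i) \<zeta>))"
      unfolding norm_mult by (intro add_mono sum_mono mult_left_le_one_le) (auto simp: comp)
    also have "\<dots> = (\<Sum>k\<in>UNIV. norm (u k \<zeta>))"
      by (simp add: UNIV_option_conv sum.reindex)
    finally show "norm (of_real r * cderiv f (r *\<^sub>R \<zeta>) (axis j 1)) \<le> (\<Sum>k\<in>UNIV. norm (u k \<zeta>))" .
  qed simp
  moreover have "(\<Sum>k\<in>UNIV. \<beta> k) = (1 + real CARD('d) * (pi / 2)) * b"
    by (simp add: UNIV_option_conv sum.reindex \<beta>_def algebra_simps)
  ultimately show ?thesis by simp
qed

section \<open>Differences and radial derivatives\<close>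

text \<open>The constant of the first-order estimate; it depends on the dimension alone.\<close>

definition diff_const :: "'d itself \<Rightarrow> real" where
  "diff_const _ = real CARD('d) * (1 + real CARD('d) * (pi / 2))"

text \<open>
  Integrate the gradient along the segment from the identity to \<open>U\<close>.  The segment consists of contractions,
  and composition with them does not increase the means of the partial derivatives.
\<close>

lemma Lp_le_op_diff:
  fixes g :: "complex ^ 'd \<Rightarrow> complex"
  assumes p: "1 \<le> p" and g: "holomorphic_fun_on g (ball 0 1)" and r: "0 < r" "r < 1"
    and U: "U \<in> ball_operators" and \<delta>: "onorm (\<lambda>z. U z - z) \<le> \<delta>"
    and b: "mean_le p r (radial g) b"
  shows "mean_le p r (op_diff U g) (diff_const TYPE('d) * \<delta> * b)"
proof -
  have lin: "Vector_Spaces.linear (*s) (*s) U" using U by (simp add: ball_operators_def)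
  have bl: "bounded_linear U" by (rule clinear_imp_bounded_linear[OF lin])
  have blE: "bounded_linear (\<lambda>z. U z - z)" by (intro bounded_linear_sub bl bounded_linear_ident)
  have cU: "continuous_on S a \<Longrightarrow> continuous_on S (\<lambda>x. U (a x))" for S and a :: "'x::topological_space \<Rightarrow> complex ^ 'd"
    by (rule bounded_linear.continuous_on[OF bl])
  have \<delta>0: "\<delta> \<ge> 0" using onorm_pos_le[OF blE] \<delta> by simp
  define V where "V = (\<lambda>s x. (1 - s) *\<^sub>R x + s *\<^sub>R U x)"
  have V: "V s \<in> ball_operators" if s: "0 \<le> s" "s \<le> 1" for s
  proof (rule ball_operatorsI)
    show "V s (x + y) = V s x + V s y" for x y by (simp add: V_def clinear_add[OF lin] algebra_simps)
    show "V s (c *s x) = c *s V s x" for c x by (simp add: V_def clinear_scale[OF lin] vec_eq_iff algebra_simps)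
    fix x
    have "norm (V s x) \<le> norm ((1 - s) *\<^sub>R x) + norm (s *\<^sub>R U x)" unfolding V_def by (rule norm_triangle_ineq)
    also have "\<dots> \<le> (1 - s) * norm x + s * norm x"
      using s ball_operators_norm_le[OF U, of x] by (simp add: mult_left_mono)
    finally show "norm (V s x) \<le> norm x" by (simp add: algebra_simps)
  qed
  have inb: "r *\<^sub>R V s \<zeta> \<in> ball 0 1" if "0 \<le> s" "s \<le> 1" "norm \<zeta> = 1" for s \<zeta>
    using ball_operators_norm_le[OF V[OF that(1,2)], of \<zeta>] that r by (intro scaleR_mem_unit_ball) auto
  define F where "F = (\<lambda>s \<zeta>. cderiv g (r *\<^sub>R V s \<zeta>) (r *\<^sub>R (U \<zeta> - \<zeta>)))"
  define K where "K = 1 + real CARD('d) * (pi / 2)"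
  have b0: "b \<ge> 0" using Lp_leD(1)[OF b] .
  have K0: "K \<ge> 0" by (simp add: K_def)
  have K: "diff_const TYPE('d) * \<delta> * b = (\<Sum>j\<in>(UNIV::'d set). \<delta> * (K * b))" by (simp add: diff_const_def K_def)
  have Fb: "Lp_le sphere_measure p (\<Sum>j\<in>(UNIV::'d set). \<delta> * (K * b)) (F s)" if s: "0 \<le> s" "s \<le> 1" for s
  proof (rule Lp_le_sum[OF p finite_measure_sphere_measure, where
        u = "\<lambda>j \<zeta>. of_real \<delta> * (of_real r * cderiv g (r *\<^sub>R V s \<zeta>) (axis j 1))"])
    fix j
    have "Lp_le sphere_measure p (K * b) (\<lambda>\<zeta>. of_real r * cderiv g (r *\<^sub>R V s \<zeta>) (axis j 1))"
      using Lp_le_ball_operator[OF p holomorphic_fun_on_cmult[OF holomorphic_fun_on_cderiv[OF g open_ball]] r V[OF s]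
          Lp_le_partial_deriv[OF p g r b]] by (simp add: K_def)
    from Lp_le_cmult[OF p this, of "of_real \<delta>"]
    show "Lp_le sphere_measure p (\<delta> * (K * b)) (\<lambda>\<zeta>. of_real \<delta> * (of_real r * cderiv g (r *\<^sub>R V s \<zeta>) (axis j 1)))"
      using \<delta>0 by simp
  next
    show "F s \<in> borel_measurable sphere_measure"
      unfolding F_def
      by (intro borel_measurable_sphere_measure continuous_on_cderiv_compose[OF g open_ball])
         (use inb s in \<open>auto simp: V_def intro!: continuous_intros cU\<close>)
    fix \<zeta> :: "complex ^ 'd" assume "\<zeta> \<in> space sphere_measure"
    then have \<zeta>: "norm \<zeta> = 1" by (simp add: space_sphere_measure)
    have comp: "norm ((U \<zeta> - \<zeta>) $ j) \<le> \<delta>" for j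
      using Finite_Cartesian_Product.norm_nth_le[of "U \<zeta> - \<zeta>" j] onorm[OF blE, of \<zeta>] \<delta> \<zeta> by simp
    have "norm (F s \<zeta>) = norm (\<Sum>j\<in>UNIV. (r *\<^sub>R (U \<zeta> - \<zeta>)) $ j * cderiv g (r *\<^sub>R V s \<zeta>) (axis j 1))"
      unfolding F_def by (subst cderiv_expand[OF g inb[OF s \<zeta>]]) simp
    also have "\<dots> \<le> (\<Sum>j\<in>UNIV. norm ((r *\<^sub>R (U \<zeta> - \<zeta>)) $ j * cderiv g (r *\<^sub>R V s \<zeta>) (axis j 1)))"
      by (rule norm_sum)
    also have "\<dots> \<le> (\<Sum>j\<in>UNIV. norm (of_real \<delta> * (of_real r * cderiv g (r *\<^sub>R V s \<zeta>) (axis j 1))))"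
    proof (rule sum_mono)
      fix j
      have "norm ((U \<zeta> - \<zeta>) $ j) * (r * norm (cderiv g (r *\<^sub>R V s \<zeta>) (axis j 1))) \<le> \<delta> * (r * norm (cderiv g (r *\<^sub>R V s \<zeta>) (axis j 1)))"
        using r by (intro mult_right_mono comp) auto
      then show "norm ((r *\<^sub>R (U \<zeta> - \<zeta>)) $ j * cderiv g (r *\<^sub>R V s \<zeta>) (axis j 1)) \<le>
          norm (of_real \<delta> * (of_real r * cderiv g (r *\<^sub>R V s \<zeta>) (axis j 1)))"
        using r \<delta>0 by (simp add: norm_mult mult_ac)
    qed
    finally show "norm (F s \<zeta>) \<le> (\<Sum>j\<in>UNIV. norm (of_real \<delta> * (of_real r * cderiv g (r *\<^sub>R V s \<zeta>) (axis j 1))))" .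
  qed simp
  let ?B = "\<Sum>j\<in>(UNIV::'d set). \<delta> * (K * b)"
  have L: "Lp_le sphere_measure p ?B (\<lambda>\<zeta>. integral {0..1} (\<lambda>s. F s \<zeta>))"
  proof (rule Lp_le_integral[OF p, where \<beta> = "\<lambda>_. ?B"])
    show "continuous_on ({0..1} \<times> sphere 0 1) (\<lambda>(s, \<zeta>). F s \<zeta>)"
      unfolding F_def case_prod_unfold
      by (intro continuous_on_cderiv_compose[OF g open_ball])
         (use inb in \<open>auto simp: V_def intro!: continuous_intros cU\<close>)
    show "(\<integral>\<^sup>+ t\<in>{0::real<..<1}. ennreal ?B \<partial>lborel) \<le> ennreal ?B"
      by (simp add: nn_integral_cmult_indicator)
  qed (use Fb \<delta>0 K0 b0 in auto)
  have eq: "integral {0..1} (\<lambda>s. F s \<zeta>) = op_diff U g (r *\<^sub>R \<zeta>)" if \<zeta>: "norm \<zeta> = 1" for \<zeta>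
  proof -
    have "((\<lambda>s. g (r *\<^sub>R V s \<zeta>)) has_vector_derivative F s \<zeta>) (at s within {0..1})" if s: "s \<in> {0..1}" for s
    proof -
      have z: "r *\<^sub>R V s \<zeta> \<in> ball 0 1" using inb s \<zeta> by auto
      have "((\<lambda>s. r *\<^sub>R V s \<zeta>) has_derivative (\<lambda>h. h *\<^sub>R (r *\<^sub>R (U \<zeta> - \<zeta>)))) (at s)"
        unfolding V_def by (auto intro!: derivative_eq_intros simp: algebra_simps)
      from has_derivative_compose[OF this holomorphic_fun_onD(1)[OF g z]]
      have "((\<lambda>s. g (r *\<^sub>R V s \<zeta>)) has_derivative (\<lambda>h. cderiv g (r *\<^sub>R V s \<zeta>) (h *\<^sub>R (r *\<^sub>R (U \<zeta> - \<zeta>))))) (at s)" .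
      moreover have "cderiv g (r *\<^sub>R V s \<zeta>) (h *\<^sub>R (r *\<^sub>R (U \<zeta> - \<zeta>))) = h *\<^sub>R F s \<zeta>" for h
        using linear_scale[OF has_derivative_linear[OF holomorphic_fun_onD(1)[OF g z]]] by (simp add: F_def)
      ultimately have "((\<lambda>s. g (r *\<^sub>R V s \<zeta>)) has_vector_derivative F s \<zeta>) (at s)"
        by (simp add: has_vector_derivative_def)
      then show ?thesis by (rule has_vector_derivative_at_within)
    qed
    from integral_unique[OF fundamental_theorem_of_calculus[OF zero_le_one this]]
    show ?thesis by (simp add: op_diff_def V_def linear_scale[OF bounded_linear.linear[OF bl]])
  qed
  have "mean_le p r (op_diff U g) ?B"
    by (rule Lp_le_cong[THEN iffD1, OF _ L]) (simp add: space_sphere_measure eq)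
  then show ?thesis unfolding K .
qed

lemma holomorphic_fun_on_compose_ball_operator:
  assumes "holomorphic_fun_on g (ball 0 1)" "U \<in> ball_operators"
  shows "holomorphic_fun_on (\<lambda>z. g (U z)) (ball 0 1)"
  by (rule holomorphic_fun_on_compose_linear[OF assms(1)])
     (use assms(2) in \<open>simp_all add: ball_operators_def\<close>)

lemma holomorphic_fun_on_op_diff:
  assumes g: "holomorphic_fun_on g (ball 0 1)" and U: "U \<in> ball_operators"
  shows "holomorphic_fun_on (op_diff U g) (ball 0 1)"
  unfolding op_diff_def
  by (rule holomorphic_fun_on_diff[OF holomorphic_fun_on_compose_ball_operator[OF g U] g])

lemma radial_cong:
  assumes f: "holomorphic_fun_on f (ball 0 1)" and eq: "\<And>z. z \<in> ball 0 1 \<Longrightarrow> f z = g z" and z: "z \<in> ball 0 1"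
  shows "radial g z = radial f z"
  unfolding radial_def using cderiv_cong[OF f open_ball eq z] by simp

lemma radial_funpow_compose_ball_operator:
  assumes g: "holomorphic_fun_on g (ball 0 1)" and U: "U \<in> ball_operators" and z: "z \<in> ball 0 1"
  shows "(radial ^^ m) (\<lambda>z. g (U z)) z = (radial ^^ m) g (U z)"
  using z
proof (induction m arbitrary: z)
  case (Suc m)
  let ?g = "(radial ^^ m) g"
  have g': "holomorphic_fun_on ?g (ball 0 1)" by (rule holomorphic_fun_on_radial_funpow[OF g open_ball])
  have "radial ((radial ^^ m) (\<lambda>z. g (U z))) z = radial (\<lambda>z. ?g (U z)) z"
    by (rule radial_cong[OF holomorphic_fun_on_compose_ball_operator[OF g' U] _ Suc.prems])
       (simp add: Suc.IH)
  also have "\<dots> = radial ?g (U z)"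
    unfolding radial_def[of "\<lambda>z. ?g (U z)"] radial_def[of ?g] using U Suc.prems
    by (intro cderiv_compose_linear[OF g', where S = "ball 0 1"]) (simp_all add: ball_operators_def)
  finally show ?case by simp
qed simp

lemma radial_funpow_op_diff:
  assumes g: "holomorphic_fun_on g (ball 0 1)" and U: "U \<in> ball_operators" and z: "z \<in> ball 0 1"
  shows "(radial ^^ m) (op_diff U g) z = op_diff U ((radial ^^ m) g) z"
proof -
  have "(radial ^^ m) (\<lambda>z. h z - k z) z = (radial ^^ m) h z - (radial ^^ m) k z"
    if h: "holomorphic_fun_on h (ball 0 1)" and k: "holomorphic_fun_on k (ball 0 1)" for h k
    using z
  proof (induction m arbitrary: z)
    case (Suc m)
    let ?h = "(radial ^^ m) h" and ?k = "(radial ^^ m) k"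
    have h': "holomorphic_fun_on ?h (ball 0 1)" and k': "holomorphic_fun_on ?k (ball 0 1)"
      by (rule holomorphic_fun_on_radial_funpow[OF _ open_ball], fact)+
    have "radial ((radial ^^ m) (\<lambda>z. h z - k z)) z = radial (\<lambda>z. ?h z - ?k z) z"
      by (rule radial_cong[OF holomorphic_fun_on_diff[OF h' k'] _ Suc.prems]) (simp add: Suc.IH)
    also have "\<dots> = radial ?h z - radial ?k z"
      unfolding radial_def[of "\<lambda>z. ?h z - ?k z"] radial_def[of ?h] radial_def[of ?k]
      by (rule cderiv_diff[OF h' k' Suc.prems])
    finally show ?case by simp
  qed simp
  from this[OF holomorphic_fun_on_compose_ball_operator[OF g U] g]
  show ?thesis by (simp add: op_diff_def radial_funpow_compose_ball_operator[OF g U z])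
qed

text \<open>
  The differences commute with the radial derivative, so the first-order estimate can be applied in turn to
  \<open>h\<close> and its radial derivatives.
\<close>

lemma Lp_le_op_diff_funpow:
  fixes h :: "complex ^ 'd \<Rightarrow> complex"
  assumes p: "1 \<le> p" and h: "holomorphic_fun_on h (ball 0 1)" and r: "0 < r" "r < 1"
    and U: "U \<in> ball_operators" and \<delta>: "onorm (\<lambda>z. U z - z) \<le> \<delta>"
    and b: "mean_le p r ((radial ^^ m) h) b"
  shows "mean_le p r ((op_diff U ^^ m) h) ((diff_const TYPE('d) * \<delta>) ^ m * b)"
  using h b
proof (induction m arbitrary: h b)
  case (Suc m)
  let ?K = "diff_const TYPE('d) * \<delta>" and ?g = "(radial ^^ m) h"
  have g: "holomorphic_fun_on ?g (ball 0 1)" by (rule holomorphic_fun_on_radial_funpow[OF Suc.prems(1) open_ball])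
  have "mean_le p r (op_diff U ?g) (?K * b)"
    by (rule Lp_le_op_diff[OF p g r U \<delta>]) (use Suc.prems(2) in simp)
  then have "mean_le p r ((radial ^^ m) (op_diff U h)) (?K * b)"
    by (rule Lp_le_cong[THEN iffD2, rotated])
       (use r in \<open>simp add: space_sphere_measure radial_funpow_op_diff[OF Suc.prems(1) U]\<close>)
  from Suc.IH[OF holomorphic_fun_on_op_diff[OF Suc.prems(1) U] this]
  show ?case by (simp add: funpow_swap1 mult_ac)
qed simp

lemma holomorphic_fun_on_op_diff_funpow:
  assumes "holomorphic_fun_on g (ball 0 1)" "U \<in> ball_operators"
  shows "holomorphic_fun_on ((op_diff U ^^ m) g) (ball 0 1)"
  by (induction m) (auto simp: assms holomorphic_fun_on_op_diff)

lemma Lp_le_op_diff_funpow_trivial: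
  fixes h :: "complex ^ 'd \<Rightarrow> complex"
  assumes p: "1 \<le> p" and h: "holomorphic_fun_on h (ball 0 1)" and r: "0 < r" "r < 1"
    and U: "U \<in> ball_operators" and b: "mean_le p r h b"
  shows "mean_le p r ((op_diff U ^^ m) h) (2 ^ m * b)"
proof (induction m)
  case (Suc m)
  let ?h = "(op_diff U ^^ m) h"
  have lin: "linear U"
    using U by (auto simp: ball_operators_def intro!: bounded_linear.linear clinear_imp_bounded_linear)
  have "Lp_le sphere_measure p (2 ^ m * b + 2 ^ m * b) (\<lambda>\<zeta>. ?h (r *\<^sub>R U \<zeta>) - ?h (r *\<^sub>R \<zeta>))"
    by (intro Lp_le_add(2)[OF p finite_measure_sphere_measure]
        Lp_le_ball_operator[OF p holomorphic_fun_on_op_diff_funpow[OF h U] r U] Suc.IH)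
  moreover have "(op_diff U ^^ Suc m) h (r *\<^sub>R \<zeta>) = ?h (r *\<^sub>R U \<zeta>) - ?h (r *\<^sub>R \<zeta>)" for \<zeta>
    by (simp add: op_diff_def[of U ?h] linear_scale[OF lin])
  moreover have "2 ^ Suc m * b = 2 ^ m * b + 2 ^ m * b" by simp
  ultimately show ?case by presburger
qed (simp add: b)

lemma op_diff_funpow_add: "(op_diff U ^^ m) (\<lambda>z. f z + g z) = (\<lambda>z. (op_diff U ^^ m) f z + (op_diff U ^^ m) g z)"
  by (induction m) (simp_all add: op_diff_def algebra_simps fun_eq_iff)

lemma op_diff_funpow_sum: "(op_diff U ^^ m) (\<lambda>z. \<Sum>i\<in>I. f i z) = (\<lambda>z. \<Sum>i\<in>I. (op_diff U ^^ m) (f i) z)"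
  by (induction m) (simp_all add: op_diff_def sum_subtractf)

lemma op_diff_funpow_cmult: "(op_diff U ^^ m) (\<lambda>z. c * f z) = (\<lambda>z. c * (op_diff U ^^ m) f z)"
  by (induction m) (simp_all add: op_diff_def algebra_simps)

section \<open>Taylor's formula along rays\<close>

text \<open>
  The Taylor polynomial at \<open>\<rho> z\<close> in the variable \<open>ln t\<close>, in which \<open>radial\<close> is the derivative along the ray
  through \<open>z\<close>.
\<close>

definition radial_Taylor :: "nat \<Rightarrow> real \<Rightarrow> (complex ^ 'd \<Rightarrow> complex) \<Rightarrow> complex ^ 'd \<Rightarrow> complex" where
  "radial_Taylor n \<rho> f z = (\<Sum>j<n. of_real ((- ln \<rho>) ^ j / fact j) * (radial ^^ j) f (\<rho> *\<^sub>R z))"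

text \<open>
  As a function of \<open>\<rho>\<close> the Taylor polynomial has a derivative in which all terms but the last cancel.
\<close>

lemma radial_Taylor_remainder:
  assumes f: "holomorphic_fun_on f (ball 0 1)" and z: "norm z < 1" and \<rho>: "0 < \<rho>" "\<rho> < 1"
  shows "((\<lambda>t. of_real ((- ln t) ^ k / fact k / t) * (radial ^^ Suc k) f (t *\<^sub>R z)) has_integral
    f z - radial_Taylor (Suc k) \<rho> f z) {\<rho>..1}"
proof -
  define T where "T = (\<lambda>k t. of_real ((- ln t) ^ k / fact k / t) * (radial ^^ Suc k) f (t *\<^sub>R z))"
  have dR: "((\<lambda>t. (radial ^^ j) f (t *\<^sub>R z)) has_vector_derivative of_real (1 / t) * (radial ^^ Suc j) f (t *\<^sub>R z)) (at t)"
    if t: "0 < t" "t \<le> 1" for j t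
  proof -
    let ?h = "(radial ^^ j) f"
    have h: "holomorphic_fun_on ?h (ball 0 1)" by (rule holomorphic_fun_on_radial_funpow[OF f open_ball])
    have tz: "t *\<^sub>R z \<in> ball 0 1" using t z mult_left_le_one_le[of "norm z" t] by auto
    have lin: "linear (cderiv ?h (t *\<^sub>R z))" using holomorphic_fun_onD(1)[OF h tz] has_derivative_linear by blast
    have "(?h has_derivative cderiv ?h (t *\<^sub>R z)) (at (t *\<^sub>R z))" by (rule holomorphic_fun_onD(1)[OF h tz])
    then have "((\<lambda>t. ?h (t *\<^sub>R z)) has_derivative (\<lambda>s. cderiv ?h (t *\<^sub>R z) (s *\<^sub>R z))) (at t)"
      by (rule has_derivative_compose[rotated]) (auto intro!: derivative_eq_intros)
    moreover have "cderiv ?h (t *\<^sub>R z) (s *\<^sub>R z) = s *\<^sub>R (of_real (1 / t) * radial ?h (t *\<^sub>R z))" for s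
    proof -
      have e: "cderiv ?h (t *\<^sub>R z) (a *\<^sub>R z) = of_real a * cderiv ?h (t *\<^sub>R z) z" for a
        by (simp only: linear_scale[OF lin] scaleR_conv_of_real[where 'a=complex])
      show ?thesis
        using t unfolding radial_def[of ?h] e by (simp add: scaleR_conv_of_real[where 'a=complex])
    qed
    ultimately show ?thesis by (simp add: has_vector_derivative_def)
  qed
  have d: "((\<lambda>t. radial_Taylor (Suc k) t f z) has_vector_derivative T k t) (at t)"
    if t: "0 < t" "t \<le> 1" for t
  proof (induction k)
    case 0
    show ?case using dR[OF t, of 0] by (simp add: radial_Taylor_def T_def)
  next
    case (Suc k)
    have "((\<lambda>t. - ln t) has_real_derivative - (1 / t)) (at t)"
      using t by (auto intro!: derivative_eq_intros)
    from DERIV_cdivide[OF DERIV_power[OF this, of "Suc k"], of "fact (Suc k)"]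
    have "((\<lambda>t. (- ln t) ^ Suc k / fact (Suc k)) has_real_derivative
        (of_nat (Suc k) * (- (1 / t) * (- ln t) ^ k) / fact (Suc k))) (at t)"
      by (simp only: diff_Suc_Suc diff_zero)
    also have "of_nat (Suc k) * (- (1 / t) * (- ln t) ^ k) / fact (Suc k) = - ((- ln t) ^ k / fact k / t)"
      using t by (simp add: fact_Suc divide_simps del: of_nat_Suc)
    finally have "((\<lambda>t. (- ln t) ^ Suc k / fact (Suc k)) has_real_derivative - ((- ln t) ^ k / fact k / t)) (at t)" .
    then have "((\<lambda>t. complex_of_real ((- ln t) ^ Suc k / fact (Suc k))) has_vector_derivative
        of_real (- ((- ln t) ^ k / fact k / t))) (at t)"
      by (intro has_vector_derivative_of_real) (simp add: has_real_derivative_iff_has_vector_derivative)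
    from has_vector_derivative_mult[OF this dR[OF t, of "Suc k"]]
    have "((\<lambda>t. of_real ((- ln t) ^ Suc k / fact (Suc k)) * (radial ^^ Suc k) f (t *\<^sub>R z)) has_vector_derivative
        (T (Suc k) t - T k t)) (at t)"
      by (rule has_vector_derivative_eq_rhs) (simp add: T_def del: fact_Suc)
    from has_vector_derivative_add[OF Suc this]
    show ?case by (simp add: radial_Taylor_def del: fact_Suc)
  qed
  have "(T k has_integral radial_Taylor (Suc k) 1 f z - radial_Taylor (Suc k) \<rho> f z) {\<rho>..1}"
    by (rule fundamental_theorem_of_calculus) (use \<rho> d in \<open>auto intro: has_vector_derivative_at_within\<close>)
  moreover have "radial_Taylor (Suc k) 1 f z = f z"
    by (simp add: radial_Taylor_def lessThan_Suc_atMost sum.atMost_shift)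
  ultimately show ?thesis by (simp add: T_def)
qed

lemma neg_ln_bounds:
  assumes "1/2 \<le> t" "t \<le> (1::real)"
  shows "0 \<le> - ln t" "- ln t \<le> 2 * (1 - t)"
proof -
  show "0 \<le> - ln t" using assms by simp
  have "- ln t = ln (1 / t)" using assms by (simp add: ln_div)
  also have "\<dots> \<le> 1 / t - 1" using assms by (intro ln_le_minus_one) auto
  also have "\<dots> = (1 - t) / t" using assms by (simp add: field_simps)
  also have "\<dots> \<le> (1 - t) / (1 / 2)" using assms by (intro divide_left_mono) auto
  finally show "- ln t \<le> 2 * (1 - t)" by simp
qed

lemma Taylor_weight_bound:
  assumes t: "1/2 \<le> t" "t \<le> (1::real)"
  shows "0 \<le> (- ln t) ^ k / fact k / t" "(- ln t) ^ k / fact k / t \<le> 2 ^ Suc k * (1 - t) ^ k"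
proof -
  note l = neg_ln_bounds[OF t]
  show "0 \<le> (- ln t) ^ k / fact k / t" using l t by simp
  have "(- ln t) ^ k / fact k / t \<le> (- ln t) ^ k / 1 / (1 / 2)"
    using l t by (intro frac_le divide_left_mono) (auto simp: fact_ge_1)
  also have "\<dots> \<le> (2 * (1 - t)) ^ k / 1 / (1 / 2)"
    using l by (intro divide_right_mono power_mono) auto
  also have "\<dots> = 2 ^ Suc k * (1 - t) ^ k"
    by (simp only: power_mult_distrib power_Suc) simp
  finally show "(- ln t) ^ k / fact k / t \<le> 2 ^ Suc k * (1 - t) ^ k" .
qed

text \<open>
  Minkowski's inequality for the integral form of the remainder; on \<open>1/2 \<le> t \<le> 1\<close> the weight
  \<open>(- ln t)\<^sup>k / (k! t)\<close> is comparable with \<open>(1 - t)\<^sup>k\<close>.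
\<close>

lemma Lp_le_radial_Taylor_remainder:
  fixes f :: "complex ^ 'd \<Rightarrow> complex"
  assumes p: "1 \<le> p" and f: "holomorphic_fun_on f (ball 0 1)" and r: "0 < r" "r < 1"
    and \<rho>: "1/2 \<le> \<rho>" "\<rho> < 1" and M [measurable]: "M \<in> borel_measurable borel"
    and Mb: "\<And>t. 0 < t \<Longrightarrow> t < 1 \<Longrightarrow> mean_le p t ((radial ^^ Suc k) f) (M t)"
    and I: "(\<integral>\<^sup>+ t\<in>{\<rho><..<1}. ennreal ((1 - t) ^ k * M t) \<partial>lborel) \<le> ennreal I" "0 \<le> I"
  shows "Lp_le sphere_measure p (2 ^ Suc k * I) (\<lambda>\<zeta>. f (r *\<^sub>R \<zeta>) - radial_Taylor (Suc k) \<rho> f (r *\<^sub>R \<zeta>))"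
proof -
  let ?h = "(radial ^^ Suc k) f"
  have h: "holomorphic_fun_on ?h (ball 0 1)" by (rule holomorphic_fun_on_radial_funpow[OF f open_ball])
  define F where "F = (\<lambda>t \<zeta>. complex_of_real ((- ln t) ^ k / fact k / t) * ?h (t *\<^sub>R r *\<^sub>R \<zeta>))"
  have "Lp_le sphere_measure p (2 ^ Suc k * I) (\<lambda>\<zeta>. integral {\<rho>..1} (\<lambda>t. F t \<zeta>))"
  proof (rule Lp_le_integral[OF p, where \<beta> = "\<lambda>t. 2 ^ Suc k * ((1 - t) ^ k * M t)"])
    have "norm (t *\<^sub>R r *\<^sub>R \<zeta>) < 1" if "0 \<le> t" "t \<le> 1" "norm \<zeta> = 1" for t and \<zeta> :: "complex ^ 'd"
      using scaleR_mem_unit_ball[of "t *\<^sub>R \<zeta>" r] that r by (simp add: mult.commute)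
    then show "continuous_on ({\<rho>..1} \<times> sphere 0 1) (\<lambda>(t, \<zeta>). F t \<zeta>)"
      unfolding F_def case_prod_unfold using \<rho>
      by (intro continuous_intros continuous_on_compose2[OF holomorphic_fun_on_imp_continuous_on[OF h]]) auto
    fix t assume t: "\<rho> < t" "t < 1"
    then have t': "0 < t" "0 \<le> t" "1/2 \<le> t" "t \<le> 1" using \<rho> by auto
    have "Lp_le sphere_measure p (M t) (\<lambda>\<zeta>. ?h (t *\<^sub>R r *\<^sub>R \<zeta>))"
      by (rule Lp_le_ball_operator[OF p h t'(1) t(2) scaling_ball_operator Mb]) (use r t t' in auto)
    from Lp_le_cmult[OF p this, of "of_real ((- ln t) ^ k / fact k / t)"]
    have L: "Lp_le sphere_measure p ((- ln t) ^ k / fact k / t * M t) (F t)"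
      using Taylor_weight_bound(1)[OF t'(3,4), of k] unfolding norm_of_real F_def by (simp only: abs_of_nonneg)
    have "(- ln t) ^ k / fact k / t * M t \<le> 2 ^ Suc k * (1 - t) ^ k * M t"
      by (intro mult_right_mono Taylor_weight_bound(2) t' Lp_leD(1)[OF Mb]) (use t in auto)
    then show "Lp_le sphere_measure p (2 ^ Suc k * ((1 - t) ^ k * M t)) (F t)"
      by (intro Lp_le_mono[OF p L Lp_leD(2)[OF L]]) (auto simp: mult_ac)
  next
    have "(\<integral>\<^sup>+ t\<in>{\<rho><..<1}. ennreal (2 ^ Suc k * ((1 - t) ^ k * M t)) \<partial>lborel) =
        (\<integral>\<^sup>+ t. ennreal (2 ^ Suc k) * (ennreal ((1 - t) ^ k * M t) * indicator {\<rho><..<1} t) \<partial>lborel)"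
      by (intro nn_integral_cong) (simp add: ennreal_mult' mult.assoc del: power_Suc)
    also have "\<dots> = ennreal (2 ^ Suc k) * (\<integral>\<^sup>+ t\<in>{\<rho><..<1}. ennreal ((1 - t) ^ k * M t) \<partial>lborel)"
      by (rule nn_integral_cmult) measurable
    also have "\<dots> \<le> ennreal (2 ^ Suc k) * ennreal I" by (intro mult_left_mono I) auto
    also have "\<dots> = ennreal (2 ^ Suc k * I)" using I by (simp add: ennreal_mult' del: power_Suc)
    finally show "(\<integral>\<^sup>+ t\<in>{\<rho><..<1}. ennreal (2 ^ Suc k * ((1 - t) ^ k * M t)) \<partial>lborel) \<le> ennreal (2 ^ Suc k * I)" .
  qed (use I in auto)
  then show ?thesis
  proof (rule Lp_le_cong[THEN iffD1, rotated])
    fix \<zeta> :: "complex ^ 'd" assume "\<zeta> \<in> space sphere_measure"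
    then have "norm (r *\<^sub>R \<zeta>) < 1" using r by (simp add: space_sphere_measure)
    from integral_unique[OF radial_Taylor_remainder[OF f this, of \<rho> k]] \<rho>
    show "integral {\<rho>..1} (\<lambda>t. F t \<zeta>) = f (r *\<^sub>R \<zeta>) - radial_Taylor (Suc k) \<rho> f (r *\<^sub>R \<zeta>)"
      by (simp add: F_def)
  qed
qed

lemma holomorphic_fun_on_radial_Taylor:
  assumes f: "holomorphic_fun_on f (ball 0 1)" and \<rho>: "0 \<le> \<rho>" "\<rho> \<le> 1"
  shows "holomorphic_fun_on (radial_Taylor n \<rho> f) (ball 0 1)"
  unfolding radial_Taylor_def
  by (intro holomorphic_fun_on_sum holomorphic_fun_on_cmult
      holomorphic_fun_on_compose_ball_operator[OF _ scaling_ball_operator[OF \<rho>]]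
      holomorphic_fun_on_radial_funpow f open_ball)

text \<open>
  In the term of order \<open>j\<close> of the Taylor polynomial, \<open>n - j\<close> of the \<open>n\<close> differences are turned into
  radial derivatives, so that every term is bounded by \<open>\<delta>\<^sup>n\<close> times the mean of the \<open>n\<close>th radial derivative.
\<close>

lemma Lp_le_op_diff_radial_Taylor:
  fixes f :: "complex ^ 'd \<Rightarrow> complex"
  assumes p: "1 \<le> p" and f: "holomorphic_fun_on f (ball 0 1)" and r: "0 < r" "r < 1"
    and U: "U \<in> ball_operators" and \<delta>: "onorm (\<lambda>z. U z - z) \<le> \<delta>" "0 < \<delta>" "\<delta> < 1"
    and m: "mean_le p (1 - \<delta> / 2) ((radial ^^ n) f) m"
  shows "mean_le p r ((op_diff U ^^ n) (radial_Taylor n (1 - \<delta> / 2) f)) (real n * ((2 + diff_const TYPE('d)) * \<delta>) ^ n * m)"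
proof -
  define \<rho> where "\<rho> = 1 - \<delta> / 2"
  have \<rho>: "1/2 \<le> \<rho>" "0 < \<rho>" "\<rho> < 1" "0 \<le> \<rho>" "\<rho> \<le> 1" using \<delta> by (auto simp: \<rho>_def)
  let ?K = "diff_const TYPE('d)"
  have K: "?K \<ge> 0" by (simp add: diff_const_def)
  have m0: "m \<ge> 0" using Lp_leD(1)[OF m] .
  have hn: "holomorphic_fun_on ((radial ^^ j) f) (ball 0 1)" for j
    by (rule holomorphic_fun_on_radial_funpow[OF f open_ball])
  define h where "h = (\<lambda>j z. (radial ^^ j) f (\<rho> *\<^sub>R z))"
  have h: "holomorphic_fun_on (h j) (ball 0 1)" for j
    unfolding h_def by (rule holomorphic_fun_on_compose_ball_operator[OF hn scaling_ball_operator[OF \<rho>(4,5)]])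
  define c where "c = (\<lambda>j. (- ln \<rho>) ^ j / fact j)"
  have c: "0 \<le> c j" "c j \<le> \<delta> ^ j" for j
  proof -
    have l: "0 \<le> - ln \<rho>" "- ln \<rho> \<le> \<delta>" using neg_ln_bounds[OF \<rho>(1,5)] by (auto simp: \<rho>_def)
    show "0 \<le> c j" using l by (simp add: c_def)
    have "c j \<le> (- ln \<rho>) ^ j / 1"
      unfolding c_def using l by (intro divide_left_mono) (auto simp: fact_ge_1)
    also have "\<dots> \<le> \<delta> ^ j" using l by (simp add: power_mono)
    finally show "c j \<le> \<delta> ^ j" .
  qed
  have summand: "Lp_le sphere_measure p (((2 + ?K) * \<delta>) ^ n * m) (\<lambda>\<zeta>. of_real (c j) * (op_diff U ^^ n) (h j) (r *\<^sub>R \<zeta>))"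
    if j: "j < n" for j
  proof -
    have "Lp_le sphere_measure p m (\<lambda>\<zeta>. (radial ^^ n) f (\<rho> *\<^sub>R r *\<^sub>R \<zeta>))"
      by (rule Lp_le_ball_operator[OF p hn \<rho>(2,3) scaling_ball_operator]) (use r m in \<open>auto simp: \<rho>_def\<close>)
    then have "mean_le p r ((radial ^^ (n - j)) (h j)) m"
    proof (rule Lp_le_cong[THEN iffD1, rotated])
      fix \<zeta> :: "complex ^ 'd" assume "\<zeta> \<in> space sphere_measure"
      then have z: "r *\<^sub>R \<zeta> \<in> ball 0 1" using r by (simp add: space_sphere_measure)
      have "(radial ^^ (n - j)) ((radial ^^ j) f) = (radial ^^ n) f"
        using j by (metis funpow_add comp_apply le_add_diff_inverse2 less_imp_le)
      then show "(radial ^^ n) f (\<rho> *\<^sub>R r *\<^sub>R \<zeta>) = (radial ^^ (n - j)) (h j) (r *\<^sub>R \<zeta>)"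
        unfolding h_def radial_funpow_compose_ball_operator[OF hn scaling_ball_operator[OF \<rho>(4,5)] z] by simp
    qed
    from Lp_le_op_diff_funpow[OF p h r U \<delta>(1) this]
    have "mean_le p r ((op_diff U ^^ (n - j)) (h j)) ((?K * \<delta>) ^ (n - j) * m)" .
    from Lp_le_op_diff_funpow_trivial[OF p holomorphic_fun_on_op_diff_funpow[OF h U] r U this, of j]
    have "mean_le p r ((op_diff U ^^ j) ((op_diff U ^^ (n - j)) (h j))) (2 ^ j * ((?K * \<delta>) ^ (n - j) * m))" .
    moreover have "(op_diff U ^^ j) ((op_diff U ^^ (n - j)) (h j)) = (op_diff U ^^ n) (h j)"
      using j by (metis funpow_add comp_apply le_add_diff_inverse less_imp_le)
    ultimately have "mean_le p r ((op_diff U ^^ n) (h j)) (2 ^ j * ((?K * \<delta>) ^ (n - j) * m))"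
      by simp
    from Lp_le_cmult[OF p this, of "of_real (c j)"]
    have L: "Lp_le sphere_measure p (c j * (2 ^ j * ((?K * \<delta>) ^ (n - j) * m)))
        (\<lambda>\<zeta>. of_real (c j) * (op_diff U ^^ n) (h j) (r *\<^sub>R \<zeta>))" using c by simp
    have "c j * (2 ^ j * ((?K * \<delta>) ^ (n - j) * m)) \<le> \<delta> ^ j * ((2 + ?K) ^ j * (((2 + ?K) * \<delta>) ^ (n - j) * m))"
      using c[of j] K \<delta> m0 by (intro mult_mono power_mono mult_nonneg_nonneg zero_le_power) auto
    also have "\<dots> = ((2 + ?K) * \<delta>) ^ j * ((2 + ?K) * \<delta>) ^ (n - j) * m"
      by (simp add: power_mult_distrib mult_ac)
    also have "\<dots> = ((2 + ?K) * \<delta>) ^ n * m"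
      using j by (simp add: power_add[symmetric])
    finally show ?thesis by (intro Lp_le_mono[OF p L Lp_leD(2)[OF L]]) auto
  qed
  have eq: "(op_diff U ^^ n) (radial_Taylor n \<rho> f) = (\<lambda>z. \<Sum>j<n. of_real (c j) * (op_diff U ^^ n) (h j) z)"
    unfolding radial_Taylor_def[abs_def] c_def h_def op_diff_funpow_sum op_diff_funpow_cmult ..
  have "mean_le p r ((op_diff U ^^ n) (radial_Taylor n \<rho> f)) (\<Sum>j<n. ((2 + ?K) * \<delta>) ^ n * m)"
  proof (rule Lp_le_sum[OF p finite_measure_sphere_measure, where u = "\<lambda>j \<zeta>. of_real (c j) * (op_diff U ^^ n) (h j) (r *\<^sub>R \<zeta>)"])
    have "continuous_on (ball 0 1) ((op_diff U ^^ n) (radial_Taylor n \<rho> f))"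
      by (intro holomorphic_fun_on_imp_continuous_on holomorphic_fun_on_op_diff_funpow holomorphic_fun_on_radial_Taylor f U \<rho>)
    then have "continuous_on (sphere 0 1) (\<lambda>\<zeta>. (op_diff U ^^ n) (radial_Taylor n \<rho> f) (r *\<^sub>R \<zeta>))"
      by (rule continuous_on_compose2) (use r in \<open>auto intro!: continuous_intros\<close>)
    then show "(\<lambda>\<zeta>. (op_diff U ^^ n) (radial_Taylor n \<rho> f) (r *\<^sub>R \<zeta>)) \<in> borel_measurable sphere_measure"
      by (rule borel_measurable_sphere_measure)
  qed (use summand in \<open>auto simp: eq norm_sum\<close>)
  then show ?thesis by (simp add: \<rho>_def mult.assoc)
qed

section \<open>The modulus of smoothness\<close>

theorem theorem1p6:
  fixes n :: nat and p :: ennreal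
  assumes "n \<ge> 1" and "1 \<le> p"
  shows "\<exists>C::real. \<forall>f :: complex ^ 'd \<Rightarrow> complex.
           holomorphic_fun_on f (ball 0 1) \<longrightarrow>
           (\<integral>\<^sup>+ r\<in>{0<..<1}. (ennreal ((1 - r) ^ (n - 1)) * integral_mean p r (radial_deriv n f)) \<partial>lborel) < \<top> \<longrightarrow>
           f \<in> hardy_space p \<and>
           (\<forall>\<delta>. 0 < \<delta> \<and> \<delta> < 1 \<longrightarrow>
              modulus_plus n \<delta> f p \<le>
                ennreal C * (\<integral>\<^sup>+ r\<in>{1 - \<delta><..<1}. (integral_mean p r (radial_deriv n f) * ennreal ((1 - r) ^ (n - 1))) \<partial>lborel))"
proof -
  note p = assms(2)
  obtain k where n: "n = Suc k" using assms(1) by (cases n) auto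
  let ?K = "diff_const TYPE('d)"
  define C where "C = real n * (2 + ?K) ^ n * (2 ^ n * real n) + 2 ^ n * 2 ^ n"
  have K: "?K \<ge> 0" by (simp add: diff_const_def)
  have C: "C \<ge> 0" using K by (simp add: C_def)
  show ?thesis
  proof (intro exI[of _ C] allI impI)
    fix f :: "complex ^ 'd \<Rightarrow> complex"
    assume f: "holomorphic_fun_on f (ball 0 1)"
      and fin: "(\<integral>\<^sup>+ r\<in>{0<..<1}. (ennreal ((1 - r) ^ (n - 1)) * integral_mean p r (radial_deriv n f)) \<partial>lborel) < \<top>"
    let ?h = "(radial ^^ n) f"
    have h: "holomorphic_fun_on ?h (ball 0 1)" by (rule holomorphic_fun_on_radial_funpow[OF f open_ball])
    have cont: "continuous_on (sphere 0 1) (\<lambda>\<zeta>. g (t *\<^sub>R \<zeta>))"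
      if "holomorphic_fun_on g (ball 0 1)" "0 < t" "t < 1" for g :: "complex ^ 'd \<Rightarrow> complex" and t
      by (rule continuous_on_compose2[OF holomorphic_fun_on_imp_continuous_on[OF that(1)]])
         (use that(2,3) in \<open>auto intro!: continuous_intros\<close>)
    \<comment> \<open>Extended by 0, which makes it Borel measurable on the whole line: on \<open>(0, 1)\<close> it is monotone.\<close>
    define M where "M = (\<lambda>t. if t \<in> {0<..<1} then Lp_norm p (\<lambda>\<zeta>. ?h (t *\<^sub>R \<zeta>)) else 0)"
    have M0: "0 \<le> M t" for t by (simp add: M_def Lp_norm_nonneg)
    have Mb: "mean_le p t ?h (M t)" if "0 < t" "t < 1" for t
      using Lp_le_Lp_norm[OF p cont[OF h that]] that by (simp add: M_def)
    have Mle: "M t \<le> b" if "0 < t" "t < 1" "mean_le p t ?h b" for t b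
      using Lp_norm_le_iff[OF p cont[OF h that(1,2)] Lp_leD(1)[OF that(3)]] that by (simp add: M_def)
    have mono: "M s \<le> M t" if "0 < s" "s \<le> t" "t < 1" for s t
    proof (rule Mle)
      have t: "0 < t" "t < 1" using that by auto
      have "Lp_le sphere_measure p (M t) (\<lambda>\<zeta>. ?h (t *\<^sub>R (s / t) *\<^sub>R \<zeta>))"
        by (rule Lp_le_ball_operator[OF p h t scaling_ball_operator Mb[OF t]]) (use that in auto)
      then show "mean_le p s ?h (M t)" using t by simp
    qed (use that in auto)
    have Mm [measurable]: "M \<in> borel_measurable borel"
    proof -
      have "mono_on {0<..<1} M" by (rule mono_onI) (use mono in auto)
      then have "M \<in> borel_measurable (restrict_space borel {0<..<1})" by (rule borel_measurable_mono_on_fnc)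
      then have "(\<lambda>t. indicator {0<..<1} t *\<^sub>R M t) \<in> borel_measurable borel"
        by (subst (asm) borel_measurable_restrict_space_iff) auto
      moreover have "(\<lambda>t. indicator {0<..<1} t *\<^sub>R M t) = M" by (auto simp: M_def indicator_def)
      ultimately show ?thesis by simp
    qed
    have mean: "integral_mean p t (radial_deriv n f) = ennreal (M t)" if t: "0 < t" "t < 1" for t
    proof -
      have eq: "radial_deriv n f (t *\<^sub>R \<zeta>) = ?h (t *\<^sub>R \<zeta>)" if "\<zeta> \<in> sphere 0 1" for \<zeta>
        using radial_deriv_eq_funpow[OF f _ assms(1), of "t *\<^sub>R \<zeta>"] that t by simp
      have c: "continuous_on (sphere 0 1) (\<lambda>\<zeta>. radial_deriv n f (t *\<^sub>R \<zeta>))"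
        using cont[OF h t] eq by (simp cong: continuous_on_cong_simp)
      have "integral_mean p t (radial_deriv n f) \<le> ennreal b \<longleftrightarrow> M t \<le> b" if b: "0 \<le> b" for b
      proof -
        have "mean_le p t (radial_deriv n f) b \<longleftrightarrow> mean_le p t ?h b"
          by (rule Lp_le_cong) (simp add: eq space_sphere_measure)
        then show ?thesis
          using integral_mean_le_iff[OF p b c] Lp_norm_le_iff[OF p cont[OF h t] b] t by (simp add: M_def)
      qed
      note * = this
      have le: "integral_mean p t (radial_deriv n f) \<le> ennreal (M t)" using *[OF M0] by simp
      then obtain x where x: "integral_mean p t (radial_deriv n f) = ennreal x" "0 \<le> x"
        by (cases "integral_mean p t (radial_deriv n f)") (auto simp: top_unique)
      have "M t \<le> x" using *[OF x(2)] x by simp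
      then show ?thesis using le x by (intro antisym) (auto simp: ennreal_leI)
    qed
    define J where "J = (\<lambda>\<delta>. \<integral>\<^sup>+ t\<in>{1 - \<delta><..<1}. ennreal ((1 - t) ^ k * M t) \<partial>lborel)"
    have J_eq: "(\<integral>\<^sup>+ r\<in>{1 - \<delta><..<1}. (integral_mean p r (radial_deriv n f) * ennreal ((1 - r) ^ (n - 1))) \<partial>lborel) = J \<delta>"
      if "\<delta> \<le> 1" for \<delta>
      unfolding J_def
    proof (rule nn_integral_cong)
      fix t :: real
      show "integral_mean p t (radial_deriv n f) * ennreal ((1 - t) ^ (n - 1)) * indicator {1 - \<delta><..<1} t =
          ennreal ((1 - t) ^ k * M t) * indicator {1 - \<delta><..<1} t"
        using mean[of t] that M0[of t] by (auto simp: indicator_def n ennreal_mult' mult.commute)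
    qed
    have J_mono: "J \<delta> \<le> J \<epsilon>" if "\<delta> \<le> \<epsilon>" for \<delta> \<epsilon>
      unfolding J_def using that by (intro nn_integral_mono) (auto simp: indicator_def)
    have "J 1 < \<top>" using fin J_eq[of 1] by (simp add: mult.commute)
    then have Jfin: "\<exists>j\<ge>0. J \<delta> = ennreal j" if "\<delta> \<le> 1" for \<delta>
      using J_mono[OF that] by (cases "J \<delta>") (auto simp: top_unique)
    have rem: "Lp_le sphere_measure p (2 ^ n * j) (\<lambda>\<zeta>. f (r *\<^sub>R \<zeta>) - radial_Taylor n (1 - \<delta>) f (r *\<^sub>R \<zeta>))"
      if r: "0 < r" "r < 1" and \<delta>: "0 < \<delta>" "\<delta> \<le> 1/2" and j: "J \<delta> = ennreal j" "0 \<le> j" for r \<delta> j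
      unfolding n using \<delta> j Mb
      by (intro Lp_le_radial_Taylor_remainder[OF p f r _ _ Mm]) (auto simp: J_def n)
    \<comment> \<open>Taylor's formula at radius 1/2, where the Taylor polynomial is a bounded function.\<close>
    have "f \<in> hardy_space p"
    proof -
      obtain j where j: "0 \<le> j" "J (1/2) = ennreal j" using Jfin[of "1/2"] by auto
      let ?T = "radial_Taylor n (1 - 1/2) f"
      have "\<exists>b\<ge>0. \<forall>z\<in>ball 0 1. norm (?T z) \<le> b"
      proof -
        have "\<exists>b. \<forall>z\<in>ball 0 1. norm ((radial ^^ i) f ((1 - 1/2) *\<^sub>R z)) \<le> b" for i
        proof -
          have "continuous_on (cball 0 (1/2)) ((radial ^^ i) f)"
            by (rule continuous_on_subset[OF holomorphic_fun_on_imp_continuous_on[OF holomorphic_fun_on_radial_funpow[OF f open_ball]]]) auto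
          then have "bounded ((radial ^^ i) f ` cball 0 (1/2))"
            by (intro compact_imp_bounded compact_continuous_image compact_cball)
          then obtain b where "\<And>w. w \<in> cball 0 (1/2) \<Longrightarrow> norm ((radial ^^ i) f w) \<le> b"
            unfolding bounded_iff by blast
          then show ?thesis by (intro exI[of _ b]) auto
        qed
        then obtain b where b: "\<And>i z. z \<in> ball 0 1 \<Longrightarrow> norm ((radial ^^ i) f ((1 - 1/2) *\<^sub>R z)) \<le> b i" by metis
        define B where "B = (\<Sum>i<n. \<bar>(- ln (1 - 1/2)) ^ i / fact i\<bar> * b i)"
        have le: "norm (?T z) \<le> B" if "z \<in> ball 0 1" for z
          unfolding radial_Taylor_def B_def
          by (rule order_trans[OF norm_sum], intro sum_mono, subst norm_mult, subst norm_of_real)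
             (intro mult_left_mono b that abs_ge_zero)
        have "B \<ge> 0" using order_trans[OF norm_ge_zero le[of 0]] by simp
        with le show ?thesis by blast
      qed
      then obtain b where b: "b \<ge> 0" "\<And>z. z \<in> ball 0 1 \<Longrightarrow> norm (?T z) \<le> b" by blast
      have "integral_mean p r f \<le> ennreal (2 ^ n * j + b)" if r: "r \<in> {0<..<1}" for r
      proof -
        have r': "0 < r" "r < 1" using r by auto
        have "holomorphic_fun_on ?T (ball 0 1)" by (rule holomorphic_fun_on_radial_Taylor[OF f]) auto
        then have "mean_le p r ?T b"
          using b r' by (intro Lp_le_cball_bound[OF p cont]) auto
        from Lp_le_add(1)[OF p finite_measure_sphere_measure rem[OF r' _ _ j(2,1)] this]
        have "mean_le p r f (2 ^ n * j + b)" by simp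
        then show ?thesis
          by (intro integral_mean_le_iff[OF p _ cont[OF f r'], THEN iffD2]) (use b j in auto)
      qed
      then have "hardy_norm p f \<le> ennreal (2 ^ n * j + b)"
        unfolding hardy_norm_def by (rule SUP_least)
      then have "hardy_norm p f < \<top>" using le_less_trans ennreal_less_top by blast
      then show ?thesis using f by (simp add: hardy_space_def)
    qed
    moreover have "modulus_plus n \<delta> f p \<le> ennreal C * J \<delta>" if \<delta>: "0 < \<delta>" "\<delta> < 1" for \<delta>
    proof -
      obtain j where j: "0 \<le> j" "J \<delta> = ennreal j" using Jfin[of \<delta>] \<delta> by auto
      obtain i where i: "0 \<le> i" "J (\<delta>/2) = ennreal i" using Jfin[of "\<delta>/2"] \<delta> by auto
      have ij: "i \<le> j" using J_mono[of "\<delta>/2" \<delta>] i j \<delta> by simp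
      \<comment> \<open>Halving \<open>\<delta>\<close> keeps \<open>\<rho>\<close> above 1/2 even for \<open>\<delta>\<close> close to 1.\<close>
      define \<rho> where "\<rho> = 1 - \<delta> / 2"
      have \<rho>: "0 < \<rho>" "\<rho> < 1" using \<delta> by (auto simp: \<rho>_def)
      have M\<rho>: "\<delta> ^ n * M \<rho> \<le> 2 ^ n * real n * i"
      proof -
        have "((\<lambda>t. (1 - t) ^ k) has_integral (- ((1 - 1) ^ n / real n) - (- ((1 - \<rho>) ^ n / real n)))) {\<rho>..1}"
        proof (rule fundamental_theorem_of_calculus)
          fix t :: real
          have "((\<lambda>t. - ((1 - t) ^ n / real n)) has_real_derivative (1 - t) ^ k) (at t)"
            unfolding n by (auto intro!: derivative_eq_intros simp: divide_simps simp del: power_Suc of_nat_Suc)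
          then show "((\<lambda>t. - ((1 - t) ^ n / real n)) has_vector_derivative (1 - t) ^ k) (at t within {\<rho>..1})"
            by (simp add: has_real_derivative_iff_has_vector_derivative has_vector_derivative_at_within)
        qed (use \<rho> in simp)
        moreover have "- ((1 - 1) ^ n / real n) - (- ((1 - \<rho>) ^ n / real n)) = (\<delta> / 2) ^ n / real n"
          by (simp add: n \<rho>_def)
        ultimately have "((\<lambda>t. (1 - t) ^ k * M \<rho>) has_integral ((\<delta> / 2) ^ n / real n * M \<rho>)) {\<rho>..1}"
          by (intro has_integral_mult_left) simp
        then have int: "((\<lambda>t. \<bar>1 - t\<bar> ^ k * M \<rho>) has_integral ((\<delta> / 2) ^ n / real n * M \<rho>)) {\<rho><..<1}"
          unfolding has_integral_Icc_iff_Ioo[symmetric]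
          by (rule has_integral_eq[rotated]) auto
        have "ennreal ((\<delta> / 2) ^ n / real n * M \<rho>) = (\<integral>\<^sup>+ t. ennreal (indicator {\<rho><..<1} t * (\<bar>1 - t\<bar> ^ k * M \<rho>)) \<partial>lborel)"
          by (rule nn_integral_has_integral_lebesgue[symmetric, OF _ int]) (simp add: M0)
        also have "\<dots> \<le> J (\<delta> / 2)"
          unfolding J_def
        proof (rule nn_integral_mono)
          fix t :: real
          have "(1 - t) ^ k * M \<rho> \<le> (1 - t) ^ k * M t" if "\<rho> < t" "t < 1"
            using that \<rho> by (intro mult_left_mono mono) auto
          then show "ennreal (indicator {\<rho><..<1} t * (\<bar>1 - t\<bar> ^ k * M \<rho>)) \<le> ennreal ((1 - t) ^ k * M t) * indicator {1 - \<delta> / 2<..<1} t"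
            by (auto simp: indicator_def \<rho>_def intro!: ennreal_leI)
        qed
        finally have "(\<delta> / 2) ^ n / real n * M \<rho> \<le> i" using i by simp
        then have "(\<delta> / 2) ^ n / real n * M \<rho> * (2 ^ n * real n) \<le> i * (2 ^ n * real n)"
          by (rule mult_right_mono) simp
        moreover have "(\<delta> / 2) ^ n / real n * M \<rho> * (2 ^ n * real n) = \<delta> ^ n * M \<rho>"
          using assms(1) by (simp add: power_divide)
        ultimately show ?thesis by (simp add: mult_ac)
      qed
      have "integral_mean p r ((op_diff U ^^ n) f) \<le> ennreal (C * j)"
        if U: "U \<in> ball_operators" "onorm (\<lambda>z. U z - z) < \<delta>" and r: "r \<in> {0<..<1}" for U r
      proof -
        have r': "0 < r" "r < 1" using r by auto
        let ?T = "radial_Taylor n (1 - \<delta>/2) f"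
        have T: "holomorphic_fun_on ?T (ball 0 1)" by (rule holomorphic_fun_on_radial_Taylor[OF f]) (use \<delta> in auto)
        have rest: "holomorphic_fun_on (\<lambda>z. f z - ?T z) (ball 0 1)" by (rule holomorphic_fun_on_diff[OF f T])
        have "mean_le p r ((op_diff U ^^ n) (\<lambda>z. f z - ?T z)) (2 ^ n * (2 ^ n * i))"
          by (rule Lp_le_op_diff_funpow_trivial[OF p rest r' U(1) rem[OF r']]) (use \<delta> i in auto)
        moreover have "mean_le p r ((op_diff U ^^ n) ?T) (real n * ((2 + ?K) * \<delta>) ^ n * M \<rho>)"
          using U \<delta> Mb[OF \<rho>] by (intro Lp_le_op_diff_radial_Taylor[OF p f r']) (auto simp: \<rho>_def)
        ultimately have "Lp_le sphere_measure p (2 ^ n * (2 ^ n * i) + real n * ((2 + ?K) * \<delta>) ^ n * M \<rho>)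
            (\<lambda>\<zeta>. (op_diff U ^^ n) (\<lambda>z. f z - ?T z) (r *\<^sub>R \<zeta>) + (op_diff U ^^ n) ?T (r *\<^sub>R \<zeta>))"
          by (rule Lp_le_add(1)[OF p finite_measure_sphere_measure])
        moreover have "(op_diff U ^^ n) f = (\<lambda>z. (op_diff U ^^ n) (\<lambda>z. f z - ?T z) z + (op_diff U ^^ n) ?T z)"
          by (subst op_diff_funpow_add[symmetric]) simp
        ultimately have L: "mean_le p r ((op_diff U ^^ n) f) (2 ^ n * (2 ^ n * i) + real n * ((2 + ?K) * \<delta>) ^ n * M \<rho>)" by simp
        have "real n * ((2 + ?K) * \<delta>) ^ n * M \<rho> = real n * (2 + ?K) ^ n * (\<delta> ^ n * M \<rho>)"
          by (simp add: power_mult_distrib)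
        also have "\<dots> \<le> real n * (2 + ?K) ^ n * (2 ^ n * real n * i)"
          using K by (intro mult_left_mono M\<rho>) auto
        finally have "2 ^ n * (2 ^ n * i) + real n * ((2 + ?K) * \<delta>) ^ n * M \<rho> \<le> C * i"
          by (simp add: C_def algebra_simps)
        also have "\<dots> \<le> C * j" using C ij by (rule mult_left_mono[rotated])
        finally have "mean_le p r ((op_diff U ^^ n) f) (C * j)"
          by (intro Lp_le_mono[OF p L Lp_leD(2)[OF L]]) auto
        then show ?thesis
          using integral_mean_le_iff[OF p _ cont[OF holomorphic_fun_on_op_diff_funpow[OF f U(1)] r']] C j by simp
      qed
      then have "modulus_plus n \<delta> f p \<le> ennreal (C * j)"
        unfolding modulus_plus_def hardy_norm_def by (intro SUP_least) auto
      then show ?thesis using C j by (simp add: ennreal_mult')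
    qed
    ultimately show "f \<in> hardy_space p \<and>
           (\<forall>\<delta>. 0 < \<delta> \<and> \<delta> < 1 \<longrightarrow>
              modulus_plus n \<delta> f p \<le>
                ennreal C * (\<integral>\<^sup>+ r\<in>{1 - \<delta><..<1}. (integral_mean p r (radial_deriv n f) * ennreal ((1 - r) ^ (n - 1))) \<partial>lborel))"
      using J_eq by simp
  qed
qed

end
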